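(* Let $\Omega\subset\mathbb{R}^2$ be an open bounded domain with Lipschitz boundary $C=\partial\Omega$, let $p\in C$ and $r>0$, and let $\mathbf{V}(x)=\frac12(x-p)$. Suppose that $C$ meets the circle $\partial D_r(p)$ in finitely many points. Ignoring those intersection points near which $C$ remains on one side of the circle, suppose the remaining intersections occur at angles $\theta_1<\theta_2<\cdots<\theta_{2k}$ (with $k\ge1$ and $\theta_{2k}<\theta_1+2\pi$), where the point at angle $\theta$ on the circle is $p+r(\cos\theta,\sin\theta)$, labeled so that, apart from the ignored points, the circular arcs $\theta_{2i-1}<\theta<\theta_{2i}$, $i=1,\dots,k$, lie in $\Omega$ and the complementary open arcs of the circle lie outside $\Omega$. Then $$A_{C,r}(p)=\int_{C\cap D_r(p)}\mathbf{V}\cdot\nu\,ds+\frac{r^2}{2}\sum_{i=1}^k(\theta_{2i}-\theta_{2i-1}).$$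
   Context: $D_r(p)$ is the disk of radius $r$ centered at $p$ in $\mathbb{R}^2$, $\nu$ is the unit outward normal to $\Omega$ along $C$ (defined almost everywhere), and $ds$ is arc length. The circular area invariant $A_{C,r}(p)$ is the area (Lebesgue measure) of $D_r(p)\cap\Omega$. *)

theory Defs
  imports "HOL-Analysis.Analysis"
begin

text \<open>
  A set has Lipschitz boundary if around each of its boundary points, in suitable Cartesian
  coordinates with orthonormal axes \<open>u\<close>, \<open>v\<close> and inside a small open rectangle, the set is the
  strict subgraph of a Lipschitz function \<open>g\<close> and its boundary is the graph of \<open>g\<close>.
\<close>

definition lipschitz_boundary :: "(real^2) set \<Rightarrow> bool" where
  "lipschitz_boundary \<Omega> \<longleftrightarrow>
     (\<forall>q\<in>frontier \<Omega>. \<exists>u v a b L. \<exists>g :: real \<Rightarrow> real.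
        norm u = 1 \<and> norm v = 1 \<and> u \<bullet> v = 0 \<and> 0 < a \<and> 0 < b \<and>
        L-lipschitz_on {-a<..<a} g \<and> (\<forall>s\<in>{-a<..<a}. \<bar>g s\<bar> < b) \<and>
        (\<forall>s\<in>{-a<..<a}. \<forall>t\<in>{-b<..<b}.
           (q + s *\<^sub>R u + t *\<^sub>R v \<in> \<Omega> \<longleftrightarrow> t < g s) \<and>
           (q + s *\<^sub>R u + t *\<^sub>R v \<in> frontier \<Omega> \<longleftrightarrow> t = g s)))"

text \<open>
  Arc length on subsets of a metric space is the one-dimensional Hausdorff measure. In dimension
  one the normalising constant is 1: a set is weighted by its diameter. Boundedness of the covering
  sets is required explicitly because \<^const>\<open>diameter\<close> is unspecified on unbounded sets.
\<close>

definition hausdorff1_premeasure :: "real \<Rightarrow> 'a::metric_space set \<Rightarrow> ennreal" where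
  "hausdorff1_premeasure \<delta> A =
     (INF E \<in> {E :: nat \<Rightarrow> 'a set. A \<subseteq> (\<Union>i. E i) \<and> (\<forall>i. bounded (E i) \<and> diameter (E i) \<le> \<delta>)}.
        \<Sum>i. ennreal (diameter (E i)))"

definition hausdorff1_outer :: "'a::metric_space set \<Rightarrow> ennreal" where
  "hausdorff1_outer A = (SUP \<delta>\<in>{0<..}. hausdorff1_premeasure \<delta> A)"

text \<open>
  This is a metric outer measure, hence countably additive on the Borel sets, so that
  \<^const>\<open>measure_of\<close> does not fall back to the null measure.
\<close>

definition arc_length :: "'a::metric_space measure" where
  "arc_length = measure_of UNIV (sets borel) hausdorff1_outer"

text \<open>
  The vector \<open>n\<close> is an outward unit normal at \<open>x\<close> if it is orthogonal to the tangent line of the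
  boundary at \<open>x\<close> (directions of secants through \<open>x\<close> become orthogonal to \<open>n\<close>) and points out of
  \<open>\<Omega>\<close>.
\<close>

definition is_outward_unit_normal :: "(real^2) set \<Rightarrow> real^2 \<Rightarrow> real^2 \<Rightarrow> bool" where
  "is_outward_unit_normal \<Omega> x n \<longleftrightarrow>
     norm n = 1 \<and>
     ((\<lambda>y. ((y - x) \<bullet> n) / norm (y - x)) \<longlongrightarrow> 0) (at x within frontier \<Omega>) \<and>
     (\<forall>\<^sub>F t in at_right 0. x + t *\<^sub>R n \<notin> closure \<Omega> \<and> x - t *\<^sub>R n \<in> \<Omega>)"

text \<open>
  For a set with Lipschitz boundary the normal exists at almost every boundary point and is unique
  where it exists; elsewhere the value is 0 by convention.
\<close>

definition outward_unit_normal :: "(real^2) set \<Rightarrow> real^2 \<Rightarrow> real^2" where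
  "outward_unit_normal \<Omega> x =
     (if \<exists>n. is_outward_unit_normal \<Omega> x n then THE n. is_outward_unit_normal \<Omega> x n else 0)"

definition circular_area_invariant :: "(real^2) set \<Rightarrow> real \<Rightarrow> real^2 \<Rightarrow> real" where
  "circular_area_invariant \<Omega> r p = measure lebesgue (cball p r \<inter> \<Omega>)"

definition circle_point :: "real^2 \<Rightarrow> real \<Rightarrow> real \<Rightarrow> real^2" where
  "circle_point p r t = p + r *\<^sub>R vector [cos t, sin t]"

definition one_sided_at :: "(real^2) set \<Rightarrow> real^2 \<Rightarrow> real \<Rightarrow> real^2 \<Rightarrow> bool" where
  "one_sided_at C p r q \<longleftrightarrow>
     (\<exists>\<epsilon>>0. C \<inter> ball q \<epsilon> \<subseteq> cball p r \<or> C \<inter> ball q \<epsilon> \<subseteq> - ball p r)"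

end

theory Submission
  imports Defs
begin

text \<open>
  The field \<open>V\<close> has divergence 1, so the claim is a divergence theorem on \<open>\<Omega> \<inter> D\<close> with \<open>D\<close> the closed
  disk of radius \<open>r\<close> about \<open>p\<close>. That set can have cusps where \<open>C\<close> touches the circle, so it is not
  treated as a domain of its own. Instead \<open>\<Omega>\<close> is dilated about \<open>p\<close>: with
  \<open>\<Omega>\<^sub>\<lambda> = p + \<lambda> (\<Omega> - p)\<close>, the derivative at \<open>\<lambda> = 1\<close> of the area of \<open>D \<inter> \<Omega>\<^sub>\<lambda>\<close> is computed in
  two ways along \<open>\<lambda> = 1 + 1/n\<close>.

  By scaling, that area is \<open>\<lambda>\<^sup>2\<close> times the area of \<open>\<Omega>\<close> in the disk of radius \<open>r/\<lambda>\<close>. Its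
  derivative is \<open>2 A - r\<^sup>2 \<Theta>\<close>, with \<open>A\<close> the circular area invariant and \<open>\<Theta>\<close> the total angle of
  the arcs of the circle inside \<open>\<Omega>\<close>. In polar coordinates the thin annulus contributes \<open>r\<^sup>2 \<Theta>\<close>,
  because almost every point of the circle is off \<open>C\<close> (\<open>annulus_limit\<close>).

  Along the boundary, \<open>\<Omega>\<close> is locally the region below a Lipschitz graph \<open>g\<close>, and \<open>\<Omega>\<^sub>\<lambda>\<close> the region
  below a dilated graph. Where \<open>g\<close> is differentiable the height of the graph changes at the rate
  \<open>(x - p) \<bullet> (v - g' u)\<close>, and this is \<open>(x - p) \<bullet> \<nu>\<close> times the arc length density
  \<open>sqrt (1 + g'\<^sup>2)\<close>. Dominated convergence turns this into a limit of area integrals against any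
  bounded weight that is continuous at almost every boundary point (\<open>chart_dilation_limit\<close>).
  The weights used are the indicator of \<open>D\<close>, discontinuous at finitely many points of \<open>C\<close> only,
  times a continuous partition of unity; summing gives \<open>dilation_flux_limit\<close>. No weight has to be
  differentiated. Comparing the two values gives
  \<open>2 \<integral> V \<bullet> \<nu> ds = 2 A - r\<^sup>2 \<Theta>\<close> (\<open>area_flux_arc_identity\<close>).

  Three tools carry the local part. The Hausdorff set function is a metric outer measure, hence a
  measure on the Borel sets (\<open>emeasure_arc_length\<close>). A Lipschitz function on the line is
  differentiable almost everywhere (\<open>lipschitz_real_differentiable_AE\<close>, from Vitali's covering
  theorem). The arc length of an injective Lipschitz curve is the integral of its metric speed
  (\<open>curve_area_formula\<close>).
\<close>

section \<open>Arc length as a Borel measure\<close>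

lemma ennreal_term_le_suminf: "f n \<le> (\<Sum>i. f i)" for f :: "nat \<Rightarrow> ennreal"
  using sum_le_suminf[of f "{n}"] by (simp add: summableI)

text \<open>
  Caratheodory's criterion for metric outer measures. The part of \<open>X\<close> outside \<open>K\<close> is exhausted by
  the sets \<open>A n\<close> at positive distance from \<open>K\<close>. What is left over are shells \<open>R k\<close>, and shells whose
  indices have the same parity are separated from each other, so their measures have a finite sum
  and the tails vanish.
\<close>

lemma metric_outer_measure_closed_split:
  fixes h :: "'a::metric_space set \<Rightarrow> ennreal"
  assumes empty: "h {} = 0"
    and mono: "\<And>A B. A \<subseteq> B \<Longrightarrow> h A \<le> h B"
    and subadd: "\<And>A. h (\<Union>n::nat. A n) \<le> (\<Sum>n. h (A n))"
    and metric: "\<And>A B d. 0 < d \<Longrightarrow> (\<And>a b. a \<in> A \<Longrightarrow> b \<in> B \<Longrightarrow> d \<le> dist a b) \<Longrightarrow> h A + h B \<le> h (A \<union> B)"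
    and K: "closed K"
  shows "h (X \<inter> K) + h (X - K) \<le> h X"
proof (cases "K = {} \<or> h X = \<infinity>")
  case True
  then show ?thesis using empty by auto
next
  case False
  then have Kne: "K \<noteq> {}" and fin: "h X < \<infinity>" by (auto simp: top.not_eq_extremum)
  define A where "A n = {x \<in> X. 1 / real (Suc n) \<le> infdist x K}" for n
  define R where "R n = {x \<in> X. 1 / real (Suc (Suc n)) \<le> infdist x K \<and> infdist x K < 1 / real (Suc n)}" for n
  have gap: "1 / real (Suc (Suc n)) - 1 / real (Suc (Suc (Suc n))) \<le> dist x y"
    if x: "x \<in> R n" and y: "y \<in> R m" and m: "n + 2 \<le> m" for x y n m
  proof -
    have "1 / real (Suc m) \<le> 1 / real (Suc (Suc (Suc n)))"
      using m by (intro divide_left_mono) auto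
    moreover have "infdist x K \<le> infdist y K + dist x y" by (rule infdist_triangle)
    ultimately show ?thesis using x y by (auto simp: R_def)
  qed
  have gap_pos: "0 < 1 / real (Suc (Suc n)) - 1 / real (Suc (Suc (Suc n)))" for n
    by (simp add: divide_strict_left_mono)
  have sum_bound: "(\<Sum>k<n. h (R (2 * k + j))) \<le> h (\<Union>k<n. R (2 * k + j))" for j n
  proof (induction n)
    case 0
    then show ?case by simp
  next
    case (Suc n)
    have "(\<Sum>k<Suc n. h (R (2 * k + j))) \<le> h (\<Union>k<n. R (2 * k + j)) + h (R (2 * n + j))"
      using Suc by (simp add: add_right_mono)
    also have "\<dots> \<le> h ((\<Union>k<n. R (2 * k + j)) \<union> R (2 * n + j))"
    proof (cases n)
      case 0
      then show ?thesis by (simp add: empty)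
    next
      case (Suc n')
      let ?d = "1 / real (Suc (Suc (2*n'+j))) - 1 / real (Suc (Suc (Suc (2*n'+j))))"
      show ?thesis
      proof (rule metric[of "?d"])
        show "0 < ?d" by (rule gap_pos)
        fix a b assume a: "a \<in> (\<Union>k<n. R (2 * k + j))" and b: "b \<in> R (2 * n + j)"
        then obtain k where k: "k \<le> n'" "a \<in> R (2*k+j)" using Suc by (auto simp: less_Suc_eq_le)
        have "1 / real (Suc (Suc (2*k+j))) - 1 / real (Suc (Suc (Suc (2*k+j)))) \<le> dist a b"
          using k Suc by (intro gap[OF k(2) b]) auto
        moreover have "?d \<le> 1 / real (Suc (Suc (2*k+j))) - 1 / real (Suc (Suc (Suc (2*k+j))))"
        proof -
          have e: "1 / real (Suc (Suc m)) - 1 / real (Suc (Suc (Suc m))) = 1 / (real (Suc (Suc m)) * real (Suc (Suc (Suc m))))" for m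
            by (simp add: field_simps)
          show ?thesis unfolding e using k
            by (intro divide_left_mono mult_mono) auto
        qed
        ultimately show "?d \<le> dist a b" by linarith
      qed
    qed
    also have "(\<Union>k<n. R (2 * k + j)) \<union> R (2 * n + j) = (\<Union>k<Suc n. R (2 * k + j))"
      by (auto simp: lessThan_Suc)
    finally show ?case .
  qed
  have bnd: "(\<Sum>k<n. h (R (2 * k + j))) \<le> h X" for n j
    by (rule order_trans[OF sum_bound]) (auto intro!: mono simp: R_def)
  then have part: "(\<Sum>k. h (R (2 * k + j))) \<le> h X" for j
    by (intro suminf_le_const summableI)
  have eq: "(\<Sum>k<2*n. h (R k)) = (\<Sum>k<n. h (R (2 * k + 0))) + (\<Sum>k<n. h (R (2 * k + 1)))" for n
    by (induction n) (auto simp: algebra_simps)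
  have part2: "(\<Sum>k<2*n. h (R k)) \<le> h X + h X" for n
    unfolding eq by (intro add_mono bnd)
  have "(\<Sum>k<n. h (R k)) \<le> h X + h X" for n
    by (rule order_trans[OF sum_mono2 part2[of n]]) auto
  then have "(\<Sum>k. h (R k)) \<le> h X + h X"
    by (intro suminf_le_const summableI)
  then have sumfin: "(\<Sum>k. h (R k)) \<noteq> \<infinity>"
    using fin by (auto simp: top_unique infinity_ennreal_def)
  have tail: "(\<lambda>n. \<Sum>k. h (R (k + n))) \<longlonglongrightarrow> 0"
  proof -
    have fink: "h (R k) \<noteq> \<infinity>" for k 
      using sumfin ennreal_term_le_suminf[of "\<lambda>k. h (R k)" k] by (auto simp: top_unique)
    define f where "f k = enn2real (h (R k))" for k
    have f: "h (R k) = ennreal (f k)" "0 \<le> f k" for k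
      using fink[of k] by (auto simp: f_def top.not_eq_extremum)
    have "summable f"
      using sumfin f by (auto intro: summable_suminf_not_top)
    then have "(\<lambda>n. \<Sum>k. f (k + n)) \<longlonglongrightarrow> 0" by (rule suminf_exist_split2)
    then have "(\<lambda>n. ennreal (\<Sum>k. f (k + n))) \<longlonglongrightarrow> ennreal 0" by (rule tendsto_ennrealI)
    moreover have "ennreal (\<Sum>k. f (k + n)) = (\<Sum>k. h (R (k + n)))" for n
      unfolding f by (rule suminf_ennreal2[symmetric]) (use f \<open>summable f\<close> in \<open>auto simp: summable_iff_shift\<close>)
    ultimately show ?thesis by simp
  qed
  have step: "h (X \<inter> K) + h (X - K) \<le> h X + (\<Sum>k. h (R (k + n)))" for n
  proof -
    have "X - K \<subseteq> (\<Union>i. case i of 0 \<Rightarrow> A n | Suc k \<Rightarrow> R (k + n))"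
    proof
      fix x assume x: "x \<in> X - K"
      then have pos: "0 < infdist x K"
        using K Kne by (metis DiffD2 in_closed_iff_infdist_zero infdist_nonneg order_le_less)
      show "x \<in> (\<Union>i. case i of 0 \<Rightarrow> A n | Suc k \<Rightarrow> R (k + n))"
      proof (cases "x \<in> A n")
        case True
        then show ?thesis by (auto intro!: exI[of _ 0])
      next
        case False
        obtain m where m: "1 / real (Suc m) < infdist x K"
          using pos nat_approx_posE by blast
        define l where "l = (LEAST m. 1 / real (Suc m) \<le> infdist x K)"
        have l: "1 / real (Suc l) \<le> infdist x K"
          unfolding l_def by (rule LeastI[of _ m]) (use m in auto)
        have nl: "n < l"
        proof (rule ccontr)
          assume "\<not> n < l"
          then have "1 / real (Suc n) \<le> 1 / real (Suc l)" by (intro divide_left_mono) auto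
          then show False using l False x by (auto simp: A_def)
        qed
        then obtain k where k: "l = Suc (k + n)" using less_iff_Suc_add by (metis add.commute)
        have "\<not> 1 / real (Suc (k+n)) \<le> infdist x K"
          using not_less_Least[of "k+n" "\<lambda>m. 1 / real (Suc m) \<le> infdist x K"] k l_def by auto
        then have "x \<in> R (k + n)" using l x unfolding k R_def by auto
        then show ?thesis by (auto intro!: exI[of _ "Suc k"])
      qed
    qed
    then have "h (X - K) \<le> (\<Sum>i. h (case i of 0 \<Rightarrow> A n | Suc k \<Rightarrow> R (k + n)))"
      using mono subadd order_trans by blast
    also have "\<dots> = h (A n) + (\<Sum>k. h (R (k + n)))"
      by (subst suminf_offset[where i=1]) (auto intro!: summableI simp: add.commute)
    finally have "h (X \<inter> K) + h (X - K) \<le> (h (X \<inter> K) + h (A n)) + (\<Sum>k. h (R (k + n)))"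
      by (simp add: add.assoc add_left_mono)
    also have "h (X \<inter> K) + h (A n) \<le> h (X \<inter> K \<union> A n)"
    proof (rule metric[of "1 / real (Suc n)"])
      fix a b assume a: "a \<in> X \<inter> K" and b: "b \<in> A n"
      then have "infdist b K \<le> dist b a" by (intro infdist_le) auto
      then show "1 / real (Suc n) \<le> dist a b" using b by (auto simp: A_def dist_commute)
    qed auto
    also have "h (X \<inter> K \<union> A n) \<le> h X" by (rule mono) (auto simp: A_def)
    finally show ?thesis by (simp add: add_right_mono)
  qed
  have "(\<lambda>n. h X + (\<Sum>k. h (R (k + n)))) \<longlonglongrightarrow> h X + 0"
    by (intro tendsto_add tendsto_const tail)
  then show ?thesis
    using step by (intro LIMSEQ_le_const[where X="\<lambda>n. h X + (\<Sum>k. h (R (k + n)))"]) auto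
qed

lemma hausdorff1_premeasure_lower:
  assumes "\<And>E. A \<subseteq> (\<Union>i::nat. E i) \<Longrightarrow> (\<And>i. bounded (E i)) \<Longrightarrow> (\<And>i. diameter (E i) \<le> \<delta>) \<Longrightarrow> x \<le> (\<Sum>i. ennreal (diameter (E i)))"
  shows "x \<le> hausdorff1_premeasure \<delta> A"
  unfolding hausdorff1_premeasure_def using assms by (intro INF_greatest) auto

lemma hausdorff1_premeasure_upper:
  assumes "A \<subseteq> (\<Union>i::nat. E i)" "\<And>i. bounded (E i)" "\<And>i. diameter (E i) \<le> \<delta>"
  shows "hausdorff1_premeasure \<delta> A \<le> (\<Sum>i. ennreal (diameter (E i)))"
  unfolding hausdorff1_premeasure_def using assms by (intro INF_lower) auto

lemma hausdorff1_premeasure_antimono: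
  "\<delta> \<le> \<epsilon> \<Longrightarrow> hausdorff1_premeasure \<epsilon> A \<le> hausdorff1_premeasure \<delta> A"
  by (rule hausdorff1_premeasure_lower, rule hausdorff1_premeasure_upper) (auto intro: order_trans)

lemma hausdorff1_outer_lower:
  assumes "0 < \<delta>"
  shows "hausdorff1_premeasure \<delta> A \<le> hausdorff1_outer A"
  unfolding hausdorff1_outer_def using assms by (intro SUP_upper) auto

lemma hausdorff1_outer_upper:
  assumes "\<And>\<delta>. 0 < \<delta> \<Longrightarrow> hausdorff1_premeasure \<delta> A \<le> x"
  shows "hausdorff1_outer A \<le> x"
  unfolding hausdorff1_outer_def using assms by (intro SUP_least) auto

lemma hausdorff1_outer_mono: "A \<subseteq> B \<Longrightarrow> hausdorff1_outer A \<le> hausdorff1_outer B"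
proof (rule hausdorff1_outer_upper)
  fix \<delta> :: real assume "A \<subseteq> B" "0 < \<delta>"
  then have "hausdorff1_premeasure \<delta> A \<le> hausdorff1_premeasure \<delta> B"
    by (intro hausdorff1_premeasure_lower hausdorff1_premeasure_upper) auto
  then show "hausdorff1_premeasure \<delta> A \<le> hausdorff1_outer B"
    using hausdorff1_outer_lower \<open>0 < \<delta>\<close> order_trans by blast
qed

lemma hausdorff1_outer_empty: "hausdorff1_outer {} = 0"
proof -
  have "hausdorff1_outer {} \<le> (0::ennreal)"
  proof (rule hausdorff1_outer_upper)
    fix \<delta> :: real assume "0 < \<delta>"
    then show "hausdorff1_premeasure \<delta> {} \<le> 0"
      using hausdorff1_premeasure_upper[of "{}" "\<lambda>_. {}" \<delta>] by simp
  qed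
  then show ?thesis by simp
qed

lemma hausdorff1_premeasure_subadditive:
  assumes "0 < \<delta>"
  shows "hausdorff1_premeasure \<delta> (\<Union>n::nat. A n) \<le> (\<Sum>n. hausdorff1_premeasure \<delta> (A n))"
proof (rule ennreal_le_epsilon)
  fix e :: real assume fin: "(\<Sum>n. hausdorff1_premeasure \<delta> (A n)) < top" and e: "0 < e"
  have fink: "hausdorff1_premeasure \<delta> (A n) < \<infinity>" for n
    using le_less_trans[OF ennreal_term_le_suminf fin] by simp
  have "\<exists>E. A n \<subseteq> (\<Union>i::nat. E i) \<and> (\<forall>i. bounded (E i) \<and> diameter (E i) \<le> \<delta>) \<and>
     (\<Sum>i. ennreal (diameter (E i))) < hausdorff1_premeasure \<delta> (A n) + ennreal (e * (1/2)^Suc n)" for n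
  proof -
    have "hausdorff1_premeasure \<delta> (A n) < hausdorff1_premeasure \<delta> (A n) + ennreal (e * (1/2)^Suc n)"
      using e fink[of n] by (cases "hausdorff1_premeasure \<delta> (A n)") (auto simp: ennreal_plus[symmetric] ennreal_less_iff simp del: ennreal_plus)
    then show ?thesis
      unfolding hausdorff1_premeasure_def by (subst (asm) INF_less_iff) auto
  qed
  then obtain E where E: "\<And>n. A n \<subseteq> (\<Union>i::nat. E n i)" "\<And>n i. bounded (E n i)" "\<And>n i. diameter (E n i) \<le> \<delta>"
     "\<And>n. (\<Sum>i. ennreal (diameter (E n i))) < hausdorff1_premeasure \<delta> (A n) + ennreal (e * (1/2)^Suc n)"
    by metis
  have "hausdorff1_premeasure \<delta> (\<Union>n. A n) \<le> (\<Sum>j. ennreal (diameter (case_prod E (prod_decode j))))"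
  proof (rule hausdorff1_premeasure_upper)
    show "(\<Union>n. A n) \<subseteq> (\<Union>j. case_prod E (prod_decode j))"
    proof clarify
      fix x n assume "x \<in> A n"
      then obtain i where "x \<in> E n i" using E(1)[of n] by blast
      then have "x \<in> case_prod E (prod_decode (prod_encode (n, i)))" by simp
      then show "x \<in> (\<Union>j. case_prod E (prod_decode j))" by (rule UN_I[OF UNIV_I])
    qed
  qed (auto split: prod.splits simp: E)
  also have "\<dots> = (\<Sum>n. \<Sum>i. ennreal (diameter (E n i)))"
    using suminf_ennreal_2dimen[of "\<lambda>n. \<Sum>i. ennreal (diameter (E n i))" "\<lambda>(n,i). ennreal (diameter (E n i))"]
    by (simp add: case_prod_unfold)
  also have "\<dots> \<le> (\<Sum>n. hausdorff1_premeasure \<delta> (A n) + ennreal (e * (1/2)^Suc n))"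
    using E(4) by (intro suminf_le summableI) (auto intro: less_imp_le)
  also have "\<dots> = (\<Sum>n. hausdorff1_premeasure \<delta> (A n)) + (\<Sum>n. ennreal (e * (1/2)^Suc n))"
    by (rule suminf_add[symmetric]) auto
  also have "(\<Sum>n. ennreal (e * (1/2)^Suc n)) = ennreal e"
  proof -
    have "(\<lambda>n. e * (1/2)^Suc n) sums (e * 1)"
      by (intro sums_mult power_half_series)
    then show ?thesis using e by (subst suminf_ennreal_eq[where x="e"]) simp_all
  qed
  finally show "hausdorff1_premeasure \<delta> (\<Union>n. A n) \<le> (\<Sum>n. hausdorff1_premeasure \<delta> (A n)) + ennreal e" .
qed

lemma hausdorff1_outer_subadditive:
  "hausdorff1_outer (\<Union>n::nat. A n) \<le> (\<Sum>n. hausdorff1_outer (A n))"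
proof (rule hausdorff1_outer_upper)
  fix \<delta> :: real assume "0 < \<delta>"
  then show "hausdorff1_premeasure \<delta> (\<Union>n. A n) \<le> (\<Sum>n. hausdorff1_outer (A n))"
    by (intro order_trans[OF hausdorff1_premeasure_subadditive suminf_le] hausdorff1_outer_lower summableI)
qed

text \<open>
  Covers by sets of diameter below the gap \<open>d\<close> split into a cover of \<open>A\<close> and a cover of \<open>B\<close>.
\<close>

lemma hausdorff1_outer_metric:
  assumes d: "0 < d" and sep: "\<And>a b. a \<in> A \<Longrightarrow> b \<in> B \<Longrightarrow> d \<le> dist a b"
  shows "hausdorff1_outer A + hausdorff1_outer B \<le> hausdorff1_outer (A \<union> B)"
proof -
  have pre: "hausdorff1_premeasure \<delta> A + hausdorff1_premeasure \<delta> B \<le> hausdorff1_premeasure \<delta> (A \<union> B)"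
    if \<delta>: "0 < \<delta>" "\<delta> < d" for \<delta>
  proof (rule hausdorff1_premeasure_lower)
    fix E assume E: "A \<union> B \<subseteq> (\<Union>i::nat. E i)" "\<And>i. bounded (E i)" "\<And>i. diameter (E i) \<le> \<delta>"
    define E1 where "E1 i = (if E i \<inter> A = {} then {} else E i)" for i
    define E2 where "E2 i = (if E i \<inter> A = {} then E i else {})" for i
    have "hausdorff1_premeasure \<delta> A \<le> (\<Sum>i. ennreal (diameter (E1 i)))"
    proof (rule hausdorff1_premeasure_upper)
      show "A \<subseteq> (\<Union>i. E1 i)" using E(1) by (fastforce simp: E1_def)
    qed (use E \<delta> in \<open>auto simp: E1_def\<close>)
    moreover have "hausdorff1_premeasure \<delta> B \<le> (\<Sum>i. ennreal (diameter (E2 i)))"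
    proof (rule hausdorff1_premeasure_upper)
      show "B \<subseteq> (\<Union>i. E2 i)"
      proof
        fix b assume b: "b \<in> B"
        then obtain i where i: "b \<in> E i" using E(1) by blast
        have "E i \<inter> A = {}"
        proof (rule ccontr)
          assume "E i \<inter> A \<noteq> {}"
          then obtain a where a: "a \<in> E i" "a \<in> A" by blast
          have "dist a b \<le> diameter (E i)" using a i E(2) by (intro diameter_bounded_bound)
          then show False using sep[OF a(2) b] E(3)[of i] \<delta> by linarith
        qed
        then show "b \<in> (\<Union>i. E2 i)" using i by (auto simp: E2_def)
      qed
    qed (use E \<delta> in \<open>auto simp: E2_def\<close>)
    ultimately have "hausdorff1_premeasure \<delta> A + hausdorff1_premeasure \<delta> B
      \<le> (\<Sum>i. ennreal (diameter (E1 i))) + (\<Sum>i. ennreal (diameter (E2 i)))" by (rule add_mono)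
    also have "\<dots> = (\<Sum>i. ennreal (diameter (E1 i)) + ennreal (diameter (E2 i)))"
      by (rule suminf_add) auto
    also have "\<dots> = (\<Sum>i. ennreal (diameter (E i)))"
      by (intro arg_cong[where f=suminf] ext) (auto simp: E1_def E2_def)
    finally show "hausdorff1_premeasure \<delta> A + hausdorff1_premeasure \<delta> B \<le> (\<Sum>i. ennreal (diameter (E i)))" .
  qed
  have key: "hausdorff1_premeasure \<delta> A + hausdorff1_premeasure \<epsilon> B \<le> hausdorff1_outer (A \<union> B)"
    if "0 < \<delta>" "0 < \<epsilon>" for \<delta> \<epsilon>
  proof -
    define \<eta> where "\<eta> = min (min \<delta> \<epsilon>) (d/2)"
    have \<eta>: "0 < \<eta>" "\<eta> < d" "\<eta> \<le> \<delta>" "\<eta> \<le> \<epsilon>" using that d by (auto simp: \<eta>_def)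
    have "hausdorff1_premeasure \<delta> A + hausdorff1_premeasure \<epsilon> B \<le> hausdorff1_premeasure \<eta> A + hausdorff1_premeasure \<eta> B"
      using \<eta> by (intro add_mono hausdorff1_premeasure_antimono)
    also have "\<dots> \<le> hausdorff1_premeasure \<eta> (A \<union> B)" using pre \<eta> by simp
    also have "\<dots> \<le> hausdorff1_outer (A \<union> B)" using \<eta> by (intro hausdorff1_outer_lower)
    finally show ?thesis .
  qed
  have "hausdorff1_outer A + hausdorff1_outer B = (SUP \<delta>\<in>{0<..}. SUP \<epsilon>\<in>{0<..}. hausdorff1_premeasure \<delta> A + hausdorff1_premeasure \<epsilon> B)"
    unfolding hausdorff1_outer_def
    by (simp add: ennreal_SUP_add_left[symmetric] ennreal_SUP_add_right[symmetric])
  also have "\<dots> \<le> hausdorff1_outer (A \<union> B)"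
    using key by (intro SUP_least) auto
  finally show ?thesis .
qed

lemma sets_arc_length [simp, measurable_cong]: "sets arc_length = sets borel"
  using sets.sigma_sets_eq[of "borel :: 'a::metric_space measure"] by (auto simp: arc_length_def sets_measure_of_conv)

lemma space_arc_length [simp]: "space arc_length = UNIV"
  by (simp add: arc_length_def space_measure_of_conv)

lemma emeasure_arc_length:
  fixes A :: "'a::metric_space set"
  assumes A: "A \<in> sets borel"
  shows "emeasure arc_length A = hausdorff1_outer A"
proof -
  interpret P: sigma_algebra "UNIV::'a set" "Pow UNIV"
    by (rule sigma_algebra_Pow)
  have oms: "outer_measure_space (Pow (UNIV::'a set)) hausdorff1_outer"
    unfolding outer_measure_space_def positive_def increasing_def countably_subadditive_def
    by (intro conjI hausdorff1_outer_empty ballI impI allI hausdorff1_outer_mono hausdorff1_outer_subadditive)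
  let ?L = "lambda_system (UNIV::'a set) (Pow UNIV) hausdorff1_outer"
  have L: "measure_space UNIV ?L hausdorff1_outer"
    by (rule P.caratheodory_lemma[OF oms])
  interpret L: sigma_algebra UNIV ?L
    using L by (simp add: measure_space_def)
  have "S \<in> ?L" if "closed S" for S :: "'a set"
  proof -
    have "hausdorff1_outer (X \<inter> S) + hausdorff1_outer (X - S) = hausdorff1_outer X" for X :: "'a set"
    proof (rule antisym)
      show "hausdorff1_outer (X \<inter> S) + hausdorff1_outer (X - S) \<le> hausdorff1_outer X"
        using that by (intro metric_outer_measure_closed_split hausdorff1_outer_empty hausdorff1_outer_mono
          hausdorff1_outer_subadditive hausdorff1_outer_metric)
      have "X = (\<Union>n::nat. if n = 0 then X \<inter> S else if n = 1 then X - S else {})" (is "_ = (\<Union>n. ?A n)")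
        by (auto split: if_splits)
      then have "hausdorff1_outer X \<le> (\<Sum>n. hausdorff1_outer (?A n))"
        using hausdorff1_outer_subadditive[of ?A] by simp
      also have "\<dots> = (\<Sum>n\<in>{0,1}. hausdorff1_outer (?A n))"
        by (rule suminf_finite) (auto simp: hausdorff1_outer_empty)
      finally show "hausdorff1_outer X \<le> hausdorff1_outer (X \<inter> S) + hausdorff1_outer (X - S)" by simp
    qed
    then show ?thesis
      unfolding P.lambda_system_eq by blast
  qed
  then have "sets borel \<subseteq> ?L"
    unfolding borel_eq_closed by (subst sets_measure_of) (use L.sigma_sets_subset[of "Collect closed"] in auto)
  then have "measure_space UNIV (sets borel) (hausdorff1_outer :: 'a set \<Rightarrow> ennreal)"
    by (intro measure_down[OF L]) (use sets.sigma_algebra_axioms[of "borel::'a measure"] in auto)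
  then show ?thesis
    unfolding arc_length_def using A
    by (intro emeasure_measure_of_sigma) (auto simp: measure_space_def)
qed

section \<open>Differentiability of Lipschitz functions on the line\<close>

text \<open>
  A local comparison of two measures on arbitrarily small balls becomes a global one: Vitali's theorem
  selects disjoint balls inside \<open>U\<close> that cover \<open>S\<close> up to a set that is null for \<open>\<alpha>\<close>. Used in both
  directions between multiples of Lebesgue measure and the length of images under a map.
\<close>

lemma le_measure_of_fine_ball_cover:
  fixes \<alpha> \<beta> :: "'a::euclidean_space measure"
  assumes \<alpha>: "sets \<alpha> = sets borel" and \<beta>: "sets \<beta> = sets borel"
    and null: "\<And>N. N \<in> null_sets lborel \<Longrightarrow> N \<in> null_sets \<alpha>"
    and S: "S \<in> sets borel" "S \<subseteq> U" and U: "open U"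
    and cover: "\<And>x d. x \<in> S \<Longrightarrow> 0 < d \<Longrightarrow>
      \<exists>c r. 0 < r \<and> r < d \<and> x \<in> ball c r \<and> emeasure \<alpha> (ball c r) \<le> emeasure \<beta> (ball c r)"
  shows "emeasure \<alpha> S \<le> emeasure \<beta> U"
proof -
  define K where "K = {(c, r). 0 < r \<and> ball c r \<subseteq> U \<and> emeasure \<alpha> (ball c r) \<le> emeasure \<beta> (ball c r)}"
  have cov: "\<exists>i. i \<in> K \<and> x \<in> ball (fst i) (snd i) \<and> snd i < d" if x: "x \<in> S" and d: "0 < d" for x d
  proof -
    obtain e where e: "0 < e" "ball x e \<subseteq> U" using S U x open_contains_ball by (meson subsetD)
    then have "0 < min d (e/2)" using d by simp
    then obtain c r where cr: "0 < r" "r < min d (e/2)" "x \<in> ball c r" "emeasure \<alpha> (ball c r) \<le> emeasure \<beta> (ball c r)"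
      using cover[OF x] by blast
    have "ball c r \<subseteq> ball x e"
    proof
      fix y assume "y \<in> ball c r"
      then show "y \<in> ball x e" using cr dist_triangle[of x y c] by (auto simp: dist_commute)
    qed
    then show ?thesis using cr e by (intro exI[of _ "(c, r)"]) (auto simp: K_def)
  qed
  obtain C where C: "countable C" "C \<subseteq> K"
     "pairwise (\<lambda>i j. disjnt (ball (fst i) (snd i)) (ball (fst j) (snd j))) C"
     "negligible (S - (\<Union>i \<in> C. ball (fst i) (snd i)))"
    using Vitali_covering_theorem_balls[of S K fst snd, OF cov] by blast
  let ?B = "\<lambda>i. ball (fst i) (snd i :: real)"
  have dis: "disjoint_family_on ?B C"
    using C(3) by (auto simp: pairwise_def disjnt_def disjoint_family_on_def)
  have UB: "(\<Union>i\<in>C. ?B i) \<in> sets borel" by (intro borel_open open_UN) auto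
  have "S - (\<Union>i\<in>C. ?B i) \<in> null_sets lborel"
    using C(4) S(1) UB by (subst (asm) negligible_iff_null_sets) (auto simp: null_sets_completion_iff)
  then have "emeasure \<alpha> (S - (\<Union>i\<in>C. ?B i)) = 0" using null by blast
  then have "emeasure \<alpha> S \<le> emeasure \<alpha> (\<Union>i\<in>C. ?B i)"
    using S(1) UB emeasure_subadditive[of "S - (\<Union>i\<in>C. ?B i)" \<alpha> "\<Union>i\<in>C. ?B i"] \<alpha>
      emeasure_mono[of S "S - (\<Union>i\<in>C. ?B i) \<union> (\<Union>i\<in>C. ?B i)" \<alpha>] by auto
  also have "\<dots> = (\<integral>\<^sup>+i. emeasure \<alpha> (?B i) \<partial>count_space C)"
    by (rule emeasure_UN_countable) (auto simp: \<alpha> C dis)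
  also have "\<dots> \<le> (\<integral>\<^sup>+i. emeasure \<beta> (?B i) \<partial>count_space C)"
    using C(2) by (intro nn_integral_mono) (auto simp: K_def)
  also have "\<dots> = emeasure \<beta> (\<Union>i\<in>C. ?B i)"
    by (rule emeasure_UN_countable[symmetric]) (auto simp: \<beta> C dis)
  also have "\<dots> \<le> emeasure \<beta> U"
    using C(2) U \<beta> by (intro emeasure_mono) (fastforce simp: K_def)+
  finally show ?thesis .
qed

text \<open>
  Let \<open>\<mu>\<close> be Lebesgue measure of the image under \<open>f\<close>. On the set \<open>E p q\<close> of points lying in arbitrarily
  short intervals with mean slope below \<open>p\<close> and in others with mean slope above \<open>q\<close>, the covering
  lemma gives \<open>q |S| \<le> \<mu> S \<le> p |S|\<close> for every bounded part \<open>S\<close>, so \<open>E p q\<close> is null if \<open>p < q\<close>. Off all these sets with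
  rational \<open>p < q\<close> the mean slopes converge.
\<close>

lemma bilipschitz_real_differentiable_AE:
  fixes f :: "real \<Rightarrow> real"
  assumes lip: "\<And>x y. x \<le> y \<Longrightarrow> f y - f x \<le> M * (y - x)"
    and expand: "\<And>x y. x \<le> y \<Longrightarrow> y - x \<le> f y - f x"
  shows "AE x in lborel. f differentiable (at x)"
proof -
  have M: "1 \<le> M" using lip[of 0 1] expand[of 0 1] by simp
  have absf: "\<bar>f y - f x\<bar> \<le> M * \<bar>y - x\<bar>" "\<bar>y - x\<bar> \<le> \<bar>f y - f x\<bar>" for x y
  proof -
    have "\<bar>f y - f x\<bar> \<le> M * \<bar>y - x\<bar> \<and> \<bar>y - x\<bar> \<le> \<bar>f y - f x\<bar>"
    proof (cases "x \<le> y")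
      case True
      then have "\<bar>f y - f x\<bar> = f y - f x" "\<bar>y - x\<bar> = y - x" using expand[OF True] by linarith+
      then show ?thesis using lip[OF True] expand[OF True] by simp
    next
      case False
      then have le: "y \<le> x" by simp
      then have "\<bar>f y - f x\<bar> = f x - f y" "\<bar>y - x\<bar> = x - y" using expand[OF le] by linarith+
      then show ?thesis using lip[OF le] expand[OF le] by simp
    qed
    then show "\<bar>f y - f x\<bar> \<le> M * \<bar>y - x\<bar>" "\<bar>y - x\<bar> \<le> \<bar>f y - f x\<bar>" by auto
  qed
  have sm: "strict_mono f"
  proof (rule strict_monoI)
    fix x y :: real assume "x < y"
    then show "f x < f y" using expand[of x y] by simp
  qed
  have Mlip: "M-lipschitz_on UNIV f"
    using absf M by (intro lipschitz_onI) (auto simp: dist_real_def)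
  then have contf: "continuous_on UNIV f" by (rule lipschitz_on_continuous_on)
  have surj: "\<exists>x. f x = y" for y
  proof -
    let ?R = "\<bar>y - f 0\<bar>"
    have "f (-?R) \<le> y" "y \<le> f ?R" using expand[of "-?R" 0] expand[of 0 ?R] by auto
    moreover have "continuous_on {-?R..?R} f" using contf continuous_on_subset by blast
    ultimately show ?thesis using IVT'[of f "-?R" y ?R] by auto
  qed
  define finv where "finv y = (SOME x. f x = y)" for y
  have ffinv [simp]: "f (finv y) = y" for y using someI_ex[OF surj] by (simp add: finv_def)
  have finvf [simp]: "finv (f x) = x" for x using strict_mono_eq[OF sm] ffinv by metis
  have "1-lipschitz_on UNIV finv"
    using absf(2)[of "finv x" "finv y" for x y] by (intro lipschitz_onI) (auto simp: dist_real_def abs_minus_commute)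
  then have [measurable]: "finv \<in> borel_measurable borel"
    by (intro borel_measurable_continuous_onI lipschitz_on_continuous_on)
  have [measurable]: "f \<in> borel_measurable borel"
    by (intro borel_measurable_continuous_onI contf)
  have vimage: "finv -` A = f ` A" for A by (auto simp: image_iff) (metis ffinv)
  define \<mu> where "\<mu> = distr lborel borel finv"
  have \<mu>: "emeasure \<mu> A = emeasure lborel (f ` A)" if "A \<in> sets borel" for A
    using that by (simp add: \<mu>_def emeasure_distr vimage)
  have s\<mu>: "sets \<mu> = sets borel" by (simp add: \<mu>_def)
  have fball: "f ` ball c r = {f (c - r)<..<f (c + r)}" for c r
  proof -
    have "f ` ball c r = finv -` ball c r" by (simp add: vimage)
    also have "\<dots> = {f (c - r)<..<f (c + r)}"
      using strict_mono_less[OF sm, of "c - r" "finv y" for y] strict_mono_less[OF sm, of "finv y" "c + r" for y]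
      by (auto simp: dist_real_def abs_less_iff; linarith)
    finally show ?thesis .
  qed
  have \<mu>_ball: "emeasure \<mu> (ball c r) = ennreal (f (c + r) - f (c - r))" if "0 < r" for c r
    using that strict_mono_less_eq[OF sm] by (simp add: \<mu> fball)
  have l_ball: "emeasure lborel (ball c r) = ennreal (2 * r)" if "0 < r" for c r :: real
  proof -
    have "ball c r = {c - r <..< c + r}" by (auto simp: dist_real_def)
    then show ?thesis using that by simp
  qed
  have \<mu>_null: "N \<in> null_sets \<mu>" if "N \<in> null_sets lborel" for N
  proof -
    have "negligible N" using that by (simp add: negligible_iff_null_sets null_sets_completionI)
    then have "negligible (f ` N)"
      by (rule negligible_locally_Lipschitz_image[rotated])
         (use absf in \<open>auto intro!: exI[of _ UNIV] exI[of _ M]\<close>)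
    moreover have "f ` N \<in> sets borel" using that measurable_sets[of finv borel borel N] by (auto simp: vimage[symmetric])
    ultimately have "f ` N \<in> null_sets lborel"
      by (simp add: negligible_iff_null_sets null_sets_completion_iff)
    then show ?thesis using that by (auto simp: null_sets_def s\<mu> \<mu>)
  qed
  define lowcov where "lowcov p d = {ball c r | c r. 0 < r \<and> r < d \<and> f (c + r) - f (c - r) < p * (2 * r)}" for p d :: real
  define highcov where "highcov q d = {ball c r | c r. 0 < r \<and> r < d \<and> q * (2 * r) < f (c + r) - f (c - r)}" for q d :: real
  define E where "E p q = (\<Inter>n::nat. \<Union>(lowcov p (1 / Suc n))) \<inter> (\<Inter>n::nat. \<Union>(highcov q (1 / Suc n)))" for p q
  have E_borel [measurable]: "E p q \<in> sets borel" for p q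
    unfolding E_def by (intro sets.Int sets.countable_INT'' borel_open open_Union) (auto simp: lowcov_def highcov_def)
  have E_null: "E p q \<in> null_sets lborel" if pq: "0 \<le> p" "p < q" for p q
  proof -
    have "emeasure lborel (E p q \<inter> ball 0 (real n)) = 0" for n
    proof -
      define S where "S = E p q \<inter> ball 0 (real n)"
      have S [measurable]: "S \<in> sets borel" by (simp add: S_def)
      have low: "\<exists>c r. 0 < r \<and> r < d \<and> x \<in> ball c r \<and> f (c + r) - f (c - r) < p * (2 * r)" if "x \<in> S" "0 < d" for x d
      proof -
        obtain m where m: "1 / real (Suc m) < d" using nat_approx_posE[OF \<open>0 < d\<close>] by blast
        have "x \<in> \<Union>(lowcov p (1 / Suc m))" using that(1) by (auto simp: S_def E_def)
        then show ?thesis unfolding lowcov_def using m by fastforce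
      qed
      have high: "\<exists>c r. 0 < r \<and> r < d \<and> x \<in> ball c r \<and> q * (2 * r) < f (c + r) - f (c - r)" if "x \<in> S" "0 < d" for x d
      proof -
        obtain m where m: "1 / real (Suc m) < d" using nat_approx_posE[OF \<open>0 < d\<close>] by blast
        have "x \<in> \<Union>(highcov q (1 / Suc m))" using that(1) by (auto simp: S_def E_def)
        then show ?thesis unfolding highcov_def using m by fastforce
      qed
      have "emeasure lborel S \<le> emeasure lborel (ball (0::real) (real n + 1))"
        by (rule emeasure_mono) (auto simp: S_def)
      also have "\<dots> = ennreal (2 * (real n + 1))" by (rule l_ball) simp
      finally have fin: "emeasure lborel S \<le> ennreal (2 * (real n + 1))" .
      then have "emeasure lborel S < \<infinity>" by (rule le_less_trans) simp
      then obtain s where s: "emeasure lborel S = ennreal s" "0 \<le> s" by (cases "emeasure lborel S") auto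
      have up1: "ennreal q * emeasure lborel S \<le> emeasure \<mu> U" if "open U" "S \<subseteq> U" for U
      proof -
        have "emeasure (scale_measure (ennreal q) lborel) S \<le> emeasure \<mu> U"
        proof (rule le_measure_of_fine_ball_cover[OF _ s\<mu> _ S that(2,1)])
          fix x and d :: real assume "x \<in> S" "0 < d"
          from high[OF this] obtain c r where cr: "0 < r" "r < d" "x \<in> ball c r" "q * (2 * r) < f (c + r) - f (c - r)" by blast
          then have "emeasure (scale_measure (ennreal q) lborel) (ball c r) \<le> emeasure \<mu> (ball c r)"
            using pq by (simp add: l_ball \<mu>_ball ennreal_mult[symmetric] ennreal_leI)
          with cr show "\<exists>c r. 0 < r \<and> r < d \<and> x \<in> ball c r \<and> emeasure (scale_measure (ennreal q) lborel) (ball c r) \<le> emeasure \<mu> (ball c r)"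
            by blast
        qed (auto simp: null_sets_def)
        then show ?thesis by simp
      qed
      have up2: "emeasure \<mu> S \<le> ennreal p * emeasure lborel U" if "open U" "S \<subseteq> U" for U
      proof -
        have "emeasure \<mu> S \<le> emeasure (scale_measure (ennreal p) lborel) U"
        proof (rule le_measure_of_fine_ball_cover[OF s\<mu> _ \<mu>_null S that(2,1)])
          fix x and d :: real assume "x \<in> S" "0 < d"
          from low[OF this] obtain c r where cr: "0 < r" "r < d" "x \<in> ball c r" "f (c + r) - f (c - r) < p * (2 * r)" by blast
          then have "emeasure \<mu> (ball c r) \<le> emeasure (scale_measure (ennreal p) lborel) (ball c r)"
            using pq by (simp add: l_ball \<mu>_ball ennreal_mult[symmetric])
          with cr show "\<exists>c r. 0 < r \<and> r < d \<and> x \<in> ball c r \<and> emeasure \<mu> (ball c r) \<le> emeasure (scale_measure (ennreal p) lborel) (ball c r)"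
            by blast
        qed auto
        then show ?thesis by simp
      qed
      have approx: "\<exists>U. open U \<and> A \<subseteq> U \<and> emeasure lborel U \<le> emeasure lborel A + ennreal e"
        if A: "A \<in> sets borel" and e: "0 < e" for A :: "real set" and e
      proof -
        obtain U where U: "open U" "A \<subseteq> U" "emeasure lborel (U - A) < ennreal e"
          using outer_regular_lborel[OF A e] by blast
        have "emeasure lborel U \<le> emeasure lborel A + emeasure lborel (U - A)"
          using U A emeasure_subadditive[of A lborel "U - A"] by (auto simp: Un_absorb1)
        also have "\<dots> \<le> emeasure lborel A + ennreal e" using U by (intro add_left_mono) auto
        finally show ?thesis using U by blast
      qed
      have bound: "(q - p) * s \<le> (p + 1) * e" if e: "0 < e" for e
      proof -
        have fS: "f ` S \<in> sets borel" using measurable_sets[of finv borel borel S] by (auto simp: vimage[symmetric])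
        obtain U where U: "open U" "S \<subseteq> U" "emeasure lborel U \<le> emeasure lborel S + ennreal e" using approx[OF S e] by blast
        obtain W where W: "open W" "f ` S \<subseteq> W" "emeasure lborel W \<le> emeasure lborel (f ` S) + ennreal e" using approx[OF fS e] by blast
        have oW: "open (f -` W)" using contf W(1) by (rule open_vimage[rotated])
        have "f ` (f -` W) = W" by (auto simp: image_iff) (metis ffinv)
        then have "emeasure \<mu> (f -` W) = emeasure lborel W" using oW by (subst \<mu>) auto
        then have "ennreal q * emeasure lborel S \<le> emeasure \<mu> S + ennreal e"
          using up1[OF oW] W(2,3) by (auto simp: \<mu> image_subset_iff_subset_vimage)
        also have "emeasure \<mu> S \<le> ennreal p * (emeasure lborel S + ennreal e)"
          using up2[OF U(1,2)] U(3) by (meson mult_left_mono order_trans zero_le)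
        finally have "ennreal q * emeasure lborel S \<le> ennreal p * (emeasure lborel S + ennreal e) + ennreal e"
          by (simp add: add_right_mono)
        then have "ennreal (q * s) \<le> ennreal (p * (s + e) + e)"
          using pq e s by (simp add: ennreal_mult ennreal_plus)
        then have "q * s \<le> p * (s + e) + e" using pq e s by (subst (asm) ennreal_le_iff) auto
        then show ?thesis by (simp add: algebra_simps)
      qed
      have "(q - p) * s \<le> 0"
      proof (rule field_le_epsilon)
        fix e :: real assume "0 < e"
        then show "(q - p) * s \<le> 0 + e" using bound[of "e / (p + 1)"] pq by simp
      qed
      then have "s = 0" using pq s by (simp add: mult_le_0_iff)
      then show ?thesis using s by (simp add: S_def)
    qed
    then have "E p q \<inter> ball 0 (real n) \<in> null_sets lborel" for n by auto
    then have "(\<Union>n. E p q \<inter> ball 0 (real n)) \<in> null_sets lborel" by blast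
    also have "(\<Union>n. E p q \<inter> ball 0 (real n)) = E p q"
      using reals_Archimedean2 by (auto simp: dist_real_def)
    finally show ?thesis .
  qed
  define N where "N = (\<Union>p\<in>\<rat> \<inter> {0..}. \<Union>q\<in>\<rat> \<inter> {p<..}. E p q)"
  have "N \<in> null_sets lborel"
    unfolding N_def using E_null countable_rat by (intro null_sets_UN' countable_Int1) auto
  moreover have "f differentiable (at x)" if x: "x \<notin> N" for x
  proof -
    define S where "S = {p. \<exists>d>0. \<forall>c r. 0 < r \<and> r < d \<and> x \<in> ball c r \<longrightarrow> p * (2 * r) \<le> f (c + r) - f (c - r)}"
    define T where "T = {q. \<exists>d>0. \<forall>c r. 0 < r \<and> r < d \<and> x \<in> ball c r \<longrightarrow> f (c + r) - f (c - r) \<le> q * (2 * r)}"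
    have ST: "p \<in> S \<or> q \<in> T" if "p \<in> \<rat>" "q \<in> \<rat>" "0 \<le> p" "p < q" for p q
    proof -
      have "x \<notin> E p q" using x that by (auto simp: N_def)
      then consider n where "x \<notin> \<Union>(lowcov p (1 / Suc n))" | n where "x \<notin> \<Union>(highcov q (1 / Suc n))"
        by (auto simp: E_def)
      then show ?thesis
      proof cases
        case 1
        then have "p \<in> S" unfolding S_def lowcov_def by (auto intro!: exI[of _ "1 / real (Suc n)"] simp: not_less) (metis mem_ball not_less)
        then show ?thesis ..
      next
        case 2
        then have "q \<in> T" unfolding T_def highcov_def by (auto intro!: exI[of _ "1 / real (Suc n)"] simp: not_less) (metis mem_ball not_less)
        then show ?thesis ..
      qed
    qed
    have "0 \<in> S" unfolding S_def using strict_mono_less_eq[OF sm] by (auto intro!: exI[of _ 1])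
    moreover have S_le: "p \<le> M" if p: "p \<in> S" for p
    proof -
      obtain d where d: "0 < d" "\<And>c r. 0 < r \<and> r < d \<and> x \<in> ball c r \<Longrightarrow> p * (2 * r) \<le> f (c + r) - f (c - r)"
        using p by (auto simp: S_def)
      have "p * (2 * (d/2)) \<le> f (x + d/2) - f (x - d/2)" using d(1) by (intro d(2)) auto
      also have "\<dots> \<le> M * (2 * (d/2))" using lip[of "x - d/2" "x + d/2"] d(1) by simp
      finally show ?thesis using d(1) by simp
    qed
    ultimately have bdd: "bdd_above S" and ne: "S \<noteq> {}" by (auto simp: bdd_above_def)
    define l where "l = Sup S"
    have l0: "0 \<le> l" unfolding l_def using \<open>0 \<in> S\<close> bdd by (rule cSup_upper)
    have closed_bound: "\<exists>d>0. \<forall>y. \<bar>y - x\<bar> < d \<longrightarrow> \<bar>f y - f x - l * (y - x)\<bar> \<le> e * \<bar>y - x\<bar>" if e: "0 < e" for e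
    proof -
      obtain p0 where p0: "p0 \<in> S" "l - e < p0"
        using less_cSupD[OF ne, of "l - e"] e by (auto simp: l_def)
      obtain p where p: "p \<in> \<rat>" "l < p" "p < l + e/2" using Rats_dense_in_real[of l "l + e/2"] e by auto
      obtain q where q: "q \<in> \<rat>" "l + e/2 < q" "q < l + e" using Rats_dense_in_real[of "l + e/2" "l + e"] e by auto
      have "p \<notin> S" using p bdd by (auto simp: l_def dest: cSup_upper)
      then have "q \<in> T" using ST[of p q] p q l0 by auto
      obtain d1 where d1: "0 < d1" "\<And>c r. 0 < r \<and> r < d1 \<and> x \<in> ball c r \<Longrightarrow> p0 * (2 * r) \<le> f (c + r) - f (c - r)"
        using p0 by (auto simp: S_def)
      obtain d2 where d2: "0 < d2" "\<And>c r. 0 < r \<and> r < d2 \<and> x \<in> ball c r \<Longrightarrow> f (c + r) - f (c - r) \<le> q * (2 * r)"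
        using \<open>q \<in> T\<close> by (auto simp: T_def)
      define d where "d = min d1 d2"
      have d: "0 < d" using d1 d2 by (simp add: d_def)
      have main: "(l - e) * (b - a) \<le> f b - f a \<and> f b - f a \<le> (l + e) * (b - a)"
        if ab: "a < b" "b - a < d" "a \<le> x" "x \<le> b" for a b
      proof -
        define A where "A h = a - h" for h :: real
        define B where "B h = b + h" for h :: real
        \<comment> \<open>The slope bounds hold for open intervals around \<open>x\<close>; intervals with endpoint \<open>x\<close> are limits of these.\<close>
        have ev: "\<forall>\<^sub>F h in at_right 0. (l - e) * (B h - A h) \<le> f (B h) - f (A h) \<and> f (B h) - f (A h) \<le> (l + e) * (B h - A h)"
          unfolding eventually_at_right_field
        proof (intro exI[of _ "(d - (b - a)) / 2"] conjI allI impI)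
          show "0 < (d - (b - a)) / 2" using ab by simp
        next
          fix h assume h: "0 < h" "h < (d - (b - a)) / 2"
          have rew: "(A h + B h)/2 + (B h - A h)/2 = B h" "(A h + B h)/2 - (B h - A h)/2 = A h" by (auto simp: field_simps)
          have c: "0 < (B h - A h)/2 \<and> (B h - A h)/2 < d \<and> x \<in> ball ((A h + B h)/2) ((B h - A h)/2)"
            using ab h by (auto simp: A_def B_def dist_real_def abs_if field_simps)
          have "p0 * (B h - A h) \<le> f (B h) - f (A h)"
            using d1(2)[of "(B h - A h)/2" "(A h + B h)/2"] c unfolding rew by (simp add: d_def field_simps)
          moreover have "f (B h) - f (A h) \<le> q * (B h - A h)"
            using d2(2)[of "(B h - A h)/2" "(A h + B h)/2"] c unfolding rew by (simp add: d_def field_simps)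
          moreover have "(l - e) * (B h - A h) \<le> p0 * (B h - A h)" "q * (B h - A h) \<le> (l + e) * (B h - A h)"
            using p0 q c by (auto intro!: mult_right_mono)
          ultimately show "(l - e) * (B h - A h) \<le> f (B h) - f (A h)" "f (B h) - f (A h) \<le> (l + e) * (B h - A h)" by linarith+
        qed
        have AB: "(A \<longlongrightarrow> a) (at_right 0)" "(B \<longlongrightarrow> b) (at_right 0)"
          unfolding A_def B_def by (auto intro!: tendsto_eq_intros)
        have fAB: "((\<lambda>h. f (A h)) \<longlongrightarrow> f a) (at_right 0)" "((\<lambda>h. f (B h)) \<longlongrightarrow> f b) (at_right 0)"
          using contf AB by (auto intro!: isCont_tendsto_compose[of _ f] simp: continuous_on_eq_continuous_at)
        show ?thesis
        proof
          show "(l - e) * (b - a) \<le> f b - f a"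
            by (rule tendsto_le[OF _ tendsto_diff[OF fAB(2,1)] tendsto_mult[OF tendsto_const tendsto_diff[OF AB(2,1)]]])
               (use ev in \<open>auto elim: eventually_mono\<close>)
          show "f b - f a \<le> (l + e) * (b - a)"
            by (rule tendsto_le[OF _ tendsto_mult[OF tendsto_const tendsto_diff[OF AB(2,1)]] tendsto_diff[OF fAB(2,1)]])
               (use ev in \<open>auto elim: eventually_mono\<close>)
        qed
      qed
      show ?thesis
      proof (intro exI[of _ d] conjI allI impI d)
        fix y assume y: "\<bar>y - x\<bar> < d"
        show "\<bar>f y - f x - l * (y - x)\<bar> \<le> e * \<bar>y - x\<bar>"
          using main[of x y] main[of y x] y by (cases x y rule: linorder_cases) (auto simp: abs_if algebra_simps)
      qed
    qed
    have "(f has_derivative (\<lambda>h. l * h)) (at x)"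
      unfolding has_derivative_at_alt using closed_bound by (auto simp: bounded_linear_mult_right)
    then show ?thesis by (rule differentiableI)
  qed
  ultimately show ?thesis by (intro AE_I'[of N]) auto
qed

text \<open>
  Rademacher's theorem in dimension one. Adding a steep linear function makes \<open>g\<close> bi-Lipschitz and
  increasing.
\<close>

lemma lipschitz_real_differentiable_AE:
  fixes g :: "real \<Rightarrow> real"
  assumes L: "L-lipschitz_on UNIV g"
  shows "AE x in lborel. g differentiable (at x)"
proof -
  have g: "\<bar>g y - g x\<bar> \<le> L * (y - x)" if "x \<le> y" for x y
    using lipschitz_onD[OF L, of y x] that by (simp add: dist_real_def)
  define f where "f x = g x + (L + 1) * x" for x
  have "AE x in lborel. f differentiable (at x)"
  proof (rule bilipschitz_real_differentiable_AE)
    fix x y :: real assume "x \<le> y"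
    then show "f y - f x \<le> (2 * L + 1) * (y - x)" "y - x \<le> f y - f x"
      using g[of x y] by (auto simp: f_def algebra_simps abs_le_iff)
  qed
  then show ?thesis
  proof eventually_elim
    case (elim x)
    then have "(\<lambda>x. f x - (L + 1) * x) differentiable (at x)" by (intro differentiable_diff) auto
    then show ?case by (simp add: f_def)
  qed
qed

text \<open>
  The derivative wherever it exists, and a Borel function for every continuous \<open>g\<close>.
\<close>

definition deriv_candidate :: "(real \<Rightarrow> real) \<Rightarrow> real \<Rightarrow> real" where
  "deriv_candidate g s = lim (\<lambda>n. (g (s + 1 / real (Suc n)) - g s) * real (Suc n))"

lemma deriv_candidate_eq:
  assumes "(g has_real_derivative d) (at s)"
  shows "deriv_candidate g s = d"
proof -
  have "((\<lambda>h. (g (s + h) - g s) / h) \<longlongrightarrow> d) (at 0)" using assms by (simp add: DERIV_def)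
  moreover have "filterlim (\<lambda>n. 1 / real (Suc n)) (at 0) sequentially"
    unfolding filterlim_at using LIMSEQ_inverse_real_of_nat by (auto simp: inverse_eq_divide)
  ultimately have "(\<lambda>n. (g (s + 1 / real (Suc n)) - g s) / (1 / real (Suc n))) \<longlonglongrightarrow> d"
    by (rule filterlim_compose)
  then show ?thesis unfolding deriv_candidate_def by (intro limI) simp
qed

lemma borel_measurable_deriv_candidate:
  assumes "continuous_on UNIV g"
  shows "deriv_candidate g \<in> borel_measurable borel"
proof -
  have [measurable]: "g \<in> borel_measurable borel" using assms by (rule borel_measurable_continuous_onI)
  show ?thesis unfolding deriv_candidate_def by measurable
qed

text \<open>
  The outward normal is defined pointwise and is set to 0 where it fails to exist, and the measure
  space of arc length is not completed. Hence null sets cannot be ignored, and the set of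
  differentiability has to be exactly Borel: by continuity the difference quotient estimates need
  to be required at rational points only.
\<close>

lemma sets_borel_differentiable:
  fixes g :: "real \<Rightarrow> real"
  assumes cont: "continuous_on UNIV g"
  shows "{s. g differentiable (at s)} \<in> sets borel"
proof -
  have [measurable]: "g \<in> borel_measurable borel" using cont by (rule borel_measurable_continuous_onI)
  note [measurable] = borel_measurable_deriv_candidate[OF cont]
  let ?P = "\<lambda>k n s t. \<bar>t - s\<bar> < 1 / real (Suc n) \<longrightarrow>
      \<bar>g t - g s - deriv_candidate g s * (t - s)\<bar> \<le> \<bar>t - s\<bar> / real (Suc k)"
  have dense: "?P k n s t" if "\<forall>t\<in>\<rat>. ?P k n s t" for k n s t
  proof
    assume t: "\<bar>t - s\<bar> < 1 / real (Suc n)"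
    define A where "A = {t. \<bar>t - s\<bar> < 1 / real (Suc n) \<and> \<bar>t - s\<bar> / real (Suc k) < \<bar>g t - g s - deriv_candidate g s * (t - s)\<bar>}"
    have A: "open A"
      unfolding A_def by (intro open_Collect_conj open_Collect_less continuous_intros cont) auto
    have notA: "r \<notin> A" if "r \<in> \<rat>" for r
      using \<open>\<forall>t\<in>\<rat>. ?P k n s t\<close> that unfolding A_def by fastforce
    have "t \<notin> A"
    proof
      assume "t \<in> A"
      then obtain e where e: "0 < e" "ball t e \<subseteq> A" using openE[OF A] by metis
      obtain r where r: "r \<in> \<rat>" "t < r" "r < t + e" using Rats_dense_in_real[of t "t + e"] e by auto
      then have "r \<in> ball t e" by (auto simp: dist_real_def)
      then show False using e(2) notA[OF r(1)] by blast
    qed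
    then show "\<bar>g t - g s - deriv_candidate g s * (t - s)\<bar> \<le> \<bar>t - s\<bar> / real (Suc k)"
      using t unfolding A_def mem_Collect_eq by linarith
  qed
  have "{s. g differentiable (at s)} = {s. \<forall>k. \<exists>n. \<forall>t\<in>\<rat>. ?P k n s t}"
  proof (intro set_eqI iffI; clarify)
    fix s k assume "g differentiable (at s)"
    then obtain d where d: "(g has_real_derivative d) (at s)" using real_differentiable_def by blast
    then have "(g has_derivative (*) d) (at s)" by (rule has_field_derivative_imp_has_derivative)
    then obtain e where e: "0 < e" "\<And>t. norm (t - s) < e \<Longrightarrow> norm (g t - g s - d * (t - s)) \<le> 1 / real (Suc k) * norm (t - s)"
      unfolding has_derivative_at_alt by (metis of_nat_0_less_iff zero_less_Suc zero_less_divide_1_iff)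
    obtain n where n: "1 / real (Suc n) < e" using nat_approx_posE[OF e(1)] by blast
    show "\<exists>n. \<forall>t\<in>\<rat>. ?P k n s t"
      using e(2) n unfolding deriv_candidate_eq[OF d] by (intro exI[of _ n]) fastforce
  next
    fix s assume *: "\<forall>k. \<exists>n. \<forall>t\<in>\<rat>. ?P k n s t"
    have "(g has_derivative (*) (deriv_candidate g s)) (at s)"
      unfolding has_derivative_at_alt
    proof (intro conjI allI impI bounded_linear_mult_right)
      fix e :: real assume "0 < e"
      then obtain k where k: "1 / real (Suc k) < e" using nat_approx_posE by blast
      obtain n where n: "\<forall>t\<in>\<rat>. ?P k n s t" using * by blast
      have "norm (g t - g s - deriv_candidate g s * (t - s)) \<le> e * norm (t - s)" if "norm (t - s) < 1 / real (Suc n)" for t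
      proof -
        have "\<bar>g t - g s - deriv_candidate g s * (t - s)\<bar> \<le> 1 / real (Suc k) * \<bar>t - s\<bar>"
          using dense[OF n, of t] that by simp
        also have "\<dots> \<le> e * \<bar>t - s\<bar>" using k by (intro mult_right_mono) auto
        finally show ?thesis by simp
      qed
      then show "\<exists>d>0. \<forall>y. norm (y - s) < d \<longrightarrow> norm (g y - g s - deriv_candidate g s * (y - s)) \<le> e * norm (y - s)"
        by (intro exI[of _ "1 / real (Suc n)"]) auto
    qed
    then show "g differentiable (at s)" by (rule differentiableI)
  qed
  also have "\<dots> \<in> sets borel"
  proof -
    have "Measurable.pred borel (\<lambda>s. \<forall>k. \<exists>n. \<forall>t\<in>\<rat>. ?P k n s t)"
      using countable_rat by measurable
    then show ?thesis by (simp add: pred_def)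
  qed
  finally show ?thesis .
qed

section \<open>Arc length of curves\<close>

lemma hausdorff1_outer_lipschitz_image:
  fixes f :: "'a::metric_space \<Rightarrow> 'b::metric_space"
  assumes c: "0 < c" and lip: "\<And>x y. x \<in> A \<Longrightarrow> y \<in> A \<Longrightarrow> dist (f x) (f y) \<le> c * dist x y"
  shows "hausdorff1_outer (f ` A) \<le> ennreal c * hausdorff1_outer A"
proof (rule hausdorff1_outer_upper)
  fix \<delta> :: real assume \<delta>: "0 < \<delta>"
  have inv: "ennreal c * (ennreal (1/c) * x) = x" for x
    using c by (simp add: mult.assoc[symmetric] ennreal_mult[symmetric])
  have "ennreal (1/c) * hausdorff1_premeasure \<delta> (f ` A) \<le> hausdorff1_premeasure (\<delta> / c) A"
  proof (rule hausdorff1_premeasure_lower)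
    fix E assume E: "A \<subseteq> (\<Union>i::nat. E i)" "\<And>i. bounded (E i)" "\<And>i. diameter (E i) \<le> \<delta> / c"
    have d: "dist (f x) (f y) \<le> c * diameter (E i)" if "x \<in> E i \<inter> A" "y \<in> E i \<inter> A" for x y i
    proof -
      have "dist (f x) (f y) \<le> c * dist x y" using that lip by auto
      also have "\<dots> \<le> c * diameter (E i)"
        using c that E(2) by (intro mult_left_mono diameter_bounded_bound) auto
      finally show ?thesis .
    qed
    have bd: "bounded (f ` (E i \<inter> A))" for i
      unfolding bounded_two_points using d by blast
    have diam: "diameter (f ` (E i \<inter> A)) \<le> c * diameter (E i)" for i
      using d[of _ i] c diameter_ge_0[OF E(2)[of i]] by (auto simp: diameter_def[of "f ` _"] intro!: cSUP_least)
    have "hausdorff1_premeasure \<delta> (f ` A) \<le> (\<Sum>i. ennreal (diameter (f ` (E i \<inter> A))))"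
    proof (rule hausdorff1_premeasure_upper)
      show "f ` A \<subseteq> (\<Union>i. f ` (E i \<inter> A))" using E(1) by blast
      fix i
      have "c * diameter (E i) \<le> \<delta>" using E(3)[of i] c by (simp add: field_simps)
      then show "diameter (f ` (E i \<inter> A)) \<le> \<delta>" using diam[of i] by linarith
    qed (rule bd)
    also have "\<dots> \<le> (\<Sum>i. ennreal c * ennreal (diameter (E i)))"
      using diam c by (intro suminf_le summableI) (simp_all add: ennreal_mult'[symmetric] ennreal_leI)
    also have "\<dots> = ennreal c * (\<Sum>i. ennreal (diameter (E i)))" by (rule ennreal_suminf_cmult)
    finally have "ennreal (1/c) * hausdorff1_premeasure \<delta> (f ` A) \<le> ennreal (1/c) * (ennreal c * (\<Sum>i. ennreal (diameter (E i))))"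
      by (rule mult_left_mono) simp
    also have "\<dots> = (\<Sum>i. ennreal (diameter (E i)))"
      using c by (simp add: mult.assoc[symmetric] ennreal_mult[symmetric])
    finally show "ennreal (1/c) * hausdorff1_premeasure \<delta> (f ` A) \<le> (\<Sum>i. ennreal (diameter (E i)))" .
  qed
  also have "\<dots> \<le> hausdorff1_outer A" using \<delta> c by (intro hausdorff1_outer_lower) simp
  finally have "ennreal c * (ennreal (1/c) * hausdorff1_premeasure \<delta> (f ` A)) \<le> ennreal c * hausdorff1_outer A"
    by (rule mult_left_mono) simp
  then show "hausdorff1_premeasure \<delta> (f ` A) \<le> ennreal c * hausdorff1_outer A"
    by (simp only: inv)
qed

text \<open>
  In the upper bound an interval is cut into short equal pieces; in the lower bound each covering set is
  enlarged to an interval of the same diameter.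
\<close>

lemma arc_length_real: "arc_length = (lborel :: real measure)"
proof (rule lborel_eqI[symmetric])
  fix l u :: real assume "\<And>b. b \<in> Basis \<Longrightarrow> l \<bullet> b \<le> u \<bullet> b"
  then have lu: "l \<le> u" by simp
  have upper: "hausdorff1_outer {l<..<u} \<le> ennreal (u - l)"
  proof (rule hausdorff1_outer_upper)
    fix \<delta> :: real assume \<delta>: "0 < \<delta>"
    obtain n :: nat where "(u - l) / \<delta> < real n" using reals_Archimedean2 by blast
    moreover have "0 \<le> (u - l) / \<delta>" using lu \<delta> by simp
    ultimately have "0 < real n" by linarith
    then have n: "0 < n" "(u - l) / n \<le> \<delta>" using \<delta> \<open>(u - l) / \<delta> < real n\<close> by (auto simp: field_simps)
    define h where "h = (u - l) / n"
    have h: "0 \<le> h" "h \<le> \<delta>" "real n * h = u - l" using lu n by (auto simp: h_def)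
    define E where "E i = (if i < n then {l + real i * h .. l + real (Suc i) * h} else {})" for i
    have "hausdorff1_premeasure \<delta> {l<..<u} \<le> (\<Sum>i. ennreal (diameter (E i)))"
    proof (rule hausdorff1_premeasure_upper)
      show "{l<..<u} \<subseteq> (\<Union>i. E i)"
      proof
        fix x assume x: "x \<in> {l<..<u}"
        then have h0: "0 < h" using h lu by (cases "h = 0") auto
        define i where "i = nat \<lfloor>(x - l) / h\<rfloor>"
        have "0 \<le> (x - l) / h" using x h0 by simp
        then have i: "real i \<le> (x - l) / h" "(x - l) / h < real i + 1"
          unfolding i_def by (auto simp: of_nat_nat) 
        have "real i * h \<le> x - l" "x - l < (real i + 1) * h" using i h0 by (auto simp: field_simps)
        moreover have "i < n"
        proof -
          have "real i * h < real n * h" using \<open>real i * h \<le> x - l\<close> x h by auto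
          then show ?thesis using h0 by simp
        qed
        ultimately have "x \<in> E i" by (auto simp: E_def algebra_simps)
        then show "x \<in> (\<Union>i. E i)" by blast
      qed
      fix i
      show "bounded (E i)" by (simp add: E_def)
      show "diameter (E i) \<le> \<delta>" using h by (simp add: E_def algebra_simps)
    qed
    also have "\<dots> = (\<Sum>i<n. ennreal (diameter (E i)))"
      by (rule suminf_finite) (auto simp: E_def)
    also have "\<dots> = (\<Sum>i<n. ennreal h)"
      using h by (intro sum.cong) (auto simp: E_def algebra_simps)
    also have "\<dots> = ennreal (u - l)"
      using h by (simp add: ennreal_of_nat_eq_real_of_nat ennreal_mult[symmetric])
    finally show "hausdorff1_premeasure \<delta> {l<..<u} \<le> ennreal (u - l)" .
  qed
  have "ennreal (u - l) \<le> hausdorff1_premeasure 1 {l<..<u}"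
  proof (rule hausdorff1_premeasure_lower)
    fix E assume E: "{l<..<u} \<subseteq> (\<Union>i::nat. E i)" "\<And>i. bounded (E i)" "\<And>i. diameter (E i) \<le> 1"
    have "\<exists>a b. a \<le> b \<and> E i \<subseteq> {a..b} \<and> b - a \<le> diameter (E i)" for i
    proof (cases "E i = {}")
      case True then show ?thesis by (auto intro!: exI[of _ 0])
    next
      case False
      have bd: "bdd_above (E i)" "bdd_below (E i)" using E(2)[of i] by (auto intro: bounded_imp_bdd_above bounded_imp_bdd_below)
      have "Sup (E i) - diameter (E i) \<le> Inf (E i)"
      proof (rule cInf_greatest[OF False])
        fix x assume x: "x \<in> E i"
        have "Sup (E i) \<le> x + diameter (E i)"
        proof (rule cSup_least[OF False])
          fix y assume "y \<in> E i"
          then have "dist y x \<le> diameter (E i)" using x E(2) by (intro diameter_bounded_bound)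
          then show "y \<le> x + diameter (E i)" by (auto simp: dist_real_def)
        qed
        then show "Sup (E i) - diameter (E i) \<le> x" by simp
      qed
      moreover have "Inf (E i) \<le> Sup (E i)" using False bd by (meson cInf_le_cSup)
      moreover have "E i \<subseteq> {Inf (E i)..Sup (E i)}" using bd by (auto intro: cInf_lower cSup_upper)
      ultimately show ?thesis by (intro exI[of _ "Inf (E i)"] exI[of _ "Sup (E i)"]) auto
    qed
    then obtain a b where ab: "\<And>i. a i \<le> b i" "\<And>i. E i \<subseteq> {a i..b i}" "\<And>i. b i - a i \<le> diameter (E i)"
      by metis
    have "ennreal (u - l) = emeasure lborel {l<..<u}" using lu by simp
    also have "\<dots> \<le> emeasure lborel (\<Union>i. {a i..b i})"
      using E(1) ab(2) by (intro emeasure_mono) (blast, simp)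
    also have "\<dots> \<le> (\<Sum>i. emeasure lborel {a i..b i})"
      by (rule emeasure_subadditive_countably) auto
    also have "\<dots> \<le> (\<Sum>i. ennreal (diameter (E i)))"
      using ab by (intro suminf_le summableI) (simp_all add: ennreal_leI)
    finally show "ennreal (u - l) \<le> (\<Sum>i. ennreal (diameter (E i)))" .
  qed
  also have "\<dots> \<le> hausdorff1_outer {l<..<u}" by (rule hausdorff1_outer_lower) simp
  finally show "emeasure arc_length (box l u) = (\<Prod>b\<in>Basis. (u - l) \<bullet> b)"
    using upper lu by (simp add: emeasure_arc_length box_real)
qed simp

lemma hausdorff1_outer_real: "A \<in> sets borel \<Longrightarrow> hausdorff1_outer A = emeasure lborel A" for A :: "real set"
  by (simp add: emeasure_arc_length[symmetric] arc_length_real)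

text \<open>
  The parameter line is divided into countably many Borel pieces \<open>X (m, n, j)\<close> on which \<open>\<gamma>\<close> distorts
  distances by the rational factor \<open>m\<close> up to an error \<open>e\<close>. On such a piece the length of the image
  and the integral of the speed both lie within \<open>e |D|\<close> of \<open>m |D|\<close>. Summation and \<open>e \<rightarrow> 0\<close> give
  equality. Only the metric speed enters, so no derivative of \<open>\<gamma>\<close> is needed. The left inverse \<open>\<sigma>\<close>
  lets the formula be stated as an equality of measures on the parameter line.
\<close>

theorem curve_area_formula:
  fixes \<gamma> :: "real \<Rightarrow> 'a::metric_space" and w :: "real \<Rightarrow> real"
  assumes lip: "0 < K" "\<And>s t. dist (\<gamma> s) (\<gamma> t) \<le> K * \<bar>s - t\<bar>"
    and \<sigma> [measurable]: "\<sigma> \<in> borel_measurable borel" and \<sigma>\<gamma>: "\<And>s. \<sigma> (\<gamma> s) = s"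
    and range: "range \<gamma> \<in> sets borel"
    and w [measurable]: "w \<in> borel_measurable borel"
    and speed: "AE s in lborel. ((\<lambda>t. dist (\<gamma> s) (\<gamma> t) / \<bar>s - t\<bar>) \<longlongrightarrow> w s) (at s)"
  shows "distr (density arc_length (indicator (range \<gamma>))) borel \<sigma> = density lborel (\<lambda>s. ennreal (w s))"
proof -
  have cont: "continuous_on UNIV \<gamma>"
    using lip by (intro lipschitz_on_continuous_on[of K] lipschitz_onI) (auto simp: dist_real_def)
  have image_eq: "\<gamma> ` B = \<sigma> -` B \<inter> range \<gamma>" for B using \<sigma>\<gamma> by (auto simp: image_iff)
  have image_borel: "\<gamma> ` B \<in> sets borel" if "B \<in> sets borel" for B
    using measurable_sets[OF \<sigma> that] range by (subst image_eq) auto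
  define \<nu> where "\<nu> = distr (density arc_length (indicator (range \<gamma>))) borel \<sigma>"
  define W where "W = density lborel (\<lambda>s. ennreal (w s))"
  have s\<nu>: "sets \<nu> = sets borel" and sW: "sets W = sets borel" by (auto simp: \<nu>_def W_def)
  have [measurable]: "\<sigma> \<in> borel_measurable (density arc_length (indicator (range \<gamma>)))"
    using \<sigma> by (simp cong: measurable_cong_sets)
  have \<nu>: "emeasure \<nu> B = emeasure arc_length (\<gamma> ` B)" if B: "B \<in> sets borel" for B
  proof -
    have sb: "\<sigma> -` B \<in> sets borel" using measurable_sets[OF \<sigma> B] by simp
    have "emeasure \<nu> B = emeasure (density arc_length (indicator (range \<gamma>))) (\<sigma> -` B)"
      unfolding \<nu>_def using B by (subst emeasure_distr) auto
    also have "\<dots> = (\<integral>\<^sup>+x. indicator (range \<gamma>) x * indicator (\<sigma> -` B) x \<partial>arc_length)"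
      using sb range by (intro emeasure_density) auto
    also have "\<dots> = (\<integral>\<^sup>+x. indicator (\<gamma> ` B) x \<partial>arc_length)"
      by (intro nn_integral_cong) (auto simp: image_eq[of B] indicator_def)
    also have "\<dots> = emeasure arc_length (\<gamma> ` B)" using image_borel[OF B] by simp
    finally show ?thesis .
  qed
  have W: "emeasure W B = (\<integral>\<^sup>+s\<in>B. ennreal (w s) \<partial>lborel)" if "B \<in> sets borel" for B
    unfolding W_def using that by (simp add: emeasure_density)
  have upper: "emeasure \<nu> B \<le> ennreal c * emeasure lborel B"
    if "B \<in> sets borel" "0 < c" "\<And>s t. s \<in> B \<Longrightarrow> t \<in> B \<Longrightarrow> dist (\<gamma> s) (\<gamma> t) \<le> c * \<bar>s - t\<bar>" for B c
    using hausdorff1_outer_lipschitz_image[of c B \<gamma>] that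
    by (simp add: \<nu> emeasure_arc_length image_borel hausdorff1_outer_real dist_real_def)
  have lower: "ennreal c * emeasure lborel B \<le> emeasure \<nu> B"
    if B: "B \<in> sets borel" and c: "0 < c" and d: "\<And>s t. s \<in> B \<Longrightarrow> t \<in> B \<Longrightarrow> c * \<bar>s - t\<bar> \<le> dist (\<gamma> s) (\<gamma> t)" for B c
  proof -
    have "hausdorff1_outer (\<sigma> ` \<gamma> ` B) \<le> ennreal (1/c) * hausdorff1_outer (\<gamma> ` B)"
    proof (rule hausdorff1_outer_lipschitz_image)
      fix x y assume "x \<in> \<gamma> ` B" "y \<in> \<gamma> ` B"
      then show "dist (\<sigma> x) (\<sigma> y) \<le> 1 / c * dist x y"
        using d c by (auto simp: \<sigma>\<gamma> dist_real_def field_simps)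
    qed (use c in simp)
    also have "\<sigma> ` \<gamma> ` B = B" by (auto simp: image_image \<sigma>\<gamma>)
    finally have "ennreal c * emeasure lborel B \<le> ennreal c * (ennreal (1/c) * emeasure \<nu> B)"
      using B by (intro mult_left_mono) (auto simp: \<nu> emeasure_arc_length image_borel hausdorff1_outer_real)
    then show ?thesis using c by (simp add: mult.assoc[symmetric] ennreal_mult[symmetric])
  qed
  obtain N where N0: "\<And>s. s \<in> space lborel - N \<Longrightarrow> ((\<lambda>t. dist (\<gamma> s) (\<gamma> t) / \<bar>s - t\<bar>) \<longlongrightarrow> w s) (at s)"
    "N \<in> null_sets lborel"
    by (rule AE_E3[OF speed]) (rule that)
  then have N: "N \<in> null_sets lborel"
    "\<And>s. s \<notin> N \<Longrightarrow> ((\<lambda>t. dist (\<gamma> s) (\<gamma> t) / \<bar>s - t\<bar>) \<longlongrightarrow> w s) (at s)" by auto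
  have Nb: "N \<in> sets borel" using N(1) by auto
  have approx: "emeasure \<nu> B \<le> emeasure W B + ennreal (2 * e) * emeasure lborel B \<and>
      emeasure W B \<le> emeasure \<nu> B + ennreal (2 * e) * emeasure lborel B"
    if B: "B \<in> sets borel" "B \<inter> N = {}" and e: "0 < e" for B e
  proof -
    define X where "X = (\<lambda>(m::real, n::nat, j::int).
      {s. \<forall>t. \<bar>s - t\<bar> < 1 / real (Suc n) \<longrightarrow> \<bar>dist (\<gamma> s) (\<gamma> t) - m * \<bar>s - t\<bar>\<bar> \<le> e * \<bar>s - t\<bar>} \<inter>
      {s. \<lfloor>real (Suc n) * s\<rfloor> = j})"
    define I where "I = (\<rat> :: real set) \<times> (UNIV::nat set) \<times> (UNIV::int set)"
    have I: "countable I" "I \<noteq> {}" unfolding I_def by (auto intro!: countable_SIGMA countable_rat intro: Rats_0)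
    have X_borel: "X i \<in> sets borel" for i
    proof -
      obtain m n j where i: "i = (m, n, j)" by (cases i)
      have "open {s. \<bar>s - t\<bar> < 1 / real (Suc n) \<and> e * \<bar>s - t\<bar> < \<bar>dist (\<gamma> s) (\<gamma> t) - m * \<bar>s - t\<bar>\<bar>}" for t
        by (intro open_Collect_conj open_Collect_less continuous_intros cont)
      then have "closed (\<Inter>t. - {s. \<bar>s - t\<bar> < 1 / real (Suc n) \<and> e * \<bar>s - t\<bar> < \<bar>dist (\<gamma> s) (\<gamma> t) - m * \<bar>s - t\<bar>\<bar>})"
        by (intro closed_INT ballI) (simp add: closed_def)
      also have "(\<Inter>t. - {s. \<bar>s - t\<bar> < 1 / real (Suc n) \<and> e * \<bar>s - t\<bar> < \<bar>dist (\<gamma> s) (\<gamma> t) - m * \<bar>s - t\<bar>\<bar>}) =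
        {s. \<forall>t. \<bar>s - t\<bar> < 1 / real (Suc n) \<longrightarrow> \<bar>dist (\<gamma> s) (\<gamma> t) - m * \<bar>s - t\<bar>\<bar> \<le> e * \<bar>s - t\<bar>}"
        by (auto simp: not_less)
      finally have "{s. \<forall>t. \<bar>s - t\<bar> < 1 / real (Suc n) \<longrightarrow> \<bar>dist (\<gamma> s) (\<gamma> t) - m * \<bar>s - t\<bar>\<bar> \<le> e * \<bar>s - t\<bar>} \<in> sets borel"
        by (rule borel_closed)
      moreover have "{s::real. \<lfloor>real (Suc n) * s\<rfloor> = j} \<in> sets borel" by measurable
      ultimately show ?thesis unfolding i X_def prod.case by (rule sets.Int)
    qed
    have cover: "B \<subseteq> (\<Union>i\<in>I. X i)"
    proof
      fix s assume "s \<in> B"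
      then have lim: "((\<lambda>t. dist (\<gamma> s) (\<gamma> t) / \<bar>s - t\<bar>) \<longlongrightarrow> w s) (at s)" using N(2) B by blast
      obtain m where m: "m \<in> \<rat>" "w s - e/2 < m" "m < w s + e/2"
        using Rats_dense_in_real[of "w s - e/2" "w s + e/2"] e by auto
      have "\<forall>\<^sub>F t in at s. dist (dist (\<gamma> s) (\<gamma> t) / \<bar>s - t\<bar>) (w s) < e/2"
        by (rule tendstoD[OF lim]) (use e in simp)
      then obtain d where d: "0 < d" "\<And>t. t \<noteq> s \<Longrightarrow> dist t s < d \<Longrightarrow> dist (dist (\<gamma> s) (\<gamma> t) / \<bar>s - t\<bar>) (w s) < e/2"
        unfolding eventually_at by auto
      obtain n where n: "1 / real (Suc n) < d" using nat_approx_posE[OF d(1)] by blast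
      have "\<bar>dist (\<gamma> s) (\<gamma> t) - m * \<bar>s - t\<bar>\<bar> \<le> e * \<bar>s - t\<bar>" if t: "\<bar>s - t\<bar> < 1 / real (Suc n)" for t
      proof (cases "t = s")
        case False
        define r where "r = dist (\<gamma> s) (\<gamma> t) / \<bar>s - t\<bar>"
        have "\<bar>r - w s\<bar> < e/2" using d(2)[OF False] t n by (auto simp: dist_real_def abs_minus_commute r_def)
        then have "\<bar>r - m\<bar> \<le> e" using m by linarith
        then have "\<bar>r - m\<bar> * \<bar>s - t\<bar> \<le> e * \<bar>s - t\<bar>" by (rule mult_right_mono) simp
        also have "\<bar>r - m\<bar> * \<bar>s - t\<bar> = \<bar>(r - m) * \<bar>s - t\<bar>\<bar>" by (simp add: abs_mult)
        also have "(r - m) * \<bar>s - t\<bar> = dist (\<gamma> s) (\<gamma> t) - m * \<bar>s - t\<bar>" using False by (simp add: r_def algebra_simps)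
        finally show ?thesis .
      qed simp
      then have "s \<in> X (m, n, \<lfloor>real (Suc n) * s\<rfloor>)" by (auto simp: X_def)
      then show "s \<in> (\<Union>i\<in>I. X i)" using m by (auto simp: I_def)
    qed
    have piece: "emeasure \<nu> D \<le> emeasure W D + ennreal (2 * e) * emeasure lborel D \<and>
      emeasure W D \<le> emeasure \<nu> D + ennreal (2 * e) * emeasure lborel D"
      if D: "D \<in> sets borel" "D \<inter> N = {}" "D \<subseteq> X i" for D i
    proof -
      obtain m n j where i: "i = (m, n, j)" by (cases i)
      have close: "\<bar>dist (\<gamma> s) (\<gamma> t) - m * \<bar>s - t\<bar>\<bar> \<le> e * \<bar>s - t\<bar>" if "s \<in> D" "t \<in> D" for s t
      proof -
        have "\<lfloor>real (Suc n) * s\<rfloor> = \<lfloor>real (Suc n) * t\<rfloor>" using that D(3) by (auto simp: i X_def)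
        then have "\<bar>real (Suc n) * s - real (Suc n) * t\<bar> < 1" by linarith
        also have "\<bar>real (Suc n) * s - real (Suc n) * t\<bar> = real (Suc n) * \<bar>s - t\<bar>"
          by (simp add: right_diff_distrib[symmetric] abs_mult del: of_nat_Suc)
        finally have "\<bar>s - t\<bar> < 1 / real (Suc n)" by (simp add: field_simps)
        then show ?thesis using that D(3) by (auto simp: i X_def)
      qed
      have wm: "\<bar>w s - m\<bar> \<le> e" if "s \<in> D" for s
      proof -
        have lim: "((\<lambda>t. \<bar>dist (\<gamma> s) (\<gamma> t) / \<bar>s - t\<bar> - m\<bar>) \<longlongrightarrow> \<bar>w s - m\<bar>) (at s)"
          using N(2) D that by (intro tendsto_intros) blast
        have "\<forall>\<^sub>F t in at s. \<bar>dist (\<gamma> s) (\<gamma> t) / \<bar>s - t\<bar> - m\<bar> \<le> e"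
          unfolding eventually_at
        proof (intro exI[of _ "1 / real (Suc n)"] conjI ballI impI)
          fix t assume t: "t \<noteq> s \<and> dist t s < 1 / real (Suc n)"
          then have "\<bar>dist (\<gamma> s) (\<gamma> t) - m * \<bar>s - t\<bar>\<bar> \<le> e * \<bar>s - t\<bar>"
            using that D(3) by (auto simp: i X_def dist_real_def abs_minus_commute)
          moreover have "dist (\<gamma> s) (\<gamma> t) - m * \<bar>s - t\<bar> = (dist (\<gamma> s) (\<gamma> t) / \<bar>s - t\<bar> - m) * \<bar>s - t\<bar>"
            using t by (simp add: algebra_simps)
          ultimately have "\<bar>dist (\<gamma> s) (\<gamma> t) / \<bar>s - t\<bar> - m\<bar> * \<bar>s - t\<bar> \<le> e * \<bar>s - t\<bar>" by (simp add: abs_mult)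
          then show "\<bar>dist (\<gamma> s) (\<gamma> t) / \<bar>s - t\<bar> - m\<bar> \<le> e" using t by (simp add: mult_le_cancel_right)
        qed simp
        then show ?thesis using tendsto_upperbound[OF lim] by simp
      qed
      have nonneg: "0 \<le> w s" if "s \<in> D" for s
      proof (rule tendsto_lowerbound)
        show "((\<lambda>t. dist (\<gamma> s) (\<gamma> t) / \<bar>s - t\<bar>) \<longlongrightarrow> w s) (at s)" using N(2) D that by blast
      qed auto
      show ?thesis
      proof (cases "D = {}")
        case False
        then have m: "0 \<le> m + e" using wm nonneg by fastforce
        have W_le: "emeasure W D \<le> ennreal (m + e) * emeasure lborel D"
        proof -
          have "emeasure W D \<le> (\<integral>\<^sup>+s\<in>D. ennreal (m + e) \<partial>lborel)"
            unfolding W[OF D(1)] using wm by (intro nn_integral_mono) (force simp: indicator_def intro!: ennreal_leI)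
          also have "\<dots> = ennreal (m + e) * emeasure lborel D" using D by (simp add: nn_integral_cmult_indicator)
          finally show ?thesis .
        qed
        have W_ge: "ennreal (m - e) * emeasure lborel D \<le> emeasure W D"
        proof -
          have "ennreal (m - e) * emeasure lborel D = (\<integral>\<^sup>+s\<in>D. ennreal (m - e) \<partial>lborel)"
            using D by (simp add: nn_integral_cmult_indicator)
          also have "\<dots> \<le> emeasure W D"
            unfolding W[OF D(1)] using wm by (intro nn_integral_mono) (force simp: indicator_def intro!: ennreal_leI)
          finally show ?thesis .
        qed
        have \<nu>_le: "emeasure \<nu> D \<le> ennreal (m + e) * emeasure lborel D"
        proof (cases "m + e = 0")
          case True
          have "\<exists>a. D \<subseteq> {a}"
          proof -
            have "s = t" if "s \<in> D" "t \<in> D" for s t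
            proof -
              have "dist (\<gamma> s) (\<gamma> t) \<le> (m + e) * \<bar>s - t\<bar>" using close[OF that] by (auto simp: abs_le_iff algebra_simps)
              then have "\<gamma> s = \<gamma> t" using True by simp
              then show ?thesis using \<sigma>\<gamma> by metis
            qed
            then show ?thesis using False by blast
          qed
          then have "emeasure lborel D = 0" 
            by (metis emeasure_lborel_countable countable_subset countable_empty countable_insert)
          then show ?thesis using upper[OF D(1) lip(1)] lip(2) by simp
        next
          case False
          have "dist (\<gamma> s) (\<gamma> t) \<le> (m + e) * \<bar>s - t\<bar>" if "s \<in> D" "t \<in> D" for s t
            using close[OF that] by (auto simp: abs_le_iff algebra_simps)
          then show ?thesis using m False by (intro upper D) auto
        qed
        have \<nu>_ge: "ennreal (m - e) * emeasure lborel D \<le> emeasure \<nu> D"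
        proof (cases "0 < m - e")
          case True
          have "(m - e) * \<bar>s - t\<bar> \<le> dist (\<gamma> s) (\<gamma> t)" if "s \<in> D" "t \<in> D" for s t
            using close[OF that] by (auto simp: abs_le_iff algebra_simps)
          then show ?thesis using True by (intro lower D) auto
        qed (simp add: ennreal_neg)
        have "ennreal (m + e) \<le> ennreal (m - e) + ennreal (2 * e)"
        proof (cases "0 \<le> m - e")
          case True then show ?thesis using e by (simp add: ennreal_plus[symmetric] del: ennreal_plus)
        next
          case False then show ?thesis by (simp add: ennreal_neg ennreal_leI)
        qed
        then have "ennreal (m + e) * emeasure lborel D \<le> (ennreal (m - e) + ennreal (2 * e)) * emeasure lborel D"
          by (rule mult_right_mono) simp
        then have key: "ennreal (m + e) * emeasure lborel D \<le> ennreal (m - e) * emeasure lborel D + ennreal (2 * e) * emeasure lborel D"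
          by (simp add: distrib_right)
        show ?thesis
          using order_trans[OF \<nu>_le order_trans[OF key add_right_mono[OF W_ge]]]
            order_trans[OF W_le order_trans[OF key add_right_mono[OF \<nu>_ge]]] by blast
      qed simp
    qed
    define Y where "Y k = B \<inter> disjointed (\<lambda>k. X (from_nat_into I k)) k" for k
    have Y_borel: "range Y \<subseteq> sets borel"
    proof -
      have "range (\<lambda>k. X (from_nat_into I k)) \<subseteq> sets borel" using X_borel by blast
      then have "range (disjointed (\<lambda>k. X (from_nat_into I k))) \<subseteq> sets borel" by (rule sets.range_disjointed_sets)
      then show ?thesis unfolding Y_def using B(1) by blast
    qed
    have disj: "disjoint_family Y"
      using disjoint_family_disjointed[of "\<lambda>k. X (from_nat_into I k)"] by (auto simp: Y_def disjoint_family_on_def)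
    have UY: "(\<Union>k. Y k) = B"
    proof -
      have "(\<Union>k. Y k) = B \<inter> (\<Union>k. X (from_nat_into I k))"
        unfolding Y_def UN_disjointed_eq[symmetric, of "\<lambda>k. X (from_nat_into I k)"] by auto
      also have "(\<Union>k. X (from_nat_into I k)) = (\<Union>i\<in>I. X i)"
      proof -
        have "(\<Union>k. X (from_nat_into I k)) = (\<Union>i\<in>range (from_nat_into I). X i)" by blast
        then show ?thesis by (simp only: range_from_nat_into[OF I(2,1)])
      qed
      finally show ?thesis using cover by (simp add: Int_absorb2)
    qed
    have Y_piece: "Y k \<inter> N = {}" "Y k \<subseteq> X (from_nat_into I k)" "Y k \<in> sets borel" for k
      using B disjointed_subset[of "\<lambda>k. X (from_nat_into I k)" k] Y_borel by (auto simp: Y_def)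
    have sums: "emeasure \<nu> B = (\<Sum>k. emeasure \<nu> (Y k))" "emeasure W B = (\<Sum>k. emeasure W (Y k))"
      "emeasure lborel B = (\<Sum>k. emeasure lborel (Y k))"
      using suminf_emeasure[OF _ disj, of \<nu>] suminf_emeasure[OF _ disj, of W] suminf_emeasure[OF _ disj, of lborel]
        Y_borel by (auto simp: UY s\<nu> sW)
    have "emeasure \<nu> B \<le> (\<Sum>k. emeasure W (Y k) + ennreal (2 * e) * emeasure lborel (Y k))"
      unfolding sums using piece[OF Y_piece(3,1,2)] by (intro suminf_le summableI) blast
    moreover have "emeasure W B \<le> (\<Sum>k. emeasure \<nu> (Y k) + ennreal (2 * e) * emeasure lborel (Y k))"
      unfolding sums using piece[OF Y_piece(3,1,2)] by (intro suminf_le summableI) blast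
    moreover have "(\<Sum>k. a k + c * b k) = (\<Sum>k. a k) + c * (\<Sum>k. b k)" for a b :: "nat \<Rightarrow> ennreal" and c
      by (subst suminf_add[symmetric, OF summableI summableI]) (simp add: ennreal_suminf_cmult)
    ultimately show ?thesis
      unfolding sums by simp
  qed
  have eq_fin: "emeasure \<nu> B = emeasure W B" if B: "B \<in> sets borel" "B \<inter> N = {}" "emeasure lborel B < \<infinity>" for B
  proof -
    obtain b where b: "emeasure lborel B = ennreal b" "0 \<le> b" using B(3) by (cases "emeasure lborel B") auto
    have le: "x \<le> y" if "\<And>e. 0 < e \<Longrightarrow> x \<le> y + ennreal (2 * e) * emeasure lborel B" for x y :: ennreal
    proof (rule ennreal_le_epsilon)
      fix e :: real assume e: "0 < e"
      have "x \<le> y + ennreal (2 * (e / (2 * (b + 1)))) * emeasure lborel B" using e b by (intro that) simp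
      also have "ennreal (2 * (e / (2 * (b + 1)))) * emeasure lborel B \<le> ennreal e"
        using e b by (simp add: ennreal_mult[symmetric] ennreal_le_iff field_simps)
      finally show "x \<le> y + ennreal e" by (simp add: add_left_mono)
    qed
    show ?thesis
    proof (rule antisym)
      show "emeasure \<nu> B \<le> emeasure W B" using approx[OF B(1,2)] le by blast
      show "emeasure W B \<le> emeasure \<nu> B" using approx[OF B(1,2)] le by blast
    qed
  qed
  have eq_nonnull: "emeasure \<nu> B = emeasure W B" if B: "B \<in> sets borel" "B \<inter> N = {}" for B
  proof -
    let ?B = "\<lambda>k::nat. B \<inter> {- real k..real k}"
    have inc: "incseq ?B" by (auto simp: incseq_def)
    have U: "(\<Union>k. ?B k) = B"
    proof -
      have "\<exists>k. x \<in> {-real k..real k}" for x using real_arch_simple[of "\<bar>x\<bar>"] by (auto simp: abs_le_iff intro: minus_le_iff[THEN iffD1])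
      then show ?thesis by auto
    qed
    have "emeasure lborel (?B k) < \<infinity>" for k
    proof (rule le_less_trans)
      show "emeasure lborel (?B k) \<le> emeasure lborel {- real k..real k}" by (rule emeasure_mono) auto
    qed simp
    then have "emeasure \<nu> (?B k) = emeasure W (?B k)" for k using B by (intro eq_fin) auto
    moreover have "(\<lambda>k. emeasure \<nu> (?B k)) \<longlonglongrightarrow> emeasure \<nu> B" "(\<lambda>k. emeasure W (?B k)) \<longlonglongrightarrow> emeasure W B"
    proof -
      have r: "range ?B \<subseteq> sets borel" using B by auto
      show "(\<lambda>k. emeasure \<nu> (?B k)) \<longlonglongrightarrow> emeasure \<nu> B"
        using Lim_emeasure_incseq[OF _ inc, of \<nu>] r unfolding U s\<nu> by blast
      show "(\<lambda>k. emeasure W (?B k)) \<longlonglongrightarrow> emeasure W B"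
        using Lim_emeasure_incseq[OF _ inc, of W] r unfolding U sW by blast
    qed
    ultimately show ?thesis using LIMSEQ_unique by simp
  qed
  have "emeasure \<nu> A = emeasure W A" if A: "A \<in> sets borel" for A
  proof -
    have null: "A \<inter> N \<in> null_sets lborel" using N(1) A by (metis Int_commute null_set_Int1 sets_lborel)
    have "emeasure \<nu> (A \<inter> N) = 0"
      using upper[of "A \<inter> N" K] null A Nb lip by (auto simp: null_sets_def)
    moreover have "emeasure W (A \<inter> N) = 0"
    proof -
      have "AE s in lborel. s \<notin> A \<inter> N" using null by (rule AE_not_in)
      then have "(\<integral>\<^sup>+s\<in>A \<inter> N. ennreal (w s) \<partial>lborel) = (\<integral>\<^sup>+s. 0 \<partial>(lborel::real measure))"
        by (intro nn_integral_cong_AE) (auto simp: indicator_def)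
      then show ?thesis using A Nb by (simp add: W)
    qed
    moreover have "emeasure \<mu> A = emeasure \<mu> (A - N) + emeasure \<mu> (A \<inter> N)" if "sets \<mu> = sets borel" for \<mu> :: "real measure"
      using plus_emeasure[of "A - N" \<mu> "A \<inter> N"] A Nb that by (auto simp: Un_Diff_Int Diff_Int_distrib2)
    ultimately show ?thesis
      using eq_nonnull[of "A - N"] A Nb s\<nu> sW by auto
  qed
  then have "\<nu> = W" by (intro measure_eqI) (auto simp: s\<nu> sW)
  then show ?thesis by (simp add: \<nu>_def W_def)
qed

section \<open>Two facts about integrals on the line and in the plane\<close>

text \<open>
  The difference of the two indicators is the signed indicator of the interval between \<open>c\<close> and \<open>y\<close>.
  This is what remains of an area between two graphs after integrating in the vertical direction.
\<close>

lemma step_difference_integral_estimate: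
  fixes \<phi> :: "real \<Rightarrow> real"
  assumes [measurable]: "\<phi> \<in> borel_measurable borel" and B: "\<And>t. \<bar>\<phi> t\<bar> \<le> B"
    and e: "\<And>t. \<bar>t - c\<bar> \<le> \<bar>y - c\<bar> \<Longrightarrow> \<bar>\<phi> t - \<phi> c\<bar> \<le> e"
  shows "\<bar>(LINT t|lborel. \<phi> t * (indicator {..<y} t - indicator {..<c} t)) - \<phi> c * (y - c)\<bar> \<le> e * \<bar>y - c\<bar>"
    (is "\<bar>?I - _\<bar> \<le> _")
proof -
  have bnd: "\<bar>(LINT t|lborel. \<phi> t * indicator {l..<u} t) - \<phi> c * (u - l)\<bar> \<le> e * (u - l)"
    if lu: "l \<le> u" and near: "\<And>t. l \<le> t \<Longrightarrow> t < u \<Longrightarrow> \<bar>\<phi> t - \<phi> c\<bar> \<le> e" for l u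
  proof -
    have int1: "integrable lborel (\<lambda>t. \<phi> t * indicator {l..<u} t)"
    proof -
      have "integrable lborel (\<lambda>t. indicator {l..<u} t *\<^sub>R \<phi> t)"
        by (rule integrableI_bounded_set_indicator[where B=B]) (use lu B in auto)
      then show ?thesis by (simp add: mult.commute)
    qed
    have int2: "integrable lborel (\<lambda>t. k * indicator {l..<u} t)" for k :: real
      using lu by (intro integrable_mult_right) simp
    have I2: "(LINT t|lborel. k * indicator {l..<u} t) = k * (u - l)" for k :: real
      using lu by simp
    have up: "(LINT t|lborel. \<phi> t * indicator {l..<u} t) \<le> (LINT t|lborel. (\<phi> c + e) * indicator {l..<u} t)"
      by (intro integral_mono int1 int2) (use near in \<open>force simp: indicator_def abs_le_iff\<close>)
    have lo: "(LINT t|lborel. (\<phi> c - e) * indicator {l..<u} t) \<le> (LINT t|lborel. \<phi> t * indicator {l..<u} t)"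
      by (intro integral_mono int1 int2) (use near in \<open>force simp: indicator_def abs_le_iff\<close>)
    show ?thesis using up lo unfolding I2 by (auto simp: abs_le_iff algebra_simps)
  qed
  show ?thesis
  proof (cases "c \<le> y")
    case True
    have "?I = (LINT t|lborel. \<phi> t * indicator {c..<y} t)"
      using True by (intro Bochner_Integration.integral_cong) (auto simp: indicator_def)
    moreover have "\<bar>(LINT t|lborel. \<phi> t * indicator {c..<y} t) - \<phi> c * (y - c)\<bar> \<le> e * (y - c)"
      using True by (intro bnd e) auto
    ultimately show ?thesis using True by simp
  next
    case False
    have "?I = (LINT t|lborel. - (\<phi> t * indicator {y..<c} t))"
      using False by (intro Bochner_Integration.integral_cong) (auto simp: indicator_def)
    then have "?I = - (LINT t|lborel. \<phi> t * indicator {y..<c} t)" by simp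
    moreover have "\<bar>(LINT t|lborel. \<phi> t * indicator {y..<c} t) - \<phi> c * (c - y)\<bar> \<le> e * (c - y)"
      using False by (intro bnd e) auto
    ultimately show ?thesis using False by (simp add: algebra_simps abs_le_iff)
  qed
qed

lemma step_difference_integral_limit:
  fixes \<phi> :: "real \<Rightarrow> real"
  assumes [measurable]: "\<phi> \<in> borel_measurable borel" and B: "\<And>t. \<bar>\<phi> t\<bar> \<le> B"
    and cont: "isCont \<phi> c" and d: "(\<lambda>n. real n * (x n - c)) \<longlonglongrightarrow> d"
  shows "(\<lambda>n. real n * (LINT t|lborel. \<phi> t * (indicator {..<x n} t - indicator {..<c} t))) \<longlonglongrightarrow> \<phi> c * d"
proof -
  have x: "x \<longlonglongrightarrow> c"
  proof -
    have "(\<lambda>n. real n * (x n - c) * (1 / real n)) \<longlonglongrightarrow> d * 0"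
      by (intro tendsto_mult d lim_1_over_n)
    moreover have "\<forall>\<^sub>F n in sequentially. real n * (x n - c) * (1 / real n) = x n - c"
      using eventually_gt_at_top[of 0] by eventually_elim simp
    ultimately have "(\<lambda>n. x n - c) \<longlonglongrightarrow> 0" by (simp add: tendsto_cong)
    then show ?thesis by (simp add: LIM_zero_iff)
  qed
  define I where "I y = (LINT t|lborel. \<phi> t * (indicator {..<y} t - indicator {..<c} t))" for y
  have est: "\<bar>I y - \<phi> c * (y - c)\<bar> \<le> e * \<bar>y - c\<bar>"
    if e: "\<And>t. \<bar>t - c\<bar> \<le> \<bar>y - c\<bar> \<Longrightarrow> \<bar>\<phi> t - \<phi> c\<bar> \<le> e" for y e
    unfolding I_def by (rule step_difference_integral_estimate[OF assms(1) B e])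
  have "(\<lambda>n. real n * (I (x n) - \<phi> c * (x n - c))) \<longlonglongrightarrow> 0"
  proof (rule LIMSEQ_I)
    fix r :: real assume r: "0 < r"
    define e where "e = r / (2 * (\<bar>d\<bar> + 1))"
    have e: "0 < e" using r by (simp add: e_def)
    obtain \<delta> where \<delta>: "0 < \<delta>" "\<And>t. \<bar>t - c\<bar> < \<delta> \<Longrightarrow> \<bar>\<phi> t - \<phi> c\<bar> < e"
      using cont e unfolding continuous_at_eps_delta by (auto simp: dist_real_def)
    have "\<forall>\<^sub>F n in sequentially. \<bar>x n - c\<bar> < \<delta>"
      using tendstoD[OF x \<delta>(1)] by (simp add: dist_real_def)
    moreover have "\<forall>\<^sub>F n in sequentially. \<bar>real n * (x n - c) - d\<bar> < 1"
      using tendstoD[OF d zero_less_one] by (simp add: dist_real_def)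
    ultimately have "\<forall>\<^sub>F n in sequentially. norm (real n * (I (x n) - \<phi> c * (x n - c)) - 0) < r"
    proof eventually_elim
      case (elim n)
      have "\<bar>I (x n) - \<phi> c * (x n - c)\<bar> \<le> e * \<bar>x n - c\<bar>"
        using elim(1) \<delta>(2) by (intro est) (auto intro: less_imp_le)
      then have "real n * \<bar>I (x n) - \<phi> c * (x n - c)\<bar> \<le> real n * (e * \<bar>x n - c\<bar>)" by (intro mult_left_mono) auto
      also have "\<dots> = e * \<bar>real n * (x n - c)\<bar>" by (simp add: abs_mult)
      also have "\<dots> \<le> e * (\<bar>d\<bar> + 1)" using elim(2) e by (intro mult_left_mono) auto
      also have "\<dots> < r"
      proof -
        have "e * (\<bar>d\<bar> + 1) = r / 2"
          using abs_ge_zero[of d] by (simp add: e_def field_simps del: abs_ge_zero)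
        then show ?thesis using r by simp
      qed
      finally show ?case by (simp add: abs_mult)
    qed
    then show "\<exists>no. \<forall>n\<ge>no. norm (real n * (I (x n) - \<phi> c * (x n - c)) - 0) < r"
      by (simp add: eventually_sequentially)
  qed
  then have "(\<lambda>n. real n * (I (x n) - \<phi> c * (x n - c)) + \<phi> c * (real n * (x n - c))) \<longlonglongrightarrow> 0 + \<phi> c * d"
    by (intro tendsto_add tendsto_mult tendsto_const d)
  then show ?thesis by (simp add: I_def algebra_simps)
qed

lemma orthonormal_plane_expansion:
  fixes u v z :: "real^2"
  assumes "norm u = 1" "norm v = 1" "u \<bullet> v = 0"
  shows "z = (z \<bullet> u) *\<^sub>R u + (z \<bullet> v) *\<^sub>R v"
proof -
  have 1: "u$1 * u$1 + u$2 * u$2 = 1" "v$1 * v$1 + v$2 * v$2 = 1" "u$1 * v$1 + u$2 * v$2 = 0"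
    using assms by (auto simp: norm_eq_1 inner_vec_def sum_2)
  define c where "c = u$1 * v$2 - u$2 * v$1"
  have v: "v$1 = - (c * u$2)" "v$2 = c * u$1" using 1 unfolding c_def by algebra+
  have c2: "c * c = 1" using 1 unfolding c_def by algebra
  have "z$1 = (z \<bullet> u) * u$1 + (z \<bullet> v) * v$1" "z$2 = (z \<bullet> u) * u$2 + (z \<bullet> v) * v$2"
    using 1 c2 unfolding inner_vec_def sum_2 v by (simp; algebra)+
  then show ?thesis by (simp add: vec_eq_iff forall_2)
qed

text \<open>
  The map is a translation after an isometry after the identification of pairs with vectors; each of
  the three preserves Lebesgue measure. This makes Fubini available in rotated coordinates.
\<close>

lemma lborel_plane_coordinates:
  fixes q u v :: "real^2"
  assumes uv: "norm u = 1" "norm v = 1" "u \<bullet> v = 0"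
  shows "distr (lborel :: (real \<times> real) measure) borel (\<lambda>(s, t). q + s *\<^sub>R u + t *\<^sub>R v) = lborel"
proof -
  define J where "J p = (fst p *\<^sub>R axis 1 1 + snd p *\<^sub>R axis 2 1 :: real^2)" for p :: "real \<times> real"
  have J_nth: "J p $ 1 = fst p" "J p $ 2 = snd p" for p by (auto simp: J_def axis_def)
  define R where "R x = x$1 *\<^sub>R u + x$2 *\<^sub>R v" for x :: "real^2"
  define R' where "R' z = (vector [z \<bullet> u, z \<bullet> v] :: real^2)" for z
  have J [measurable]: "J \<in> borel_measurable borel"
    unfolding J_def by (intro borel_measurable_continuous_onI continuous_intros)
  have lR: "linear R" by (rule linearI) (auto simp: R_def algebra_simps)
  have [measurable]: "R \<in> borel_measurable borel"
    unfolding R_def by (intro borel_measurable_continuous_onI continuous_intros)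
  have inv1: "R (R' z) = z" for z
    using orthonormal_plane_expansion[OF uv, of z] by (simp add: R_def R'_def)
  have inv2: "R' (R x) = x" for x
    using uv by (auto simp: R_def R'_def vec_eq_iff forall_2 inner_add_left inner_commute[of v u] norm_eq_1)
  have "orthogonal_transformation R'"
    unfolding orthogonal_transformation
  proof
    show "linear R'" by (rule linearI) (auto simp: R'_def vec_eq_iff forall_2 inner_add_left)
    have "norm (R x) = norm x" for x
    proof -
      have "R x \<bullet> R x = x$1 * x$1 + x$2 * x$2"
        using uv by (simp add: R_def inner_add_left inner_add_right inner_commute norm_eq_1)
      then show ?thesis by (simp add: norm_eq_sqrt_inner inner_vec_def sum_2)
    qed
    then show "\<forall>z. norm (R' z) = norm z" by (metis inv1)
  qed
  then have orth: "measure lebesgue (R' ` S) = measure lebesgue S" if "S \<in> lmeasurable" for S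
    using that by (rule measure_orthogonal_image)
  have J_eq: "lborel = distr lborel borel J"
  proof (rule lborel_eqI)
    fix l h :: "real^2" assume le: "\<And>b. b \<in> Basis \<Longrightarrow> l \<bullet> b \<le> h \<bullet> b"
    then have le': "l$1 \<le> h$1" "l$2 \<le> h$2" using le[of "axis 1 1"] le[of "axis 2 1"] by (auto simp: inner_axis axis_in_Basis_iff)
    have "J -` box l h = {l$1<..<h$1} \<times> {l$2<..<h$2}"
      by (auto simp: J_nth mem_box_cart forall_2)
    then have "emeasure (distr lborel borel J) (box l h) = emeasure lborel ({l$1<..<h$1} \<times> {l$2<..<h$2})"
      by (subst emeasure_distr) auto
    also have "\<dots> = ennreal (h$1 - l$1) * ennreal (h$2 - l$2)"
      unfolding lborel_prod[symmetric] using le' by (subst lborel.emeasure_pair_measure_Times) auto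
    also have "\<dots> = (\<Prod>b\<in>Basis. (h - l) \<bullet> b)"
    proof -
      have B: "(Basis :: (real^2) set) = {axis 1 1, axis 2 1}" by (auto simp: Basis_vec_def exhaust_2 UNIV_2)
      have "(\<Prod>b\<in>Basis. (h - l) \<bullet> b) = (h$1 - l$1) * (h$2 - l$2)"
        unfolding B by (simp add: axis_eq_axis inner_axis)
      then show ?thesis using le' by (simp add: ennreal_mult)
    qed
    finally show "emeasure (distr lborel borel J) (box l h) = (\<Prod>b\<in>Basis. (h - l) \<bullet> b)" .
  qed simp
  have R_eq: "lborel = distr lborel borel R"
  proof (rule lborel_eqI)
    fix l h :: "real^2" assume le: "\<And>b. b \<in> Basis \<Longrightarrow> l \<bullet> b \<le> h \<bullet> b"
    have "R -` box l h = R' ` box l h" using inv1 inv2 by (auto simp: image_iff) (metis inv2)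
    then have "emeasure (distr lborel borel R) (box l h) = emeasure lborel (R' ` box l h)"
      by (subst emeasure_distr) auto
    moreover have bm: "R' ` box l h \<in> sets borel"
      using measurable_sets[of R borel borel "box l h"] \<open>R -` box l h = R' ` box l h\<close> by auto
    moreover have "R' ` box l h \<in> lmeasurable"
      using \<open>orthogonal_transformation R'\<close> by (rule measurable_orthogonal_image) simp
    ultimately have "emeasure (distr lborel borel R) (box l h) = ennreal (measure lebesgue (R' ` box l h))"
      using emeasure_eq_measure2[of "R' ` box l h" lebesgue] by simp
    also have "\<dots> = ennreal (measure lebesgue (box l h))" by (simp add: orth)
    also have "\<dots> = (\<Prod>b\<in>Basis. (h - l) \<bullet> b)"
      using le by (simp add: measure_lborel_box_eq)
    finally show "emeasure (distr lborel borel R) (box l h) = (\<Prod>b\<in>Basis. (h - l) \<bullet> b)" .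
  qed simp
  have "distr (lborel :: (real \<times> real) measure) borel (\<lambda>(s, t). q + s *\<^sub>R u + t *\<^sub>R v)
    = distr (distr (distr lborel borel J) borel R) borel ((+) q)"
  proof -
    have [measurable]: "(\<lambda>x. R (J x)) \<in> borel_measurable borel" by measurable
    have "(\<lambda>(s, t). q + s *\<^sub>R u + t *\<^sub>R v) = (+) q \<circ> (R \<circ> J)"
      by (auto simp: fun_eq_iff R_def J_nth add.assoc)
    then show ?thesis by (simp add: distr_distr comp_def)
  qed
  also have "\<dots> = lborel"
    unfolding J_eq[symmetric] R_eq[symmetric] by (rule lborel_distr_plus)
  finally show ?thesis .
qed

section \<open>Lipschitz charts of the boundary\<close>

text \<open>
  In contrast to the definition of Lipschitz boundary, \<open>g\<close> is Lipschitz on the whole line; this is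
  possible after shrinking \<open>a\<close> and spares side conditions on the parameter.
\<close>

locale lipschitz_chart =
  fixes \<Omega> :: "(real^2) set" and q u v :: "real^2" and a b L :: real and g :: "real \<Rightarrow> real"
  assumes uv: "norm u = 1" "norm v = 1" "u \<bullet> v = 0"
    and ab: "0 < a" "0 < b"
    and lip: "L-lipschitz_on UNIV g"
    and g_bound: "\<And>s. \<bar>g s\<bar> < b"
    and inside: "\<And>s t. \<bar>s\<bar> < a \<Longrightarrow> \<bar>t\<bar> < b \<Longrightarrow> q + s *\<^sub>R u + t *\<^sub>R v \<in> \<Omega> \<longleftrightarrow> t < g s"
    and boundary: "\<And>s t. \<bar>s\<bar> < a \<Longrightarrow> \<bar>t\<bar> < b \<Longrightarrow> q + s *\<^sub>R u + t *\<^sub>R v \<in> frontier \<Omega> \<longleftrightarrow> t = g s"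
begin

definition pt :: "real \<Rightarrow> real \<Rightarrow> real^2" where "pt s t = q + s *\<^sub>R u + t *\<^sub>R v"
definition S :: "real^2 \<Rightarrow> real" where "S x = (x - q) \<bullet> u"
definition T :: "real^2 \<Rightarrow> real" where "T x = (x - q) \<bullet> v"
definition \<gamma> :: "real \<Rightarrow> real^2" where "\<gamma> s = pt s (g s)"
definition dg :: "real \<Rightarrow> real" where "dg = deriv_candidate g"
definition graph_normal :: "real \<Rightarrow> real^2" where
  "graph_normal s = (1 / sqrt (1 + (dg s)\<^sup>2)) *\<^sub>R (v - dg s *\<^sub>R u)"

lemma uv_inner [simp]: "u \<bullet> u = 1" "v \<bullet> v = 1" "u \<bullet> v = 0" "v \<bullet> u = 0"
  using uv by (auto simp: norm_eq_1 inner_commute)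

lemma S_pt [simp]: "S (pt s t) = s" and T_pt [simp]: "T (pt s t) = t"
  by (auto simp: S_def T_def pt_def inner_add_left)

lemma pt_ST [simp]: "pt (S x) (T x) = x"
  using orthonormal_plane_expansion[OF uv, of "x - q"] by (simp add: pt_def S_def T_def algebra_simps)

lemma S_\<gamma> [simp]: "S (\<gamma> s) = s" and T_\<gamma> [simp]: "T (\<gamma> s) = g s"
  by (auto simp: \<gamma>_def)

lemma continuous_pt [continuous_intros]:
  "continuous_on A f \<Longrightarrow> continuous_on A h \<Longrightarrow> continuous_on A (\<lambda>x. pt (f x) (h x))"
  unfolding pt_def by (intro continuous_intros)

lemma continuous_S [continuous_intros]: "continuous_on A f \<Longrightarrow> continuous_on A (\<lambda>x. S (f x))"
  unfolding S_def by (intro continuous_intros)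

lemma continuous_T [continuous_intros]: "continuous_on A f \<Longrightarrow> continuous_on A (\<lambda>x. T (f x))"
  unfolding T_def by (intro continuous_intros)

lemma continuous_g [continuous_intros]: "continuous_on A f \<Longrightarrow> continuous_on A (\<lambda>x. g (f x))"
  by (rule continuous_on_compose2[OF lipschitz_on_continuous_on[OF lip]]) auto

lemma continuous_\<gamma> [continuous_intros]: "continuous_on A f \<Longrightarrow> continuous_on A (\<lambda>x. \<gamma> (f x))"
  unfolding \<gamma>_def by (intro continuous_intros)

lemma borel_measurable_chart [measurable]:
  "S \<in> borel_measurable borel" "T \<in> borel_measurable borel" "g \<in> borel_measurable borel"
  "\<gamma> \<in> borel_measurable borel" "dg \<in> borel_measurable borel" "graph_normal \<in> borel_measurable borel"
proof -
  show [measurable]: "S \<in> borel_measurable borel" "T \<in> borel_measurable borel" "g \<in> borel_measurable borel" "\<gamma> \<in> borel_measurable borel"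
    by (intro borel_measurable_continuous_onI continuous_intros)+
  show [measurable]: "dg \<in> borel_measurable borel"
    unfolding dg_def by (intro borel_measurable_deriv_candidate continuous_intros)
  show "graph_normal \<in> borel_measurable borel"
    unfolding graph_normal_def by measurable
qed

lemma L_nonneg: "0 \<le> L" using lip by (rule lipschitz_on_nonneg)

lemma g_lip: "\<bar>g s - g t\<bar> \<le> L * \<bar>s - t\<bar>"
  using lipschitz_onD[OF lip, of s t] by (simp add: dist_real_def)

lemma pt_diff: "pt s t - pt s' t' = (s - s') *\<^sub>R u + (t - t') *\<^sub>R v"
  by (simp add: pt_def algebra_simps)

lemma norm_comb: "norm (x *\<^sub>R u + y *\<^sub>R v) = sqrt (x\<^sup>2 + y\<^sup>2)"
  by (simp add: norm_eq_sqrt_inner inner_add_left inner_add_right power2_eq_square)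

lemma dist_\<gamma>: "dist (\<gamma> s) (\<gamma> t) = sqrt ((s - t)\<^sup>2 + (g s - g t)\<^sup>2)"
  by (simp add: dist_norm \<gamma>_def pt_diff norm_comb)

lemma dist_\<gamma>_ge: "\<bar>s - t\<bar> \<le> dist (\<gamma> s) (\<gamma> t)"
  unfolding dist_\<gamma> by (simp add: real_le_rsqrt)

lemma dist_\<gamma>_le: "dist (\<gamma> s) (\<gamma> t) \<le> (1 + L) * \<bar>s - t\<bar>"
proof -
  have "dist (\<gamma> s) (\<gamma> t) \<le> \<bar>s - t\<bar> + \<bar>g s - g t\<bar>"
    unfolding dist_\<gamma> by (rule sqrt_sum_squares_le_sum_abs)
  also have "\<dots> \<le> (1 + L) * \<bar>s - t\<bar>" using g_lip[of s t] by (simp add: algebra_simps)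
  finally show ?thesis .
qed

lemma dg: "g differentiable (at s) \<Longrightarrow> (g has_real_derivative dg s) (at s)"
  unfolding dg_def real_differentiable_def using deriv_candidate_eq by blast

lemma dg_bound:
  assumes "g differentiable (at s)"
  shows "\<bar>dg s\<bar> \<le> L"
proof (rule tendsto_upperbound)
  show "((\<lambda>y. \<bar>(g y - g s) / (y - s)\<bar>) \<longlongrightarrow> \<bar>dg s\<bar>) (at s)"
    using dg[OF assms] by (intro tendsto_rabs) (simp add: has_field_derivative_iff)
  show "\<forall>\<^sub>F y in at s. \<bar>(g y - g s) / (y - s)\<bar> \<le> L"
    unfolding eventually_at
  proof (intro exI[of _ 1] conjI ballI impI)
    fix y assume "y \<noteq> s \<and> dist y s < 1"
    then show "\<bar>(g y - g s) / (y - s)\<bar> \<le> L" using g_lip[of y s] by (simp add: divide_le_eq)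
  qed simp
qed simp

lemma frontier_\<gamma>: "\<bar>s\<bar> < a \<Longrightarrow> \<gamma> s \<in> frontier \<Omega>"
  using boundary[of s "g s"] g_bound[of s] by (simp add: \<gamma>_def pt_def)

lemma inside_iff: "\<bar>S x\<bar> < a \<Longrightarrow> \<bar>T x\<bar> < b \<Longrightarrow> x \<in> \<Omega> \<longleftrightarrow> T x < g (S x)"
  using inside[of "S x" "T x"] pt_ST[of x] by (simp add: pt_def)

lemma frontier_iff: "\<bar>S x\<bar> < a \<Longrightarrow> \<bar>T x\<bar> < b \<Longrightarrow> x \<in> frontier \<Omega> \<longleftrightarrow> T x = g (S x)"
  using boundary[of "S x" "T x"] pt_ST[of x] by (simp add: pt_def)

lemma graph_eq: "T x = g (S x) \<Longrightarrow> x = \<gamma> (S x)"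
  using pt_ST[of x] by (simp add: \<gamma>_def)

lemma eventually_in_chart:
  assumes s: "\<bar>s\<bar> < a" and f: "(f \<longlongrightarrow> \<gamma> s) F"
  shows "\<forall>\<^sub>F y in F. \<bar>S (f y)\<bar> < a \<and> \<bar>T (f y)\<bar> < b"
proof -
  have "open {x. \<bar>S x\<bar> < a \<and> \<bar>T x\<bar> < b}"
    by (intro open_Collect_conj open_Collect_less continuous_intros)
  moreover have "\<gamma> s \<in> {x. \<bar>S x\<bar> < a \<and> \<bar>T x\<bar> < b}" using s g_bound by simp
  ultimately show ?thesis using topological_tendstoD[OF f] by fastforce
qed

lemma normal_comb: "n = (n \<bullet> u) *\<^sub>R u + (n \<bullet> v) *\<^sub>R v"
  by (rule orthonormal_plane_expansion[OF uv])

lemma secant_inner: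
  assumes "t \<noteq> s"
  shows "(\<gamma> t - \<gamma> s) \<bullet> n = (t - s) * (n \<bullet> u + (n \<bullet> v) * ((g t - g s) / (t - s)))"
proof -
  have "(\<gamma> t - \<gamma> s) \<bullet> n = (t - s) * (n \<bullet> u) + (g t - g s) * (n \<bullet> v)"
    by (simp add: \<gamma>_def pt_diff inner_add_left inner_commute[of u n] inner_commute[of v n])
  also have "g t - g s = (t - s) * ((g t - g s) / (t - s))" using assms by simp
  finally show ?thesis by (simp add: algebra_simps)
qed

text \<open>
  The tangency condition forces the difference quotients of \<open>g\<close> to converge to minus the quotient of
  the components of \<open>n\<close> along \<open>u\<close> and \<open>v\<close>; the latter is not zero, since a Lipschitz graph has no
  vertical tangent.
  The side condition fixes the sign.
\<close>

lemma is_outward_unit_normal_graphD: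
  assumes s: "\<bar>s\<bar> < a" and n: "is_outward_unit_normal \<Omega> (\<gamma> s) n"
  shows "g differentiable (at s)" "n = graph_normal s"
proof -
  let ?Q = "\<lambda>t. (g t - g s) / (t - s)"
  define n1 n2 where "n1 = n \<bullet> u" and "n2 = n \<bullet> v"
  have n_eq: "n = n1 *\<^sub>R u + n2 *\<^sub>R v" unfolding n1_def n2_def by (rule normal_comb)
  have norm: "n1\<^sup>2 + n2\<^sup>2 = 1" using n norm_comb[of n1 n2] n_eq by (auto simp: is_outward_unit_normal_def)
  have \<gamma>_lim: "(\<gamma> \<longlongrightarrow> \<gamma> s) (at s)"
    using continuous_\<gamma>[of UNIV "\<lambda>x. x"] by (simp add: continuous_on_def)
  have "filterlim \<gamma> (at (\<gamma> s) within frontier \<Omega>) (at s)"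
    unfolding filterlim_at
  proof
    have "\<forall>\<^sub>F t in at s. \<bar>t\<bar> < a"
      using eventually_in_chart[OF s \<gamma>_lim] by eventually_elim simp
    moreover have "\<forall>\<^sub>F t in at s. t \<noteq> s" by (simp add: eventually_at_filter)
    ultimately show "\<forall>\<^sub>F t in at s. \<gamma> t \<in> frontier \<Omega> \<and> \<gamma> t \<noteq> \<gamma> s"
      by eventually_elim (metis S_\<gamma> frontier_\<gamma>)
  qed (rule \<gamma>_lim)
  moreover have "((\<lambda>y. ((y - \<gamma> s) \<bullet> n) / norm (y - \<gamma> s)) \<longlongrightarrow> 0) (at (\<gamma> s) within frontier \<Omega>)"
    using n by (simp add: is_outward_unit_normal_def)
  ultimately have lim: "((\<lambda>t. ((\<gamma> t - \<gamma> s) \<bullet> n) / norm (\<gamma> t - \<gamma> s)) \<longlongrightarrow> 0) (at s)"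
    by (rule filterlim_compose[rotated])
  have lim0: "((\<lambda>t. n1 + n2 * ?Q t) \<longlongrightarrow> 0) (at s)"
  proof (rule tendsto_0_le[OF lim, where K="1 + L"])
    have "\<forall>\<^sub>F t in at s. t \<noteq> s" by (simp add: eventually_at_filter)
    then show "\<forall>\<^sub>F t in at s. norm (n1 + n2 * ?Q t) \<le> norm (((\<gamma> t - \<gamma> s) \<bullet> n) / norm (\<gamma> t - \<gamma> s)) * (1 + L)"
    proof eventually_elim
      case (elim t)
      have pos: "0 < norm (\<gamma> t - \<gamma> s)" using dist_\<gamma>_ge[of t s] elim by (auto simp: dist_norm)
      have "norm (n1 + n2 * ?Q t) * norm (\<gamma> t - \<gamma> s) \<le> norm (n1 + n2 * ?Q t) * ((1 + L) * \<bar>t - s\<bar>)"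
        using dist_\<gamma>_le[of t s] by (intro mult_left_mono) (auto simp: dist_norm)
      also have "\<dots> = \<bar>(\<gamma> t - \<gamma> s) \<bullet> n\<bar> * (1 + L)"
        unfolding secant_inner[OF elim] by (simp add: abs_mult n1_def n2_def)
      finally show ?case using pos by (simp add: field_simps)
    qed
  qed
  have n2: "n2 \<noteq> 0"
  proof
    assume "n2 = 0"
    then have "((\<lambda>t. n1) \<longlongrightarrow> 0) (at s)" using lim0 by simp
    then have "n1 = 0" by (simp add: tendsto_const_iff)
    then show False using norm \<open>n2 = 0\<close> by simp
  qed
  define d where "d = - n1 / n2"
  have "((\<lambda>t. (n1 + n2 * ?Q t) / n2 - n1 / n2) \<longlongrightarrow> 0 / n2 - n1 / n2) (at s)"
    by (intro tendsto_intros lim0 n2)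
  then have "(?Q \<longlongrightarrow> d) (at s)" using n2 by (simp add: add_divide_distrib d_def)
  then have der: "(g has_real_derivative d) (at s)" by (simp add: has_field_derivative_iff)
  then show "g differentiable (at s)" using real_differentiable_def by blast
  have dgs: "dg s = d" unfolding dg_def by (rule deriv_candidate_eq[OF der])
  have n1: "n1 = - d * n2" using n2 by (simp add: d_def)
  have sq: "n2\<^sup>2 * (1 + d\<^sup>2) = 1" using norm unfolding n1 by (simp add: power_mult_distrib algebra_simps)
  have "0 < n2"
  proof (rule ccontr)
    assume "\<not> 0 < n2"
    then have neg: "n2 < 0" using n2 by simp
    define \<psi> where "\<psi> \<tau> = (g s - \<tau> * n2) - g (s - \<tau> * n1)" for \<tau>
    have "((\<lambda>\<tau>. g (s - \<tau> * n1)) has_real_derivative d * - n1) (at 0)"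
      by (rule DERIV_chain2[where g="\<lambda>\<tau>. s - \<tau> * n1"]) (auto intro!: derivative_eq_intros simp: der)
    then have "(\<psi> has_real_derivative - n2 - d * - n1) (at 0)"
      unfolding \<psi>_def by (auto intro!: derivative_eq_intros)
    moreover have "- n2 - d * - n1 = (- n2) * (1 + d\<^sup>2)" unfolding n1 by (simp add: power2_eq_square algebra_simps)
    moreover have "0 < (- n2) * (1 + d\<^sup>2)" using neg by (intro mult_pos_pos add_pos_nonneg) auto
    ultimately obtain e where e: "0 < e" "\<And>h. 0 < h \<Longrightarrow> h < e \<Longrightarrow> \<psi> 0 < \<psi> (0 + h)"
      using DERIV_pos_inc_right[of \<psi> _ 0] by metis
    have ev1: "\<forall>\<^sub>F \<tau> in at_right 0. 0 < \<psi> \<tau>"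
      unfolding eventually_at_right_field using e by (intro exI[of _ e]) (auto simp: \<psi>_def)
    have ev2: "\<forall>\<^sub>F \<tau> in at_right 0. \<gamma> s - \<tau> *\<^sub>R n \<in> \<Omega>"
      using n by (auto simp: is_outward_unit_normal_def elim: eventually_mono)
    have eq: "\<gamma> s - \<tau> *\<^sub>R n = pt (s - \<tau> * n1) (g s - \<tau> * n2)" for \<tau>
      by (simp add: \<gamma>_def pt_def n_eq algebra_simps)
    have "((\<lambda>\<tau>. \<gamma> s - \<tau> *\<^sub>R n) \<longlongrightarrow> \<gamma> s) (at_right 0)"
      by (auto intro!: tendsto_eq_intros)
    from eventually_in_chart[OF s this]
    have ev3: "\<forall>\<^sub>F \<tau> in at_right 0. \<bar>s - \<tau> * n1\<bar> < a \<and> \<bar>g s - \<tau> * n2\<bar> < b"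
      by eventually_elim (simp add: eq)
    have "\<forall>\<^sub>F \<tau> in at_right (0::real). False"
      using ev1 ev2 ev3
    proof eventually_elim
      case (elim \<tau>)
      then have "g s - \<tau> * n2 < g (s - \<tau> * n1)"
        using inside_iff[of "pt (s - \<tau> * n1) (g s - \<tau> * n2)"] by (simp add: eq)
      then show False using elim(1) by (simp add: \<psi>_def)
    qed
    then show False by simp
  qed
  moreover have "n2\<^sup>2 = (1 / sqrt (1 + d\<^sup>2))\<^sup>2"
  proof -
    have pos: "0 < 1 + d\<^sup>2" by (simp add: add_pos_nonneg)
    have "(1 / sqrt (1 + d\<^sup>2))\<^sup>2 = 1 / (1 + d\<^sup>2)"
      by (simp only: power_divide power_one real_sqrt_pow2[OF less_imp_le[OF pos]])
    moreover have "n2\<^sup>2 = 1 / (1 + d\<^sup>2)"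
      using sq pos by (metis less_irrefl nonzero_eq_divide_eq)
    ultimately show ?thesis by metis
  qed
  ultimately have n2_eq: "n2 = 1 / sqrt (1 + d\<^sup>2)"
    by (intro power2_eq_imp_eq[of n2]) (auto simp: add_nonneg_nonneg)
  show "n = graph_normal s"
    unfolding graph_normal_def dgs n_eq n1 n2_eq by (simp add: algebra_simps)
qed

lemma is_outward_unit_normal_graphI:
  assumes s: "\<bar>s\<bar> < a" and "g differentiable (at s)"
  shows "is_outward_unit_normal \<Omega> (\<gamma> s) (graph_normal s)"
proof -
  define d where "d = dg s"
  have der: "(g has_real_derivative d) (at s)" unfolding d_def by (rule dg[OF assms(2)])
  define n2 where "n2 = 1 / sqrt (1 + d\<^sup>2)"
  define n1 where "n1 = - d * n2"
  define n where "n = graph_normal s"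
  have pos: "0 < 1 + d\<^sup>2" by (simp add: add_pos_nonneg)
  have n2: "0 < n2" using pos by (simp add: n2_def)
  have n_eq: "n = n1 *\<^sub>R u + n2 *\<^sub>R v"
    unfolding n_def graph_normal_def d_def[symmetric] n1_def n2_def by (simp add: algebra_simps)
  have nuv: "n \<bullet> u = n1" "n \<bullet> v = n2" by (auto simp: n_eq inner_add_left)
  have norm: "norm n = 1"
  proof -
    have "n1\<^sup>2 + n2\<^sup>2 = n2\<^sup>2 * (1 + d\<^sup>2)" unfolding n1_def by (simp add: power_mult_distrib algebra_simps)
    also have "\<dots> = 1" using pos by (simp add: n2_def power_divide)
    finally show ?thesis unfolding n_eq norm_comb by simp
  qed
  have Q: "((\<lambda>t. n1 + n2 * ((g t - g s) / (t - s))) \<longlongrightarrow> 0) (at s)"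
  proof -
    have "((\<lambda>t. n1 + n2 * ((g t - g s) / (t - s))) \<longlongrightarrow> n1 + n2 * d) (at s)"
      using der by (intro tendsto_intros) (simp add: has_field_derivative_iff)
    then show ?thesis by (simp add: n1_def)
  qed
  let ?F = "at (\<gamma> s) within frontier \<Omega>"
  have id: "((\<lambda>y. y) \<longlongrightarrow> \<gamma> s) ?F" by (rule tendsto_ident_at)
  have chart: "\<forall>\<^sub>F y in ?F. y = \<gamma> (S y) \<and> S y \<noteq> s"
  proof -
    have "\<forall>\<^sub>F y in ?F. y \<in> frontier \<Omega> \<and> y \<noteq> \<gamma> s" by (simp add: eventually_at_filter)
    with eventually_in_chart[OF s id] show ?thesis
    proof eventually_elim
      case (elim y)
      then have "y = \<gamma> (S y)" using frontier_iff graph_eq by blast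
      then show ?case using elim by metis
    qed
  qed
  have "filterlim S (at s) ?F"
    unfolding filterlim_at
  proof
    show "\<forall>\<^sub>F y in ?F. S y \<in> UNIV \<and> S y \<noteq> s" using chart by eventually_elim simp
    have "(S \<longlongrightarrow> S (\<gamma> s)) (at (\<gamma> s))"
      using continuous_S[of UNIV "\<lambda>x. x", OF continuous_on_id] unfolding continuous_on_def by blast
    then have "(S \<longlongrightarrow> S (\<gamma> s)) ?F" by (rule tendsto_within_subset) simp
    then show "(S \<longlongrightarrow> s) ?F" by simp
  qed
  then have comp: "((\<lambda>y. n1 + n2 * ((g (S y) - g s) / (S y - s))) \<longlongrightarrow> 0) ?F"
    by (rule filterlim_compose[OF Q])
  have secant: "((\<lambda>y. ((y - \<gamma> s) \<bullet> n) / norm (y - \<gamma> s)) \<longlongrightarrow> 0) ?F"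
  proof (rule tendsto_0_le[OF comp, where K=1])
    show "\<forall>\<^sub>F y in ?F. norm (((y - \<gamma> s) \<bullet> n) / norm (y - \<gamma> s)) \<le> norm (n1 + n2 * ((g (S y) - g s) / (S y - s))) * 1"
      using chart
    proof eventually_elim
      case (elim y)
      define t where "t = S y"
      have t: "y = \<gamma> t" "t \<noteq> s" using elim by (auto simp: t_def)
      have le: "\<bar>t - s\<bar> \<le> norm (\<gamma> t - \<gamma> s)" using dist_\<gamma>_ge[of t s] by (simp add: dist_norm)
      then have pos: "0 < norm (\<gamma> t - \<gamma> s)" using t by linarith
      have "\<bar>(\<gamma> t - \<gamma> s) \<bullet> n\<bar> = \<bar>n1 + n2 * ((g t - g s) / (t - s))\<bar> * \<bar>t - s\<bar>"
        unfolding secant_inner[OF t(2)] nuv by (simp add: abs_mult)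
      also have "\<dots> \<le> \<bar>n1 + n2 * ((g t - g s) / (t - s))\<bar> * norm (\<gamma> t - \<gamma> s)"
        using le by (intro mult_left_mono) auto
      finally show ?case unfolding t_def[symmetric] t(1) using pos by (simp add: divide_le_eq)
    qed
  qed
  define \<psi> where "\<psi> \<tau> = (g s + \<tau> * n2) - g (s + \<tau> * n1)" for \<tau>
  have "((\<lambda>\<tau>. g (s + \<tau> * n1)) has_real_derivative d * n1) (at 0)"
    by (rule DERIV_chain2[where g="\<lambda>\<tau>. s + \<tau> * n1"]) (auto intro!: derivative_eq_intros simp: der)
  then have "(\<psi> has_real_derivative n2 - d * n1) (at 0)"
    unfolding \<psi>_def by (auto intro!: derivative_eq_intros)
  moreover have "n2 - d * n1 = n2 * (1 + d\<^sup>2)" unfolding n1_def by (simp add: power2_eq_square algebra_simps)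
  ultimately have der\<psi>: "(\<psi> has_real_derivative n2 * (1 + d\<^sup>2)) (at 0)" "0 < n2 * (1 + d\<^sup>2)" using n2 pos by auto
  obtain e where e: "0 < e" "\<And>h. 0 < h \<Longrightarrow> h < e \<Longrightarrow> \<psi> 0 < \<psi> (0 + h)"
    using DERIV_pos_inc_right[OF der\<psi>] by metis
  obtain e' where e': "0 < e'" "\<And>h. 0 < h \<Longrightarrow> h < e' \<Longrightarrow> \<psi> (0 - h) < \<psi> 0"
    using DERIV_pos_inc_left[OF der\<psi>] by metis
  have \<psi>0: "\<psi> 0 = 0" by (simp add: \<psi>_def)
  have eq: "\<gamma> s + \<tau> *\<^sub>R n = pt (s + \<tau> * n1) (g s + \<tau> * n2)" for \<tau>
    by (simp add: \<gamma>_def pt_def n_eq algebra_simps)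
  have "((\<lambda>\<tau>. \<gamma> s + \<tau> *\<^sub>R n) \<longlongrightarrow> \<gamma> s) (at_right 0)" "((\<lambda>\<tau>. \<gamma> s + (- \<tau>) *\<^sub>R n) \<longlongrightarrow> \<gamma> s) (at_right 0)"
    by (auto intro!: tendsto_eq_intros)
  note ch = this[THEN eventually_in_chart[OF s]]
  have out: "\<forall>\<^sub>F \<tau> in at_right 0. \<gamma> s + \<tau> *\<^sub>R n \<notin> closure \<Omega>"
  proof -
    have "\<forall>\<^sub>F \<tau> in at_right 0. 0 < \<psi> \<tau>"
      unfolding eventually_at_right_field using e \<psi>0 by (intro exI[of _ e]) auto
    with ch(1) show ?thesis
    proof eventually_elim
      case (elim \<tau>)
      then show ?case using inside_iff[of "\<gamma> s + \<tau> *\<^sub>R n"] frontier_iff[of "\<gamma> s + \<tau> *\<^sub>R n"]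
        by (simp add: closure_Un_frontier eq \<psi>_def)
    qed
  qed
  have inn: "\<forall>\<^sub>F \<tau> in at_right 0. \<gamma> s - \<tau> *\<^sub>R n \<in> \<Omega>"
  proof -
    have "\<forall>\<^sub>F \<tau> in at_right 0. \<psi> (- \<tau>) < 0"
      unfolding eventually_at_right_field using e' \<psi>0 by (intro exI[of _ e']) auto
    with ch(2) show ?thesis
    proof eventually_elim
      case (elim \<tau>)
      then have "\<gamma> s + (- \<tau>) *\<^sub>R n \<in> \<Omega>" using inside_iff[of "\<gamma> s + (- \<tau>) *\<^sub>R n"]
        unfolding eq by (simp add: \<psi>_def)
      then show ?case by simp
    qed
  qed
  show ?thesis
    unfolding is_outward_unit_normal_def n_def[symmetric] using norm secant out inn by (auto simp: eventually_conj_iff)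
qed

lemma outward_unit_normal_graph:
  assumes "\<bar>s\<bar> < a"
  shows "outward_unit_normal \<Omega> (\<gamma> s) = (if g differentiable (at s) then graph_normal s else 0)"
  unfolding outward_unit_normal_def
  using is_outward_unit_normal_graphD[OF assms] is_outward_unit_normal_graphI[OF assms]
  by (auto intro!: the_equality)

lemma closed_graph: "closed (range \<gamma>)"
proof -
  have "range \<gamma> = {x. T x = g (S x)}" using graph_eq by (force simp: image_iff)
  also have "closed \<dots>" by (intro closed_Collect_eq continuous_intros)
  finally show ?thesis .
qed

lemma AE_differentiable: "AE s in lborel. g differentiable (at s)"
  by (rule lipschitz_real_differentiable_AE[OF lip])

lemma graph_area_formula:
  "distr (density arc_length (indicator (range \<gamma>))) borel S = density lborel (\<lambda>s. ennreal (sqrt (1 + (dg s)\<^sup>2)))"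
proof (rule curve_area_formula)
  show "0 < 1 + L" using L_nonneg by simp
  show "AE s in lborel. ((\<lambda>t. dist (\<gamma> s) (\<gamma> t) / \<bar>s - t\<bar>) \<longlongrightarrow> sqrt (1 + (dg s)\<^sup>2)) (at s)"
    using AE_differentiable
  proof eventually_elim
    case (elim s)
    have lim: "((\<lambda>t. sqrt (1 + ((g t - g s) / (t - s))\<^sup>2)) \<longlongrightarrow> sqrt (1 + (dg s)\<^sup>2)) (at s)"
      using dg[OF elim] by (intro tendsto_intros) (simp add: has_field_derivative_iff)
    have "\<forall>\<^sub>F t in at s. t \<noteq> s" by (simp add: eventually_at_filter)
    then have "\<forall>\<^sub>F t in at s. sqrt (1 + ((g t - g s) / (t - s))\<^sup>2) = dist (\<gamma> s) (\<gamma> t) / \<bar>s - t\<bar>"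
    proof eventually_elim
      case (elim t)
      have "1 + ((g t - g s) / (t - s))\<^sup>2 = ((s - t)\<^sup>2 + (g s - g t)\<^sup>2) / (s - t)\<^sup>2"
        using elim by (simp add: add_divide_distrib power_divide power2_commute)
      then show ?case by (simp add: dist_\<gamma> real_sqrt_divide)
    qed
    then show ?case using lim by (simp add: tendsto_cong)
  qed
qed (use closed_graph dist_\<gamma>_le in auto)

text \<open>
  The flux \<open>(x - p) \<bullet> \<nu>\<close> through the graph per unit of parameter.
\<close>

definition flux_density :: "real^2 \<Rightarrow> real \<Rightarrow> real" where
  "flux_density p s = (\<gamma> s - p) \<bullet> (v - dg s *\<^sub>R u)"

lemma borel_measurable_flux_density [measurable]: "flux_density p \<in> borel_measurable borel"
  unfolding flux_density_def by measurable

text \<open>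
  The factor \<open>sqrt (1 + g'\<^sup>2)\<close> of the area formula cancels the normalisation of the normal.
\<close>

lemma graph_surface_integral:
  fixes f :: "real^2 \<Rightarrow> real"
  assumes f [measurable]: "f \<in> borel_measurable borel" and B: "\<And>x. \<bar>f x\<bar> \<le> B"
    and supp: "\<And>x. f x \<noteq> 0 \<Longrightarrow> \<bar>S x\<bar> < a \<and> \<bar>T x\<bar> < b"
  shows "integrable arc_length (\<lambda>x. indicator (frontier \<Omega>) x * (f x * ((x - p) \<bullet> outward_unit_normal \<Omega> x)))" (is ?int)
    and "(LINT x|arc_length. indicator (frontier \<Omega>) x * (f x * ((x - p) \<bullet> outward_unit_normal \<Omega> x)))
       = (LINT s|lborel. f (\<gamma> s) * flux_density p s)" (is ?eq)
proof -
  let ?D = "{s. g differentiable (at s)}"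
  have D [measurable]: "?D \<in> sets borel" by (intro sets_borel_differentiable continuous_intros)
  define F where "F s = f (\<gamma> s) * ((\<gamma> s - p) \<bullet> (indicator ?D s *\<^sub>R graph_normal s))" for s
  have [measurable]: "F \<in> borel_measurable borel" unfolding F_def by measurable
  have r [measurable]: "range \<gamma> \<in> sets borel" using closed_graph by simp
  have "S \<in> borel_measurable borel" by measurable
  then have S' [measurable]: "S \<in> borel_measurable (density arc_length (indicator (range \<gamma>)))"
    "S \<in> borel_measurable arc_length"
    by (simp_all cong: measurable_cong_sets)
  have f0: "f (\<gamma> s) = 0" if "\<not> \<bar>s\<bar> < a" for s using supp[of "\<gamma> s"] that by auto
  have pointwise: "indicator (frontier \<Omega>) x * (f x * ((x - p) \<bullet> outward_unit_normal \<Omega> x)) = indicator (range \<gamma>) x * F (S x)" for x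
  proof (cases "x \<in> range \<gamma>")
    case True
    then obtain s where x: "x = \<gamma> s" by blast
    show ?thesis
    proof (cases "\<bar>s\<bar> < a")
      case True
      then show ?thesis using frontier_\<gamma>[OF True] outward_unit_normal_graph[OF True] by (simp add: x F_def)
    next
      case False
      then show ?thesis using f0 by (simp add: x F_def)
    qed
  next
    case False
    have "f x = 0 \<or> x \<notin> frontier \<Omega>"
      using supp[of x] frontier_iff[of x] graph_eq[of x] False by blast
    then show ?thesis using False by auto
  qed
  have weight: "sqrt (1 + (dg s)\<^sup>2) * F s = f (\<gamma> s) * flux_density p s" if "g differentiable (at s)" for s
  proof -
    have "0 < sqrt (1 + (dg s)\<^sup>2)" by (simp add: add_pos_nonneg)
    then show ?thesis using that by (simp add: F_def flux_density_def graph_normal_def)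
  qed
  have bound: "\<bar>f (\<gamma> s) * flux_density p s\<bar> \<le> indicator {-a..a} s * (B * ((norm (q - p) + a + b) * (1 + L)))"
    if "g differentiable (at s)" for s
  proof (cases "\<bar>s\<bar> < a")
    case True
    have "norm (\<gamma> s - p) \<le> norm (q - p) + norm (s *\<^sub>R u) + norm (g s *\<^sub>R v)"
    proof -
      have e: "\<gamma> s - p = (q - p) + s *\<^sub>R u + g s *\<^sub>R v" by (simp add: \<gamma>_def pt_def)
      show ?thesis unfolding e
        using norm_triangle_ineq[of "(q - p) + s *\<^sub>R u" "g s *\<^sub>R v"] norm_triangle_ineq[of "q - p" "s *\<^sub>R u"] by linarith
    qed
    also have "\<dots> \<le> norm (q - p) + a + b" using uv True g_bound[of s] by (simp add: less_imp_le)
    finally have 1: "norm (\<gamma> s - p) \<le> norm (q - p) + a + b" .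
    have 2: "norm (v - dg s *\<^sub>R u) \<le> 1 + L"
      using norm_triangle_ineq4[of v "dg s *\<^sub>R u"] uv dg_bound[OF that] by simp
    have "\<bar>flux_density p s\<bar> \<le> norm (\<gamma> s - p) * norm (v - dg s *\<^sub>R u)"
      unfolding flux_density_def by (rule Cauchy_Schwarz_ineq2)
    also have "\<dots> \<le> (norm (q - p) + a + b) * (1 + L)" using 1 2 ab by (intro mult_mono) (auto simp: add_nonneg_nonneg less_imp_le)
    finally have "\<bar>f (\<gamma> s)\<bar> * \<bar>flux_density p s\<bar> \<le> B * ((norm (q - p) + a + b) * (1 + L))"
      using B[of "\<gamma> s"] by (intro mult_mono) auto
    then show ?thesis using True by (simp add: abs_mult indicator_def abs_less_iff)
  next
    case False
    have "0 \<le> B" using B[of 0] by linarith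
    then show ?thesis using f0[OF False] ab L_nonneg by (simp add: indicator_def)
  qed
  have int0: "integrable lborel (\<lambda>s. f (\<gamma> s) * flux_density p s)"
  proof (rule Bochner_Integration.integrable_bound)
    show "integrable lborel (\<lambda>s. indicator {-a..a} s * (B * ((norm (q - p) + a + b) * (1 + L))))"
      using ab by (intro integrable_mult_left) simp
    show "AE s in lborel. norm (f (\<gamma> s) * flux_density p s) \<le> norm (indicator {-a..a} s * (B * ((norm (q - p) + a + b) * (1 + L))))"
      using AE_differentiable by eventually_elim (use bound in \<open>auto intro: order_trans[OF _ abs_ge_self]\<close>)
  qed measurable
  have AEw: "AE s in lborel. sqrt (1 + (dg s)\<^sup>2) *\<^sub>R F s = f (\<gamma> s) * flux_density p s"
    using AE_differentiable by eventually_elim (simp add: weight)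
  have int1: "integrable lborel (\<lambda>s. sqrt (1 + (dg s)\<^sup>2) *\<^sub>R F s)"
    by (rule integrable_cong_AE_imp[OF int0 _ AEw[THEN AE_symmetric]]) measurable
  have ind: "density arc_length (indicator (range \<gamma>)) = density arc_length (\<lambda>x. ennreal (indicator (range \<gamma>) x))"
    by (simp add: ennreal_indicator)
  have int2: "integrable (distr (density arc_length (indicator (range \<gamma>))) borel S) F"
    unfolding graph_area_formula using int1 by (subst integrable_density) (auto simp: add_nonneg_nonneg)
  then have int3: "integrable (density arc_length (\<lambda>x. ennreal (indicator (range \<gamma>) x))) (\<lambda>x. F (S x))"
    by (subst (asm) integrable_distr_eq) (auto simp: ind)
  show ?int
    unfolding pointwise using int3 by (subst (asm) integrable_density) auto
  have "(LINT x|arc_length. indicator (range \<gamma>) x * F (S x)) = (LINT x|density arc_length (\<lambda>x. ennreal (indicator (range \<gamma>) x)). F (S x))"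
    by (subst integral_density) auto
  also have "\<dots> = (LINT s|distr (density arc_length (indicator (range \<gamma>))) borel S. F s)"
    by (subst integral_distr) (auto simp: ind)
  also have "\<dots> = (LINT s|lborel. sqrt (1 + (dg s)\<^sup>2) *\<^sub>R F s)"
    unfolding graph_area_formula by (subst integral_density) (auto simp: add_nonneg_nonneg)
  also have "\<dots> = (LINT s|lborel. f (\<gamma> s) * flux_density p s)"
    using AEw by (intro integral_cong_AE) measurable
  finally show ?eq unfolding pointwise .
qed

end

section \<open>Dilating a chart\<close>

text \<open>
  Contraction towards \<open>p\<close> by the factor \<open>1/\<lambda>\<close> with \<open>\<lambda> = 1 + 1/n\<close>. A point lies in the dilated
  domain \<open>\<Omega>\<^sub>\<lambda>\<close> iff its contraction lies in \<open>\<Omega>\<close>. For \<open>n = 0\<close> it is constant, which is harmless since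
  only limits matter.
\<close>

definition shrink :: "real^2 \<Rightarrow> nat \<Rightarrow> real^2 \<Rightarrow> real^2" where
  "shrink p n x = p + (real n / (real n + 1)) *\<^sub>R (x - p)"

lemma continuous_shrink [continuous_intros]: "continuous_on A f \<Longrightarrow> continuous_on A (\<lambda>x. shrink p n (f x))"
  unfolding shrink_def by (intro continuous_intros)

lemma borel_measurable_shrink [measurable]: "shrink p n \<in> borel_measurable borel"
  by (intro borel_measurable_continuous_onI continuous_intros)

lemma shrink_diff: "shrink p n x = x - (1 / (real n + 1)) *\<^sub>R (x - p)"
proof -
  have "real n / (real n + 1) = 1 - 1 / (real n + 1)" by (simp add: field_simps)
  then show ?thesis unfolding shrink_def by (simp only: scaleR_left_diff_distrib) (simp add: algebra_simps)
qed

context lipschitz_chart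
begin

text \<open>
  The graph function of the dilated domain in the coordinates of the chart.
\<close>

definition dilated_graph :: "real^2 \<Rightarrow> nat \<Rightarrow> real \<Rightarrow> real" where
  "dilated_graph p n s = ((real n + 1) * g (s - (s - S p) / (real n + 1)) - T p) / real n"

lemma S_shrink: "S (shrink p n x) = S x - (S x - S p) / (real n + 1)"
  and T_shrink: "T (shrink p n x) = T x - (T x - T p) / (real n + 1)"
  by (simp_all add: S_def T_def shrink_diff inner_diff_left)

lemma shrink_below_graph_iff:
  assumes "0 < n"
  shows "T (shrink p n x) < g (S (shrink p n x)) \<longleftrightarrow> T x < dilated_graph p n (S x)"
proof -
  have "T (shrink p n x) = (real n * T x + T p) / (real n + 1)"
    unfolding T_shrink by (simp add: field_simps)
  then have "T (shrink p n x) < g (S (shrink p n x)) \<longleftrightarrow> real n * T x + T p < (real n + 1) * g (S (shrink p n x))"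
    by (simp add: divide_less_eq mult.commute)
  also have "\<dots> \<longleftrightarrow> T x < dilated_graph p n (S x)"
    using assms unfolding dilated_graph_def S_shrink by (simp add: less_divide_eq) (simp add: algebra_simps)
  finally show ?thesis .
qed

lemma dilated_graph_diff:
  assumes "0 < n"
  shows "real n * (dilated_graph p n s - g s)
    = real n * (g (s - (s - S p) / (real n + 1)) - g s) + g (s - (s - S p) / (real n + 1)) - T p"
proof -
  have "real n * dilated_graph p n s = (real n + 1) * g (s - (s - S p) / (real n + 1)) - T p"
    using assms by (simp add: dilated_graph_def)
  then show ?thesis by (simp add: algebra_simps)
qed

lemma dilated_graph_bound:
  assumes "0 < n" "\<bar>s\<bar> < a"
  shows "\<bar>real n * (dilated_graph p n s - g s)\<bar> \<le> L * (a + \<bar>S p\<bar>) + b + \<bar>T p\<bar>"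
proof -
  let ?s = "s - (s - S p) / (real n + 1)"
  have "\<bar>real n * (g ?s - g s)\<bar> \<le> real n * (L * \<bar>?s - s\<bar>)"
    unfolding abs_mult using g_lip[of ?s s] by (intro mult_mono) auto
  also have "\<dots> = L * \<bar>s - S p\<bar> * (real n / (real n + 1))" by (simp add: abs_divide abs_minus_commute)
  also have "\<dots> \<le> L * \<bar>s - S p\<bar>" using L_nonneg by (intro mult_left_le) auto
  also have "\<dots> \<le> L * (a + \<bar>S p\<bar>)" using assms L_nonneg by (intro mult_left_mono) auto
  finally show ?thesis unfolding dilated_graph_diff[OF assms(1)] using g_bound[of ?s] by linarith
qed

lemma dilated_graph_limit:
  assumes "g differentiable (at s)"
  shows "(\<lambda>n. real n * (dilated_graph p n s - g s)) \<longlonglongrightarrow> flux_density p s"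
proof -
  let ?s = "\<lambda>n. s - (s - S p) / (real n + 1)"
  have inv: "(\<lambda>n. 1 / (real n + 1)) \<longlonglongrightarrow> 0"
    using LIMSEQ_inverse_real_of_nat by (simp add: inverse_eq_divide add.commute)
  have ratio: "(\<lambda>n. real n / (real n + 1)) \<longlonglongrightarrow> 1"
  proof -
    have "(\<lambda>n. 1 - 1 / (real n + 1)) \<longlonglongrightarrow> 1 - 0" by (intro tendsto_intros inv)
    moreover have "1 - 1 / (real n + 1) = real n / (real n + 1)" for n by (simp add: field_simps)
    ultimately show ?thesis by simp
  qed
  have s: "?s \<longlonglongrightarrow> s"
  proof -
    have "(\<lambda>n. s - (s - S p) * (1 / (real n + 1))) \<longlonglongrightarrow> s - (s - S p) * 0" by (intro tendsto_intros inv)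
    then show ?thesis by simp
  qed
  obtain k where k: "\<And>z. g z - g s = k z * (z - s)" "isCont k s" "k s = dg s"
    using dg[OF assms] unfolding CARAT_DERIV by blast
  have gs: "(\<lambda>n. g (?s n)) \<longlonglongrightarrow> g s"
    using continuous_g[of UNIV "\<lambda>x. x"] s by (auto intro!: isCont_tendsto_compose[of s g] simp: continuous_on_eq_continuous_at)
  have "(\<lambda>n. k (?s n) * (- ((s - S p) * (real n / (real n + 1)))) + g (?s n) - T p)
      \<longlonglongrightarrow> dg s * (- ((s - S p) * 1)) + g s - T p"
    using k(2,3) by (intro tendsto_intros ratio gs) (metis isCont_tendsto_compose s)
  moreover have "dg s * (- ((s - S p) * 1)) + g s - T p = flux_density p s"
  proof -
    have "(\<gamma> s - p) \<bullet> u = s - S p" "(\<gamma> s - p) \<bullet> v = g s - T p"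
      by (simp_all add: \<gamma>_def pt_def S_def T_def algebra_simps inner_diff_left)
    then show ?thesis unfolding flux_density_def inner_diff_right by (simp add: right_diff_distrib)
  qed
  moreover have "\<forall>\<^sub>F n in sequentially. k (?s n) * (- ((s - S p) * (real n / (real n + 1)))) + g (?s n) - T p
      = real n * (dilated_graph p n s - g s)"
    using eventually_gt_at_top[of 0]
  proof eventually_elim
    case (elim n)
    show ?case unfolding dilated_graph_diff[OF elim] k(1)[of "?s n"] by (simp add: algebra_simps)
  qed
  ultimately show ?thesis by (simp add: tendsto_cong)
qed

text \<open>
  Integrating first along \<open>v\<close> reduces the difference of the two domains to an interval between
  \<open>g s\<close> and the dilated height. Its length times \<open>n\<close> tends to the flux density for almost every \<open>s\<close> and
  stays bounded, so dominated convergence applies. The weight vanishes outside half the chart, which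
  keeps contracted points inside the chart for large \<open>n\<close>.
\<close>

lemma chart_dilation_limit:
  fixes f :: "real^2 \<Rightarrow> real"
  assumes \<Omega>: "open \<Omega>" and f [measurable]: "f \<in> borel_measurable borel" and B: "\<And>x. \<bar>f x\<bar> \<le> B"
    and supp: "\<And>x. f x \<noteq> 0 \<Longrightarrow> \<bar>S x\<bar> < a / 2 \<and> \<bar>T x\<bar> < b / 2"
    and cont: "AE s in lborel. \<bar>s\<bar> < a \<longrightarrow> isCont f (\<gamma> s)"
  shows "(\<lambda>n. real n * (LINT x|lborel. f x * (indicator \<Omega> (shrink p n x) - indicator \<Omega> x)))
    \<longlonglongrightarrow> (LINT s|lborel. f (\<gamma> s) * flux_density p s)"
proof -
  have [measurable]: "\<Omega> \<in> sets borel" using \<Omega> by simp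
  have B0: "0 \<le> B" using B[of 0] by linarith
  define F where "F n x = f x * (indicator \<Omega> (shrink p n x) - indicator \<Omega> x)" for n x
  have F_borel [measurable]: "F n \<in> borel_measurable borel" for n
    unfolding F_def by measurable
  have F_bound: "\<bar>F n x\<bar> \<le> B" for n x
    using B[of x] B0 unfolding F_def by (auto simp: indicator_def abs_mult)
  have F_int: "integrable lborel (F n)" for n
  proof -
    have sub: "{x. F n x \<noteq> 0} \<subseteq> cball q (a + b)"
    proof clarify
      fix x assume "F n x \<noteq> 0"
      then have st: "\<bar>S x\<bar> < a / 2" "\<bar>T x\<bar> < b / 2" using supp[of x] by (auto simp: F_def)
      have "dist q x = norm (S x *\<^sub>R u + T x *\<^sub>R v)"
      proof -
        have "x - q = S x *\<^sub>R u + T x *\<^sub>R v"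
          unfolding S_def T_def by (rule orthonormal_plane_expansion[OF uv])
        then show ?thesis by (metis dist_commute dist_norm)
      qed
      also have "\<dots> \<le> \<bar>S x\<bar> + \<bar>T x\<bar>" unfolding norm_comb by (rule sqrt_sum_squares_le_sum_abs)
      finally show "x \<in> cball q (a + b)" using st by auto
    qed
    have "integrable lborel (\<lambda>x. indicator (cball q (a + b)) x *\<^sub>R F n x)"
      by (rule integrableI_bounded_set_indicator[where B=B]) (use F_bound emeasure_bounded_finite[of "cball q (a + b)"] in auto)
    moreover have "(\<lambda>x. indicator (cball q (a + b)) x *\<^sub>R F n x) = F n"
      using sub by (auto simp: indicator_def fun_eq_iff)
    ultimately show ?thesis by metis
  qed
  define H where "H n s = (LINT t|lborel. F n (pt s t))" for n s
  have pt_measurable [measurable]: "(\<lambda>(s, t). pt s t) \<in> borel_measurable borel"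
    unfolding case_prod_unfold by (intro borel_measurable_continuous_onI continuous_intros)
  have coord: "lborel = distr (lborel :: (real \<times> real) measure) borel (\<lambda>(s, t). pt s t)"
    unfolding pt_def by (rule lborel_plane_coordinates[OF uv, symmetric])
  have F_int2: "integrable (lborel \<Otimes>\<^sub>M lborel) (\<lambda>z. F n (case z of (s, t) \<Rightarrow> pt s t))" for n
  proof -
    have "integrable (distr (lborel :: (real \<times> real) measure) borel (\<lambda>(s, t). pt s t)) (F n)"
      using F_int[of n] by (subst coord[symmetric])
    then show ?thesis unfolding lborel_prod by (subst (asm) integrable_distr_eq) auto
  qed
  have H_int: "integrable lborel (H n)" for n
    using lborel_pair.integrable_fst'[OF F_int2[of n]] by (simp add: H_def[abs_def])
  have F_H: "(LINT x|lborel. F n x) = (LINT s|lborel. H n s)" for n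
  proof -
    have "(LINT x|lborel. F n x) = (LINT x|distr (lborel :: (real \<times> real) measure) borel (\<lambda>(s, t). pt s t). F n x)"
      by (subst coord[symmetric]) simp
    also have "\<dots> = integral\<^sup>L (lborel \<Otimes>\<^sub>M lborel) (\<lambda>z. F n (case z of (s, t) \<Rightarrow> pt s t))"
      unfolding lborel_prod by (subst integral_distr) auto
    also have "\<dots> = (LINT s|lborel. H n s)"
      using lborel_pair.integral_fst'[OF F_int2[of n]] by (simp add: H_def)
    finally show ?thesis .
  qed
  obtain N :: nat where N: "2 * ((a + \<bar>S p\<bar>) / a + (b + \<bar>T p\<bar>) / b) < real N"
    using reals_Archimedean2 by blast
  have close: "\<bar>x - (x - y) / (real n + 1)\<bar> < c"
    if x: "\<bar>x\<bar> < c / 2" and c: "0 < c" and n: "2 * ((c + \<bar>y\<bar>) / c) < real n" for x y c n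
  proof -
    have "2 * (c + \<bar>y\<bar>) < c * real n" using n c by (simp add: field_simps)
    moreover have "2 * X < K + c" if "2 * (c + Y) < K" "X \<le> A + Y" "A < c / 2" for X Y A K :: real
      using that c by (simp add: field_simps)
    ultimately have "2 * \<bar>x - y\<bar> < c * real n + c" using abs_triangle_ineq4[of x y] x by blast
    then have "2 * \<bar>x - y\<bar> < c * (real n + 1)" by (simp add: algebra_simps)
    then have "\<bar>(x - y) / (real n + 1)\<bar> < c / 2" by (simp add: abs_divide field_simps)
    then show ?thesis using x by linarith
  qed
  have H_eq: "H n s = (LINT t|lborel. f (pt s t) * (indicator {..<dilated_graph p n s} t - indicator {..<g s} t))"
    if n: "N \<le> n" for n s
  proof -
    have "0 < (a + \<bar>S p\<bar>) / a" "0 < (b + \<bar>T p\<bar>) / b" using ab by (auto intro!: divide_pos_pos add_pos_nonneg)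
    moreover have "0 < K \<and> 2 * A < K \<and> 2 * A' < K" if "0 < A" "0 < A'" "2 * (A + A') < real N" "real N \<le> K" for A A' K :: real
      using that by (auto simp: field_simps)
    moreover have "real N \<le> real n" using n by simp
    ultimately have "0 < real n" and na: "2 * ((a + \<bar>S p\<bar>) / a) < real n" and nb: "2 * ((b + \<bar>T p\<bar>) / b) < real n"
      using N by blast+
    then have n0: "0 < n" by simp
    have "F n (pt s t) = f (pt s t) * (indicator {..<dilated_graph p n s} t - indicator {..<g s} t)" for t
    proof (cases "f (pt s t) = 0")
      case False
      then have st: "\<bar>s\<bar> < a / 2" "\<bar>t\<bar> < b / 2" using supp[of "pt s t"] by auto
      have 1: "pt s t \<in> \<Omega> \<longleftrightarrow> t < g s" using inside_iff[of "pt s t"] st ab by auto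
      have "\<bar>S (shrink p n (pt s t))\<bar> < a" "\<bar>T (shrink p n (pt s t))\<bar> < b"
        unfolding S_shrink T_shrink using close[OF _ ab(1) na] close[OF _ ab(2) nb] st by auto
      then have 2: "shrink p n (pt s t) \<in> \<Omega> \<longleftrightarrow> t < dilated_graph p n s"
        using inside_iff[of "shrink p n (pt s t)"] shrink_below_graph_iff[OF n0, of p "pt s t"] by simp
      show ?thesis unfolding F_def using 1 2 by (auto simp: indicator_def)
    qed (simp add: F_def)
    then show ?thesis by (simp add: H_def)
  qed
  have meas_t [measurable]: "(\<lambda>t. f (pt s t)) \<in> borel_measurable borel" for s
  proof -
    have [measurable]: "pt s \<in> borel_measurable borel" by (intro borel_measurable_continuous_onI continuous_intros)
    show ?thesis by measurable
  qed
  \<comment> \<open>The estimate with the crude oscillation bound \<open>2 B\<close> yields the factor 3.\<close>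
  define Cst where "Cst = 3 * B * (L * (a + \<bar>S p\<bar>) + b + \<bar>T p\<bar>)"
  have H_bound: "norm (real n * H n s) \<le> indicator {-a..a} s * Cst" if n: "N \<le> n" "0 < n" for n s
  proof (cases "\<bar>s\<bar> < a")
    case True
    let ?d = "dilated_graph p n s - g s"
    have "\<bar>H n s - f (pt s (g s)) * ?d\<bar> \<le> (2 * B) * \<bar>?d\<bar>"
      unfolding H_eq[OF n(1)]
    proof (rule step_difference_integral_estimate[OF meas_t])
      fix t show "\<bar>f (pt s t) - f (pt s (g s))\<bar> \<le> 2 * B" using B[of "pt s t"] B[of "pt s (g s)"] by linarith
    qed (rule B)
    moreover have "\<bar>f (pt s (g s)) * ?d\<bar> \<le> B * \<bar>?d\<bar>" unfolding abs_mult by (intro mult_right_mono B) auto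
    ultimately have "\<bar>H n s\<bar> \<le> 3 * B * \<bar>?d\<bar>" by linarith
    then have "real n * \<bar>H n s\<bar> \<le> real n * (3 * B * \<bar>?d\<bar>)" by (intro mult_left_mono) auto
    also have "\<dots> = 3 * B * \<bar>real n * ?d\<bar>" by (simp add: abs_mult)
    also have "\<dots> \<le> Cst" unfolding Cst_def using B0 by (intro mult_left_mono dilated_graph_bound n True) auto
    finally show ?thesis using True by (simp add: abs_mult indicator_def abs_less_iff)
  next
    case False
    then have "F n (pt s t) = 0" for t using supp[of "pt s t"] ab by (auto simp: F_def)
    moreover have "0 \<le> Cst" unfolding Cst_def using B0 L_nonneg ab by (intro mult_nonneg_nonneg add_nonneg_nonneg) auto
    ultimately show ?thesis by (simp add: H_def)
  qed
  have H_lim: "AE s in lborel. (\<lambda>n. real n * H n s) \<longlonglongrightarrow> f (\<gamma> s) * flux_density p s"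
    using AE_differentiable cont
  proof eventually_elim
    case (elim s)
    show ?case
    proof (cases "\<bar>s\<bar> < a")
      case True
      have "isCont (pt s) (g s)" using continuous_pt[of UNIV "\<lambda>_. s" "\<lambda>x. x"] by (simp add: continuous_on_eq_continuous_at)
      then have "isCont (\<lambda>t. f (pt s t)) (g s)"
        using elim True by (intro isCont_o2[OF \<open>isCont (pt s) (g s)\<close>, of f]) (simp add: \<gamma>_def)
      from step_difference_integral_limit[OF meas_t _ this dilated_graph_limit[OF elim(1)], where B=B]
      have "(\<lambda>n. real n * (LINT t|lborel. f (pt s t) * (indicator {..<dilated_graph p n s} t - indicator {..<g s} t)))
        \<longlonglongrightarrow> f (pt s (g s)) * flux_density p s" using B by simp
      moreover have "\<forall>\<^sub>F n in sequentially. real n * (LINT t|lborel. f (pt s t) * (indicator {..<dilated_graph p n s} t - indicator {..<g s} t))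
          = real n * H n s"
        using eventually_ge_at_top[of N] by eventually_elim (simp add: H_eq)
      ultimately show ?thesis by (simp add: tendsto_cong \<gamma>_def)
    next
      case False
      then have z: "f (pt s t) = 0" for t using supp[of "pt s t"] ab by auto
      then have "H n s = 0" for n by (simp add: H_def F_def)
      then show ?thesis using z by (simp add: \<gamma>_def)
    qed
  qed
  have "(\<lambda>n. LINT s|lborel. real (n + Suc N) * H (n + Suc N) s) \<longlonglongrightarrow> (LINT s|lborel. f (\<gamma> s) * flux_density p s)"
  proof (rule integral_dominated_convergence[where w="\<lambda>s. indicator {-a..a} s * Cst"])
    show "integrable lborel (\<lambda>s. indicator {-a..a} s * Cst)"
      using ab by (intro integrable_mult_left) simp
    show "AE s in lborel. (\<lambda>n. real (n + Suc N) * H (n + Suc N) s) \<longlonglongrightarrow> f (\<gamma> s) * flux_density p s"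
      using H_lim by eventually_elim (rule LIMSEQ_ignore_initial_segment)
    show "AE s in lborel. norm (real (n + Suc N) * H (n + Suc N) s) \<le> indicator {-a..a} s * Cst" for n
      by (intro AE_I2 H_bound) auto
    show "(\<lambda>s. real (n + Suc N) * H (n + Suc N) s) \<in> borel_measurable lborel" for n
      using H_int by (intro borel_measurable_times borel_measurable_const borel_measurable_integrable)
  qed measurable
  then have "(\<lambda>n. real (n + Suc N) * (LINT s|lborel. H (n + Suc N) s)) \<longlonglongrightarrow> (LINT s|lborel. f (\<gamma> s) * flux_density p s)"
    by (simp del: of_nat_Suc of_nat_add add_Suc_right)
  then have "(\<lambda>n. real n * (LINT s|lborel. H n s)) \<longlonglongrightarrow> (LINT s|lborel. f (\<gamma> s) * flux_density p s)"
    by (rule LIMSEQ_offset[where k="Suc N" and f="\<lambda>n. real n * (LINT s|lborel. H n s)"])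
  moreover have "(LINT s|lborel. H n s) = (LINT x|lborel. f x * (indicator \<Omega> (shrink p n x) - indicator \<Omega> x))" for n
    using F_H[of n] by (simp add: F_def[abs_def])
  ultimately show ?thesis by simp
qed

end

text \<open>
  Clamping the parameter to the middle half of its range extends \<open>g\<close> to the line with the same Lipschitz
  constant.
\<close>

lemma lipschitz_boundary_chart:
  assumes "lipschitz_boundary \<Omega>" "q \<in> frontier \<Omega>"
  shows "\<exists>u v a b L g. lipschitz_chart \<Omega> q u v a b L g"
proof -
  obtain u v a b L g where
    uv: "norm u = 1" "norm v = 1" "u \<bullet> v = 0" "0 < a" "0 < b" and
    lip: "L-lipschitz_on {-a<..<a} g" and gb: "\<forall>s\<in>{-a<..<a}. \<bar>g s\<bar> < b" and
    mem: "\<forall>s\<in>{-a<..<a}. \<forall>t\<in>{-b<..<b}.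
           (q + s *\<^sub>R u + t *\<^sub>R v \<in> \<Omega> \<longleftrightarrow> t < g s) \<and>
           (q + s *\<^sub>R u + t *\<^sub>R v \<in> frontier \<Omega> \<longleftrightarrow> t = g s)"
    using assms unfolding lipschitz_boundary_def by blast
  define clamp where "clamp s = max (- (a/2)) (min s (a/2))" for s
  have clamp: "clamp s \<in> {-a<..<a}" for s using uv by (auto simp: clamp_def)
  have clamp_id: "clamp s = s" if "\<bar>s\<bar> < a / 2" for s using that by (auto simp: clamp_def)
  have clamp_lip: "\<bar>clamp s - clamp t\<bar> \<le> \<bar>s - t\<bar>" for s t by (auto simp: clamp_def)
  have L: "0 \<le> L" using lip by (rule lipschitz_on_nonneg)
  have "lipschitz_chart \<Omega> q u v (a/2) b L (\<lambda>s. g (clamp s))"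
  proof
    show "L-lipschitz_on UNIV (\<lambda>s. g (clamp s))"
    proof (rule lipschitz_onI[OF _ L])
      fix s t
      have "dist (g (clamp s)) (g (clamp t)) \<le> L * dist (clamp s) (clamp t)"
        by (rule lipschitz_onD[OF lip clamp clamp])
      also have "\<dots> \<le> L * dist s t" using L clamp_lip by (intro mult_left_mono) (auto simp: dist_real_def)
      finally show "dist (g (clamp s)) (g (clamp t)) \<le> L * dist s t" .
    qed
    fix s t :: real assume "\<bar>s\<bar> < a / 2" "\<bar>t\<bar> < b"
    then have "clamp s = s" "s \<in> {-a<..<a}" "t \<in> {-b<..<b}" using uv by (auto simp: clamp_id)
    then show "q + s *\<^sub>R u + t *\<^sub>R v \<in> \<Omega> \<longleftrightarrow> t < g (clamp s)" "q + s *\<^sub>R u + t *\<^sub>R v \<in> frontier \<Omega> \<longleftrightarrow> t = g (clamp s)"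
      using mem by auto
  qed (use uv gb clamp in auto)
  then show ?thesis by blast
qed

section \<open>Polar coordinates and thin annuli\<close>

lemma circle_point_eq:
  "circle_point p r t = p + (r * cos t) *\<^sub>R axis 1 1 + (r * sin t) *\<^sub>R axis 2 1"
  by (simp add: circle_point_def vec_eq_iff forall_2 axis_def)

lemma circle_point_nth:
  "(circle_point p r t - p) $ 1 = r * cos t" "(circle_point p r t - p) $ 2 = r * sin t"
  by (simp_all add: circle_point_def)

lemma dist_circle_point: "dist p (circle_point p r t) = \<bar>r\<bar>"
proof -
  have "(r * cos t)\<^sup>2 + (r * sin t)\<^sup>2 = r\<^sup>2"
    by (simp add: power_mult_distrib distrib_left[symmetric])
  then have "norm (circle_point p r t - p) = \<bar>r\<bar>"
    unfolding norm_vec_def L2_set_def sum_2 real_norm_def power2_abs circle_point_nth by simp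
  then show ?thesis by (simp add: dist_norm norm_minus_commute)
qed

lemma polar_coordinates_inj:
  assumes "0 < r" "0 < r'" "t \<in> {\<alpha>..<\<alpha> + 2 * pi}" "t' \<in> {\<alpha>..<\<alpha> + 2 * pi}"
    and eq: "circle_point p r t = circle_point p r' t'"
  shows "r = r' \<and> t = t'"
proof -
  have r: "r = r'" using dist_circle_point[of p r t] dist_circle_point[of p r' t'] eq assms by simp
  have "r * cos t = r' * cos t'" "r * sin t = r' * sin t'" using eq circle_point_nth by metis+
  then have "sin t = sin t' \<and> cos t = cos t'" using r assms by simp
  then obtain n :: int where n: "t = t' + 2 * pi * n" using sin_cos_eq_iff by blast
  \<comment> \<open>Both angles lie in one period, so they differ by less than a full turn.\<close>
  have "\<bar>t - t'\<bar> < 2 * pi" using assms by auto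
  then have "\<bar>2 * pi * real_of_int n\<bar> < 2 * pi * 1" unfolding n by simp
  then have "\<bar>real_of_int n\<bar> < 1" by (simp add: abs_mult)
  then have "n = 0" by linarith
  then show ?thesis using r n by simp
qed

lemma polar_coordinates_exist:
  fixes p y :: "real^2" and \<alpha> :: real
  shows "\<exists>t\<in>{\<alpha>..<\<alpha> + 2 * pi}. y = circle_point p (dist p y) t"
proof -
  obtain t0 where t0: "y = circle_point p (dist p y) t0"
  proof (cases "y = p")
    case True
    then show ?thesis using that[of 0] by (simp add: circle_point_eq)
  next
    case False
    define R where "R = dist p y"
    have R: "0 < R" using False by (simp add: R_def)
    define z where "z = y - p"
    have "z$1 * z$1 + z$2 * z$2 = R * R"
    proof -
      have "R\<^sup>2 = z \<bullet> z" unfolding R_def z_def by (metis dist_commute dist_norm power2_norm_eq_inner)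
      then show ?thesis by (simp add: inner_vec_def sum_2 power2_eq_square)
    qed
    then have "(z$1 / R)\<^sup>2 + (z$2 / R)\<^sup>2 = 1" using R by (simp add: field_simps power2_eq_square)
    then obtain t where t: "z$1 / R = cos t" "z$2 / R = sin t" using sincos_total_2pi by metis
    have "z$1 = R * cos t" "z$2 = R * sin t" using t R by (auto simp: field_simps)
    then have "y = circle_point p R t"
      by (simp add: vec_eq_iff forall_2 circle_point_def z_def algebra_simps)
    then show ?thesis using that by (simp add: R_def)
  qed
  define m where "m = \<lfloor>(t0 - \<alpha>) / (2 * pi)\<rfloor>"
  define t where "t = t0 - 2 * pi * real_of_int m"
  have "real_of_int m \<le> (t0 - \<alpha>) / (2 * pi)" "(t0 - \<alpha>) / (2 * pi) < real_of_int m + 1"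
    unfolding m_def by linarith+
  then have "t \<in> {\<alpha>..<\<alpha> + 2 * pi}" by (simp add: t_def field_simps)
  moreover have "sin t = sin t0 \<and> cos t = cos t0"
    unfolding sin_cos_eq_iff t_def by (rule exI[of _ "-m"]) simp
  ultimately show ?thesis using t0 by (intro bexI[of _ t]) (auto simp: circle_point_def)
qed

lemma indicator_tendsto_off_frontier:
  assumes "open \<Omega>" "z \<notin> frontier \<Omega>" "(y \<longlongrightarrow> z) F"
  shows "((\<lambda>n. indicator \<Omega> (y n) :: real) \<longlongrightarrow> indicator \<Omega> z) F"
proof (cases "z \<in> \<Omega>")
  case True
  then have "\<forall>\<^sub>F n in F. y n \<in> \<Omega>" using assms topological_tendstoD by blast
  then have "\<forall>\<^sub>F n in F. (indicator \<Omega> (y n) :: real) = indicator \<Omega> z"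
    by eventually_elim (use True in simp)
  then show ?thesis by (rule tendsto_eventually)
next
  case False
  then have "z \<in> - closure \<Omega>" using assms(2) by (simp add: closure_Un_frontier)
  then have "\<forall>\<^sub>F n in F. y n \<in> - closure \<Omega>" using assms(3) topological_tendstoD[of y z F "- closure \<Omega>"] by auto
  then have "\<forall>\<^sub>F n in F. (indicator \<Omega> (y n) :: real) = indicator \<Omega> z"
    by eventually_elim (use False closure_subset in \<open>auto simp: indicator_def\<close>)
  then show ?thesis by (rule tendsto_eventually)
qed

lemma finite_circle_angles:
  assumes "0 < r" "finite (A \<inter> sphere p r)"
  shows "finite {t \<in> {\<alpha>..<\<alpha> + 2 * pi}. circle_point p r t \<in> A}"
proof (rule finite_imageD)
  show "finite (circle_point p r ` {t \<in> {\<alpha>..<\<alpha> + 2 * pi}. circle_point p r t \<in> A})"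
    by (rule finite_subset[OF _ assms(2)]) (use assms(1) in \<open>auto simp: dist_circle_point\<close>)
  show "inj_on (circle_point p r) {t \<in> {\<alpha>..<\<alpha> + 2 * pi}. circle_point p r t \<in> A}"
    by (rule inj_onI) (use polar_coordinates_inj[OF assms(1) assms(1)] in blast)
qed

definition polar_strip :: "real \<Rightarrow> (real^2) set" where
  "polar_strip \<alpha> = {x. 0 \<le> x$1 \<and> x$1 < 1 \<and> \<alpha> \<le> x$2 \<and> x$2 < \<alpha> + 2 * pi}"

text \<open>
  For \<open>0 < c \<le> r\<close> this maps the fixed strip of width 1 onto the annulus between the radii \<open>r - c\<close> and
  \<open>r\<close>. A fixed domain of integration lets the width \<open>c\<close> tend to 0 under the integral.
\<close>

definition polar_map :: "real^2 \<Rightarrow> real \<Rightarrow> real \<Rightarrow> real^2 \<Rightarrow> real^2" where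
  "polar_map p r c x = circle_point p (r - c * x$1) (x$2)"

lemma continuous_polar_map: "continuous_on UNIV (polar_map p r c)"
  unfolding polar_map_def circle_point_eq by (intro continuous_intros)

lemma polar_map_image:
  assumes "0 < c" "c \<le> r"
  shows "polar_map p r c ` polar_strip \<alpha> = cball p r - cball p (r - c)"
proof (intro equalityI subsetI)
  fix y assume "y \<in> polar_map p r c ` polar_strip \<alpha>"
  then obtain x where x: "x \<in> polar_strip \<alpha>" "y = polar_map p r c x" by blast
  have "c * x$1 < c * 1" "0 \<le> c * x$1" using x assms by (auto simp: polar_strip_def)
  moreover have "dist p y = \<bar>r - c * x$1\<bar>" using x by (simp add: polar_map_def dist_circle_point)
  ultimately have "dist p y \<le> r" "\<not> dist p y \<le> r - c" using assms by linarith+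
  then show "y \<in> cball p r - cball p (r - c)" by simp
next
  fix y assume y: "y \<in> cball p r - cball p (r - c)"
  obtain t where t: "t \<in> {\<alpha>..<\<alpha> + 2 * pi}" "y = circle_point p (dist p y) t" using polar_coordinates_exist by blast
  define x where "x = (vector [(r - dist p y) / c, t] :: real^2)"
  have "x \<in> polar_strip \<alpha>" using t y assms by (auto simp: polar_strip_def x_def field_simps)
  moreover have "polar_map p r c x = y" using t(2) assms by (simp add: polar_map_def x_def)
  ultimately show "y \<in> polar_map p r c ` polar_strip \<alpha>" by blast
qed

lemma polar_map_inj:
  assumes "0 < c" "c \<le> r"
  shows "inj_on (polar_map p r c) (polar_strip \<alpha>)"
proof (rule inj_onI)
  fix x y assume xy: "x \<in> polar_strip \<alpha>" "y \<in> polar_strip \<alpha>" "polar_map p r c x = polar_map p r c y"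
  have "c * x$1 < c * 1" "c * y$1 < c * 1" using xy assms by (auto simp: polar_strip_def)
  then have "0 < r - c * x$1" "0 < r - c * y$1" using assms by linarith+
  then have "r - c * x$1 = r - c * y$1 \<and> x$2 = y$2"
    using xy assms by (intro polar_coordinates_inj[of _ _ _ \<alpha> _ p]) (auto simp: polar_strip_def polar_map_def)
  then show "x = y" using assms by (simp add: vec_eq_iff forall_2)
qed

lemma polar_map_derivative:
  "(polar_map p r c has_derivative
     (\<lambda>h. (- c * h$1 * cos (x$2) - (r - c * x$1) * sin (x$2) * h$2) *\<^sub>R axis 1 1
        + (- c * h$1 * sin (x$2) + (r - c * x$1) * cos (x$2) * h$2) *\<^sub>R axis 2 1)) (at x within A)"
proof -
  have d: "((\<lambda>x. x$i) has_derivative (\<lambda>h. h$i)) (at x within A)" for i :: 2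
    by (rule bounded_linear_imp_has_derivative[OF bounded_linear_vec_nth])
  show ?thesis
    unfolding polar_map_def[abs_def] circle_point_eq
    by (rule has_derivative_eq_rhs, (rule derivative_intros d)+) (auto simp: fun_eq_iff algebra_simps)
qed

lemma polar_map_det:
  "det (matrix (\<lambda>h. (- c * h$1 * cos t - R * sin t * h$2) *\<^sub>R axis 1 1
        + (- c * h$1 * sin t + R * cos t * h$2) *\<^sub>R axis 2 1 :: real^2)) = - c * R"
proof -
  have "R * (c * (cos t * cos t)) + R * (c * (sin t * sin t)) = R * c"
    by (simp add: distrib_left[symmetric] sin_cos_squared_add3)
  then show ?thesis unfolding det_2 matrix_def by (simp add: axis_def algebra_simps)
qed

lemma polar_strip_borel [measurable]: "polar_strip \<alpha> \<in> sets borel"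
  unfolding polar_strip_def by measurable

lemma measure_strip_angles:
  fixes A :: "real set"
  assumes [measurable]: "A \<in> sets borel"
  shows "measure lborel {x::real^2. 0 \<le> x$1 \<and> x$1 < 1 \<and> x$2 \<in> A} = measure lborel A"
proof -
  have ax: "norm (axis 1 1 :: real^2) = 1" "norm (axis 2 1 :: real^2) = 1" "(axis 1 1 :: real^2) \<bullet> axis 2 1 = 0"
    by (simp_all add: inner_axis_axis)
  have M: "(\<lambda>(s, t). 0 + s *\<^sub>R axis 1 1 + t *\<^sub>R axis 2 1 :: real^2) \<in> borel_measurable borel"
    unfolding case_prod_unfold by (intro borel_measurable_continuous_onI continuous_intros)
  let ?X = "{x::real^2. 0 \<le> x$1 \<and> x$1 < 1 \<and> x$2 \<in> A}"
  have "(\<lambda>(s, t). 0 + s *\<^sub>R axis 1 1 + t *\<^sub>R axis 2 1 :: real^2) -` ?X = {0..<1::real} \<times> A"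
    by (auto simp: axis_def)
  moreover have "?X \<in> sets borel" by measurable
  ultimately have "emeasure lborel ?X = emeasure lborel ({0..<1::real} \<times> A)"
    by (subst lborel_plane_coordinates[OF ax, of 0, symmetric], subst emeasure_distr) (use M in auto)
  also have "\<dots> = emeasure lborel A"
    unfolding lborel_prod[symmetric] by (subst lborel.emeasure_pair_measure_Times) auto
  finally show ?thesis by (simp add: measure_def)
qed

text \<open>
  On the strip the Jacobian is \<open>c (r - c x\<^sub>1)\<close>, and \<open>n c \<rightarrow> r\<close>. For every angle whose point on the
  circle is off the frontier, membership in \<open>\<Omega>\<close> is stable as the radius tends to \<open>r\<close>; the finitely
  many other angles form a null set of the strip.
\<close>

lemma annulus_limit:
  fixes \<Omega> :: "(real^2) set" and \<alpha> :: real
  assumes \<Omega>: "open \<Omega>" and r: "0 < r" and fin: "finite (frontier \<Omega> \<inter> sphere p r)"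
  shows "(\<lambda>n. real n * measure lborel (\<Omega> \<inter> (cball p r - cball p (r - r / (real n + 1)))))
    \<longlonglongrightarrow> r\<^sup>2 * measure lborel {t \<in> {\<alpha>..<\<alpha> + 2 * pi}. circle_point p r t \<in> \<Omega>}"
proof -
  define c where "c n = r / (real n + 1)" for n
  have c: "0 < c n" "c n \<le> r" for n using r by (auto simp: c_def field_simps)
  have [measurable]: "\<Omega> \<in> sets borel" using \<Omega> by simp
  have [measurable]: "polar_map p r d \<in> borel_measurable borel" for d
    using continuous_polar_map by (rule borel_measurable_continuous_onI)
  have [measurable]: "circle_point p r \<in> borel_measurable borel"
    unfolding circle_point_eq[abs_def] by (intro borel_measurable_continuous_onI continuous_intros)
  have bnd: "bounded (polar_strip \<alpha>)"
  proof (rule bounded_subset[OF bounded_cbox])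
    show "polar_strip \<alpha> \<subseteq> cbox (vector [0, \<alpha>]) (vector [1, \<alpha> + 2 * pi])"
      by (auto simp: polar_strip_def mem_box_cart forall_2)
  qed
  then have em: "emeasure lborel (polar_strip \<alpha>) < \<infinity>" by (rule emeasure_bounded_finite)
  have area: "measure lborel (\<Omega> \<inter> (cball p r - cball p (r - c n)))
    = (LINT x|lborel. indicator (polar_strip \<alpha>) x * (indicator \<Omega> (polar_map p r (c n) x) * (c n * (r - c n * x$1))))" for n
  proof -
    define X where "X = {x \<in> polar_strip \<alpha>. polar_map p r (c n) x \<in> \<Omega>}"
    have X [measurable]: "X \<in> sets borel" unfolding X_def by measurable
    have im: "polar_map p r (c n) ` X = \<Omega> \<inter> (cball p r - cball p (r - c n))"
    proof -
      have "polar_map p r (c n) ` X = \<Omega> \<inter> polar_map p r (c n) ` polar_strip \<alpha>" unfolding X_def by auto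
      then show ?thesis by (simp only: polar_map_image[OF c])
    qed
    define D where "D x h = ((- c n * h$1 * cos (x$2) - (r - c n * x$1) * sin (x$2) * h$2) *\<^sub>R axis 1 1
        + (- c n * h$1 * sin (x$2) + (r - c n * x$1) * cos (x$2) * h$2) *\<^sub>R axis 2 1 :: real^2)" for x h :: "real^2"
    have det: "\<bar>det (matrix (D x))\<bar> = c n * (r - c n * x$1)" if "x \<in> polar_strip \<alpha>" for x
    proof -
      have "c n * x$1 \<le> c n * 1" using that c[of n] by (auto simp: polar_strip_def)
      then have "0 \<le> r - c n * x$1" using c[of n] by linarith
      then show ?thesis unfolding D_def[abs_def] polar_map_det using c[of n] by (simp add: abs_mult)
    qed
    have bound: "norm (c n * (r - c n * x$1)) \<le> r * r" if "x \<in> polar_strip \<alpha>" for x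
    proof -
      have "c n * x$1 \<le> c n * 1" "0 \<le> c n * x$1" using that c[of n] by (auto simp: polar_strip_def)
      then have "0 \<le> r - c n * x$1" "r - c n * x$1 \<le> r" using c[of n] by linarith+
      then show ?thesis using c[of n] by (simp add: abs_mult mult_mono)
    qed
    have int: "set_integrable lborel X (\<lambda>x. c n * (r - c n * x$1))"
      unfolding set_integrable_def
    proof (rule integrableI_bounded_set_indicator[where B="r * r"])
      show "emeasure lborel X < \<infinity>"
        by (rule le_less_trans[OF emeasure_mono em]) (auto simp: X_def)
    qed (use bound in \<open>auto simp: X_def\<close>)
    have intD: "(\<lambda>x. \<bar>det (matrix (D x))\<bar>) integrable_on X"
      using set_borel_integral_eq_integral(1)[OF int]
      by (rule integrable_eq) (use det in \<open>auto simp: X_def\<close>)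
    have "measure lebesgue (polar_map p r (c n) ` X) = integral X (\<lambda>x. \<bar>det (matrix (D x))\<bar>)"
    proof (rule measure_differentiable_image_eq)
      show "inj_on (polar_map p r (c n)) X"
        by (rule inj_on_subset[OF polar_map_inj[OF c]]) (auto simp: X_def)
      show "(polar_map p r (c n) has_derivative D x) (at x within X)" for x
        unfolding D_def[abs_def] by (rule polar_map_derivative)
    qed (use intD in auto)
    also have "\<dots> = integral X (\<lambda>x. c n * (r - c n * x$1))"
      by (rule integral_cong) (use det in \<open>auto simp: X_def\<close>)
    also have "\<dots> = (LINT x:X|lborel. c n * (r - c n * x$1))"
      by (rule set_borel_integral_eq_integral(2)[OF int, symmetric])
    also have "\<dots> = (LINT x|lborel. indicator (polar_strip \<alpha>) x * (indicator \<Omega> (polar_map p r (c n) x) * (c n * (r - c n * x$1))))"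
      unfolding set_lebesgue_integral_def by (intro Bochner_Integration.integral_cong) (auto simp: X_def indicator_def)
    finally show ?thesis unfolding im by (simp add: measure_completion)
  qed
  define G where "G n x = real n * (indicator (polar_strip \<alpha>) x * (indicator \<Omega> (polar_map p r (c n) x) * (c n * (r - c n * x$1))))" for n and x :: "real^2"
  define Tb where "Tb = {t \<in> {\<alpha>..<\<alpha> + 2 * pi}. circle_point p r t \<in> frontier \<Omega>}"
  have Tb: "finite Tb" unfolding Tb_def by (rule finite_circle_angles[OF r fin])
  have null: "AE x in lborel. (x::real^2)$2 \<notin> Tb"
  proof -
    have "negligible (\<Union>t\<in>Tb. {x::real^2. axis 2 1 \<bullet> x = t})"
      using Tb by (intro negligible_Union) (auto intro!: negligible_hyperplane)
    moreover have "closed (\<Union>t\<in>Tb. {x::real^2. axis 2 1 \<bullet> x = t})"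
      using Tb by (auto intro!: closed_UN closed_hyperplane simp del: inner_axis inner_axis')
    ultimately have "(\<Union>t\<in>Tb. {x::real^2. axis 2 1 \<bullet> x = t}) \<in> null_sets lborel"
      by (simp add: negligible_iff_null_sets null_sets_completion_iff borel_closed)
    then show ?thesis by (rule AE_I') (auto simp: inner_axis')
  qed
  have cn: "c \<longlonglongrightarrow> 0"
  proof -
    have "(\<lambda>n. r * (1 / (real n + 1))) \<longlonglongrightarrow> r * 0"
      using LIMSEQ_inverse_real_of_nat by (intro tendsto_intros) (simp add: inverse_eq_divide add.commute)
    then show ?thesis by (simp add: c_def[abs_def])
  qed
  have ncn: "(\<lambda>n. real n * c n) \<longlonglongrightarrow> r"
  proof -
    have "(\<lambda>n. r - c n) \<longlonglongrightarrow> r - 0" by (intro tendsto_intros cn)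
    moreover have "r - c n = real n * c n" for n by (simp add: c_def field_simps)
    ultimately show ?thesis by simp
  qed
  have "(\<lambda>n. LINT x|lborel. G n x) \<longlonglongrightarrow> (LINT x|lborel. indicator (polar_strip \<alpha>) x * (indicator \<Omega> (circle_point p r (x$2)) * r\<^sup>2))"
  proof (rule integral_dominated_convergence[where w="\<lambda>x. indicator (polar_strip \<alpha>) x * r\<^sup>2"])
    show "integrable lborel (\<lambda>x. indicator (polar_strip \<alpha>) x * r\<^sup>2)"
      using em by (intro integrable_mult_left) simp
    show "AE x in lborel. (\<lambda>n. G n x) \<longlonglongrightarrow> indicator (polar_strip \<alpha>) x * (indicator \<Omega> (circle_point p r (x$2)) * r\<^sup>2)"
      using null
    proof eventually_elim
      case (elim x)
      show ?case
      proof (cases "x \<in> polar_strip \<alpha>")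
        case True
        then have off: "circle_point p r (x$2) \<notin> frontier \<Omega>" using elim by (auto simp: Tb_def polar_strip_def)
        have "(\<lambda>n. polar_map p r (c n) x) \<longlonglongrightarrow> circle_point p (r - 0 * x$1) (x$2)"
          unfolding polar_map_def circle_point_eq by (intro tendsto_intros cn)
        then have lim: "(\<lambda>n. indicator \<Omega> (polar_map p r (c n) x) :: real) \<longlonglongrightarrow> indicator \<Omega> (circle_point p r (x$2))"
          using off by (intro indicator_tendsto_off_frontier[OF \<Omega>]) auto
        have "(\<lambda>n. indicator \<Omega> (polar_map p r (c n) x) * ((real n * c n) * (r - c n * x$1)))
          \<longlonglongrightarrow> indicator \<Omega> (circle_point p r (x$2)) * (r * (r - 0 * x$1))"
          by (intro tendsto_intros lim ncn cn)
        moreover have "G n x = indicator \<Omega> (polar_map p r (c n) x) * ((real n * c n) * (r - c n * x$1))" for n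
          using True by (simp add: G_def)
        ultimately show ?thesis using True by (simp add: power2_eq_square)
      qed (simp add: G_def)
    qed
    show "AE x in lborel. norm (G n x) \<le> indicator (polar_strip \<alpha>) x * r\<^sup>2" for n
    proof (rule AE_I2)
      fix x :: "real^2"
      show "norm (G n x) \<le> indicator (polar_strip \<alpha>) x * r\<^sup>2"
      proof (cases "x \<in> polar_strip \<alpha>")
        case True
        have "c n * x$1 \<le> c n * 1" "0 \<le> c n * x$1" using True c[of n] by (auto simp: polar_strip_def)
        then have 1: "0 \<le> r - c n * x$1" "r - c n * x$1 \<le> r" using c[of n] by linarith+
        have 2: "real n * c n \<le> r" "0 \<le> real n * c n" using r by (auto simp: c_def field_simps)
        have "real n * c n * (r - c n * x$1) \<le> r * r" using 1 2 by (intro mult_mono) auto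
        then show ?thesis using True 1 2 c[of n] r
          by (auto simp: G_def indicator_def power2_eq_square abs_mult mult.assoc)
      qed (simp add: G_def)
    qed
    show "G n \<in> borel_measurable lborel" for n unfolding G_def by measurable
  qed measurable
  moreover have "(LINT x|lborel. G n x) = real n * measure lborel (\<Omega> \<inter> (cball p r - cball p (r - r / (real n + 1))))" for n
    using area[of n] by (simp add: G_def c_def)
  moreover have "(LINT x|lborel. indicator (polar_strip \<alpha>) x * (indicator \<Omega> (circle_point p r (x$2)) * r\<^sup>2))
    = r\<^sup>2 * measure lborel {t \<in> {\<alpha>..<\<alpha> + 2 * pi}. circle_point p r t \<in> \<Omega>}"
  proof -
    have A: "{t \<in> {\<alpha>..<\<alpha> + 2 * pi}. circle_point p r t \<in> \<Omega>} \<in> sets borel" by measurable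
    have "(LINT x|lborel. indicator (polar_strip \<alpha>) x * (indicator \<Omega> (circle_point p r (x$2)) * r\<^sup>2))
      = (LINT x|lborel. indicator {x::real^2. 0 \<le> x$1 \<and> x$1 < 1 \<and> x$2 \<in> {t \<in> {\<alpha>..<\<alpha> + 2 * pi}. circle_point p r t \<in> \<Omega>}} x * r\<^sup>2)"
      by (intro Bochner_Integration.integral_cong) (auto simp: polar_strip_def indicator_def)
    also have "\<dots> = measure lborel {x::real^2. 0 \<le> x$1 \<and> x$1 < 1 \<and> x$2 \<in> {t \<in> {\<alpha>..<\<alpha> + 2 * pi}. circle_point p r t \<in> \<Omega>}} * r\<^sup>2"
      by simp
    also have "\<dots> = r\<^sup>2 * measure lborel {t \<in> {\<alpha>..<\<alpha> + 2 * pi}. circle_point p r t \<in> \<Omega>}"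
      using measure_strip_angles[OF A] by simp
    finally show ?thesis .
  qed
  ultimately show ?thesis by simp
qed

section \<open>Global flux and the area formula\<close>

context lipschitz_chart
begin

definition inner_box :: "(real^2) set" where "inner_box = {x. \<bar>S x\<bar> < a / 2 \<and> \<bar>T x\<bar> < b / 2}"

lemma open_inner_box: "open inner_box"
  unfolding inner_box_def by (intro open_Collect_conj open_Collect_less continuous_intros) auto

lemma center_in_inner_box: "q \<in> inner_box"
  using ab by (simp add: inner_box_def S_def T_def)

lemma inner_box_not_UNIV: "- inner_box \<noteq> {}"
proof -
  have "pt a 0 \<in> - inner_box" using ab by (simp add: inner_box_def)
  then show ?thesis by blast
qed

lemma chart_flux:
  fixes f :: "real^2 \<Rightarrow> real"
  assumes \<Omega>: "open \<Omega>" and f: "f \<in> borel_measurable borel" and B: "\<And>x. \<bar>f x\<bar> \<le> B"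
    and supp: "\<And>x. f x \<noteq> 0 \<Longrightarrow> x \<in> inner_box"
    and cont: "\<And>x. x \<in> frontier \<Omega> - E \<Longrightarrow> isCont f x" and fin: "finite (frontier \<Omega> \<inter> E)"
  shows "integrable arc_length (\<lambda>x. indicator (frontier \<Omega>) x * (f x * ((x - p) \<bullet> outward_unit_normal \<Omega> x)))"
    and "(\<lambda>n. real n * (LINT x|lborel. f x * (indicator \<Omega> (shrink p n x) - indicator \<Omega> x)))
      \<longlonglongrightarrow> (LINT x|arc_length. indicator (frontier \<Omega>) x * (f x * ((x - p) \<bullet> outward_unit_normal \<Omega> x)))"
proof -
  have supp': "\<bar>S x\<bar> < a / 2 \<and> \<bar>T x\<bar> < b / 2" if "f x \<noteq> 0" for x
    using supp[OF that] by (simp add: inner_box_def)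
  then have supp'': "\<bar>S x\<bar> < a \<and> \<bar>T x\<bar> < b" if "f x \<noteq> 0" for x
    using supp'[OF that] ab by (intro conjI; linarith)
  show "integrable arc_length (\<lambda>x. indicator (frontier \<Omega>) x * (f x * ((x - p) \<bullet> outward_unit_normal \<Omega> x)))"
    using f B supp'' by (rule graph_surface_integral)
  have "finite {s. \<bar>s\<bar> < a \<and> \<gamma> s \<in> E}"
  proof (rule finite_imageD)
    show "finite (\<gamma> ` {s. \<bar>s\<bar> < a \<and> \<gamma> s \<in> E})"
      by (rule finite_subset[OF _ fin]) (use frontier_\<gamma> in auto)
    show "inj_on \<gamma> {s. \<bar>s\<bar> < a \<and> \<gamma> s \<in> E}"
      by (rule inj_onI) (metis S_\<gamma>)
  qed
  then have "{s. \<bar>s\<bar> < a \<and> \<gamma> s \<in> E} \<in> null_sets lborel"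
    by (rule finite_imp_null_set_lborel)
  then have "AE s in lborel. s \<notin> {s. \<bar>s\<bar> < a \<and> \<gamma> s \<in> E}" by (rule AE_not_in)
  then have "AE s in lborel. \<bar>s\<bar> < a \<longrightarrow> isCont f (\<gamma> s)"
    by eventually_elim (use cont frontier_\<gamma> in auto)
  then show "(\<lambda>n. real n * (LINT x|lborel. f x * (indicator \<Omega> (shrink p n x) - indicator \<Omega> x)))
      \<longlonglongrightarrow> (LINT x|arc_length. indicator (frontier \<Omega>) x * (f x * ((x - p) \<bullet> outward_unit_normal \<Omega> x)))"
    using chart_dilation_limit[OF \<Omega> f B supp'] graph_surface_integral(2)[OF f B supp''] by simp
qed

end

lemma dist_shrink: "dist x (shrink p n x) = dist p x / (real n + 1)"
  by (simp add: shrink_diff dist_norm norm_minus_commute)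

text \<open>
  If the contraction moved a point across the frontier, the segment between the two would meet it.
\<close>

lemma shrink_mem_iff_near:
  assumes "\<And>y. y \<in> frontier \<Omega> \<Longrightarrow> d \<le> dist x y" "dist p x / (real n + 1) < d"
  shows "shrink p n x \<in> \<Omega> \<longleftrightarrow> x \<in> \<Omega>"
proof (rule ccontr)
  let ?L = "closed_segment x (shrink p n x)"
  assume "\<not> ?thesis"
  moreover have "x \<in> ?L" "shrink p n x \<in> ?L" by auto
  ultimately have "?L \<inter> \<Omega> \<noteq> {}" "?L - \<Omega> \<noteq> {}" by blast+
  then have "?L \<inter> frontier \<Omega> \<noteq> {}" by (intro connected_Int_frontier) auto
  then obtain y where y: "y \<in> ?L" "y \<in> frontier \<Omega>" by blast
  have "dist x y \<le> dist x (shrink p n x)" using segment_bound(1)[OF y(1)] by (simp add: dist_norm norm_minus_commute)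
  then show False using assms y(2) dist_shrink[of x p n] by fastforce
qed

text \<open>
  By compactness finitely many charts suffice. The weights \<open>\<psi> q\<close> are distances to the complements of the
  chart boxes, normalised to sum 1 on their union; they are continuous on the union, which is all
  that the charts require. On the rest of the disk, a compact set away from the frontier, dilation
  by a factor close to 1 changes nothing.
\<close>

theorem dilation_flux_limit:
  fixes \<Omega> :: "(real^2) set"
  assumes \<Omega>: "open \<Omega>" "bounded \<Omega>" "lipschitz_boundary \<Omega>"
    and fin: "finite (frontier \<Omega> \<inter> sphere p r)"
  defines "F \<equiv> \<lambda>x. indicator (frontier \<Omega>) x * (indicator (cball p r) x * ((x - p) \<bullet> outward_unit_normal \<Omega> x))"
  shows "integrable arc_length F"
    and "(\<lambda>n. real n * (LINT x|lborel. indicator (cball p r) x * (indicator \<Omega> (shrink p n x) - indicator \<Omega> x)))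
      \<longlonglongrightarrow> (LINT x|arc_length. F x)"
proof -
  let ?D = "cball p r"
  have [measurable]: "\<Omega> \<in> sets borel" using \<Omega> by simp
  have "\<forall>q\<in>frontier \<Omega>. \<exists>u v a b L g. lipschitz_chart \<Omega> q u v a b L g"
    using lipschitz_boundary_chart[OF \<Omega>(3)] by blast
  then obtain u v a b L g where ch: "\<And>q. q \<in> frontier \<Omega> \<Longrightarrow> lipschitz_chart \<Omega> q (u q) (v q) (a q) (b q) (L q) (g q)"
    by metis
  define U where "U q = lipschitz_chart.inner_box q (u q) (v q) (a q) (b q)" for q
  have U: "open (U q)" "q \<in> U q" "- U q \<noteq> {}" if "q \<in> frontier \<Omega>" for q
    unfolding U_def using lipschitz_chart.open_inner_box[OF ch[OF that]] lipschitz_chart.center_in_inner_box[OF ch[OF that]]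
      lipschitz_chart.inner_box_not_UNIV[OF ch[OF that]] by auto
  have "compact (frontier \<Omega>)" using \<Omega>(2) by (simp add: compact_frontier_bounded)
  moreover have "frontier \<Omega> \<subseteq> (\<Union>q\<in>frontier \<Omega>. U q)" using U(2) by blast
  ultimately obtain Q where Q: "Q \<subseteq> frontier \<Omega>" "finite Q" "frontier \<Omega> \<subseteq> (\<Union>q\<in>Q. U q)"
    using compactE_image[of "frontier \<Omega>" "frontier \<Omega>" U] U(1) by metis
  define w where "w q x = infdist x (- U q)" for q and x :: "real^2"
  define W where "W x = (\<Sum>q\<in>Q. w q x)" for x
  define \<psi> where "\<psi> q x = w q x / W x" for q x
  have w_cont: "continuous_on UNIV (w q)" for q unfolding w_def by (intro continuous_intros)
  have w_nonneg: "0 \<le> w q x" for q x by (simp add: w_def infdist_nonneg)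
  have w_pos: "0 < w q x \<longleftrightarrow> x \<in> U q" if "q \<in> Q" for q x
  proof -
    have q: "q \<in> frontier \<Omega>" using that Q by blast
    have "x \<in> - U q \<longleftrightarrow> w q x = 0"
      unfolding w_def using U(1,3)[OF q] by (intro in_closed_iff_infdist_zero) auto
    then show ?thesis using w_nonneg[of q x] by auto
  qed
  have W_pos: "0 < W x \<longleftrightarrow> x \<in> (\<Union>q\<in>Q. U q)" for x
  proof -
    have "0 < W x \<longleftrightarrow> (\<exists>q\<in>Q. 0 < w q x)"
      unfolding W_def using sum_nonneg_eq_0_iff[OF Q(2), of "\<lambda>q. w q x"] sum_nonneg[of Q "\<lambda>q. w q x"] w_nonneg
      by (metis less_le order_refl)
    then show ?thesis using w_pos by auto
  qed
  have W_cont: "continuous_on UNIV W" unfolding W_def[abs_def] by (intro continuous_on_sum w_cont)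
  have [measurable]: "w q \<in> borel_measurable borel" "W \<in> borel_measurable borel" for q
    using w_cont W_cont by (auto intro: borel_measurable_continuous_onI)
  have [measurable]: "\<psi> q \<in> borel_measurable borel" for q unfolding \<psi>_def[abs_def] by measurable
  have W_nonneg: "0 \<le> W x" for x unfolding W_def by (intro sum_nonneg w_nonneg)
  have \<psi>_bound: "0 \<le> \<psi> q x" "\<psi> q x \<le> 1" if "q \<in> Q" for q x
  proof -
    show "0 \<le> \<psi> q x" unfolding \<psi>_def by (intro divide_nonneg_nonneg w_nonneg W_nonneg)
    have "w q x \<le> W x" unfolding W_def using that Q(2) w_nonneg by (intro member_le_sum) auto
    then show "\<psi> q x \<le> 1" unfolding \<psi>_def using W_nonneg[of x] by (simp add: divide_le_eq)
  qed
  have \<psi>_sum: "(\<Sum>q\<in>Q. \<psi> q x) = indicator (\<Union>q\<in>Q. U q) x" for x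
  proof -
    have "(\<Sum>q\<in>Q. \<psi> q x) = W x / W x" unfolding \<psi>_def W_def by (rule sum_divide_distrib[symmetric])
    then show ?thesis using W_pos[of x] W_nonneg[of x] by (auto simp: indicator_def)
  qed
  define f where "f q x = indicator ?D x * \<psi> q x" for q x
  have [measurable]: "?D \<in> sets borel" by simp
  have f_borel [measurable]: "f q \<in> borel_measurable borel" for q unfolding f_def[abs_def] by measurable
  have f_bound: "\<bar>f q x\<bar> \<le> 1" if "q \<in> Q" for q x
    using \<psi>_bound[OF that, of x] by (simp add: f_def indicator_def)
  have f_supp: "x \<in> U q" if "q \<in> Q" "f q x \<noteq> 0" for q x
    using that(2) w_pos[OF that(1), of x] w_nonneg[of q x] by (auto simp: f_def \<psi>_def less_le)
  have f_cont: "isCont (f q) x" if "q \<in> Q" "x \<in> frontier \<Omega> - sphere p r" for q x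
  proof -
    have "W x \<noteq> 0" using W_pos[of x] that Q(3) by auto
    moreover have "isCont (w q) x" "isCont W x" using w_cont W_cont by (auto simp: continuous_on_eq_continuous_at)
    moreover have "isCont (indicator ?D :: _ \<Rightarrow> real) x" using that by (simp add: isCont_indicator)
    ultimately show ?thesis unfolding f_def[abs_def] \<psi>_def by (intro continuous_intros)
  qed
  define J where "J q x = indicator (frontier \<Omega>) x * (f q x * ((x - p) \<bullet> outward_unit_normal \<Omega> x))" for q x
  have flux: "integrable arc_length (J q)"
    "(\<lambda>n. real n * (LINT x|lborel. f q x * (indicator \<Omega> (shrink p n x) - indicator \<Omega> x))) \<longlonglongrightarrow> (LINT x|arc_length. J q x)"
    if q: "q \<in> Q" for q
  proof -
    have qf: "q \<in> frontier \<Omega>" using q Q by blast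
    have s: "x \<in> lipschitz_chart.inner_box q (u q) (v q) (a q) (b q)" if "f q x \<noteq> 0" for x
      using f_supp[OF q that] by (simp add: U_def)
    note * = lipschitz_chart.chart_flux[OF ch[OF qf] \<Omega>(1) f_borel f_bound[OF q] s f_cont[OF q] fin]
    show "integrable arc_length (J q)" unfolding J_def[abs_def] by (rule *(1))
    show "(\<lambda>n. real n * (LINT x|lborel. f q x * (indicator \<Omega> (shrink p n x) - indicator \<Omega> x))) \<longlonglongrightarrow> (LINT x|arc_length. J q x)"
      unfolding J_def by (rule *(2))
  qed
  have F_eq: "F x = (\<Sum>q\<in>Q. J q x)" for x
  proof -
    have "(\<Sum>q\<in>Q. J q x) = indicator (frontier \<Omega>) x * ((indicator ?D x * (\<Sum>q\<in>Q. \<psi> q x)) * ((x - p) \<bullet> outward_unit_normal \<Omega> x))"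
      unfolding J_def f_def by (simp add: sum_distrib_left sum_distrib_right)
    then show ?thesis using Q(3) unfolding \<psi>_sum F_def by (auto simp: indicator_def)
  qed
  show "integrable arc_length F"
    using flux(1) by (subst F_eq[abs_def]) (intro Bochner_Integration.integrable_sum)
  define k where "k n x = (indicator \<Omega> (shrink p n x) - indicator \<Omega> x :: real)" for n x
  have [measurable]: "k n \<in> borel_measurable borel" for n unfolding k_def[abs_def] by measurable
  have k_bound: "\<bar>k n x\<bar> \<le> 1" for n x by (simp add: k_def indicator_def)
  have int: "integrable lborel (\<lambda>x. f q x * k n x)" if q: "q \<in> Q" for q n
  proof -
    have "integrable lborel (\<lambda>x. indicator ?D x *\<^sub>R (\<psi> q x * k n x))"
    proof (rule integrableI_bounded_set_indicator[where B=1])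
      show "emeasure lborel ?D < \<infinity>" by (rule emeasure_bounded_finite) simp
      show "AE x in lborel. x \<in> ?D \<longrightarrow> norm (\<psi> q x * k n x) \<le> 1"
        using \<psi>_bound[OF q] k_bound by (intro AE_I2) (simp add: abs_mult mult_le_one)
    qed measurable
    then show ?thesis by (simp add: f_def mult.assoc)
  qed
  have off: "\<forall>\<^sub>F n in sequentially. \<forall>x\<in>?D - (\<Union>q\<in>Q. U q). k n x = 0"
  proof -
    have "compact (?D - (\<Union>q\<in>Q. U q))" using U(1) Q(1) by (intro compact_diff open_UN) auto
    moreover have "(?D - (\<Union>q\<in>Q. U q)) \<inter> frontier \<Omega> = {}" using Q(3) by blast
    ultimately obtain d where d: "0 < d" "\<forall>x\<in>?D - (\<Union>q\<in>Q. U q). \<forall>y\<in>frontier \<Omega>. d \<le> dist x y"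
      using separate_compact_closed[of "?D - (\<Union>q\<in>Q. U q)" "frontier \<Omega>"] by auto
    obtain N :: nat where N: "r / d < real N" using reals_Archimedean2 by blast
    show ?thesis
      using eventually_ge_at_top[of N]
    proof eventually_elim
      case (elim n)
      have rd: "r / (real n + 1) < d"
      proof -
        have "r < real N * d" using N d(1) by (simp add: divide_less_eq)
        also have "\<dots> \<le> (real n + 1) * d" using elim d(1) by (intro mult_right_mono) auto
        finally show ?thesis by (simp add: divide_less_eq mult.commute)
      qed
      show ?case
      proof
        fix x assume x: "x \<in> ?D - (\<Union>q\<in>Q. U q)"
        have "dist p x / (real n + 1) \<le> r / (real n + 1)" using x by (intro divide_right_mono) auto
        then have "shrink p n x \<in> \<Omega> \<longleftrightarrow> x \<in> \<Omega>" using d(2) x rd by (intro shrink_mem_iff_near[of \<Omega> d]) auto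
        then show "k n x = 0" by (simp add: k_def indicator_def)
      qed
    qed
  qed
  have split: "\<forall>\<^sub>F n in sequentially. real n * (LINT x|lborel. indicator ?D x * k n x) = (\<Sum>q\<in>Q. real n * (LINT x|lborel. f q x * k n x))"
    using off
  proof eventually_elim
    case (elim n)
    have "indicator ?D x * k n x = (\<Sum>q\<in>Q. f q x * k n x)" for x
    proof -
      have "(\<Sum>q\<in>Q. f q x * k n x) = indicator ?D x * (\<Sum>q\<in>Q. \<psi> q x) * k n x"
        unfolding f_def by (simp add: sum_distrib_left sum_distrib_right)
      then show ?thesis unfolding \<psi>_sum using elim by (auto simp: indicator_def)
    qed
    then show ?case using int by (simp add: sum_distrib_left)
  qed
  have "(\<lambda>n. \<Sum>q\<in>Q. real n * (LINT x|lborel. f q x * k n x)) \<longlonglongrightarrow> (\<Sum>q\<in>Q. LINT x|arc_length. J q x)"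
    using flux(2) unfolding k_def by (intro tendsto_sum)
  moreover have "(\<Sum>q\<in>Q. LINT x|arc_length. J q x) = (LINT x|arc_length. F x)"
    using flux(1) by (simp add: F_eq)
  ultimately have "(\<lambda>n. real n * (LINT x|lborel. indicator ?D x * k n x)) \<longlonglongrightarrow> (LINT x|arc_length. F x)"
    using split by (simp add: tendsto_cong)
  then show "(\<lambda>n. real n * (LINT x|lborel. indicator (cball p r) x * (indicator \<Omega> (shrink p n x) - indicator \<Omega> x)))
      \<longlonglongrightarrow> (LINT x|arc_length. F x)" by (simp add: k_def)
qed

lemma measure_shrink_vimage:
  fixes A :: "(real^2) set"
  assumes n: "0 < n" and A [measurable]: "A \<in> sets borel"
  shows "measure lborel (shrink p n -` A) = ((real n + 1) / real n)\<^sup>2 * measure lborel A"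
proof -
  define \<rho> where "\<rho> = real n / (real n + 1)"
  have \<rho>: "0 < \<rho>" using n by (simp add: \<rho>_def)
  have sh: "shrink p n = (\<lambda>x. (p - \<rho> *\<^sub>R p) + \<rho> *\<^sub>R x)"
    by (simp add: fun_eq_iff shrink_def \<rho>_def algebra_simps)
  have "emeasure lborel A = emeasure (density (distr lborel borel (shrink p n)) (\<lambda>_. ennreal (\<bar>\<rho>\<bar> ^ DIM(real^2)))) A"
    unfolding sh using \<rho> by (subst lborel_affine[of \<rho> "p - \<rho> *\<^sub>R p"]) auto
  also have "\<dots> = ennreal (\<rho>\<^sup>2) * emeasure lborel (shrink p n -` A)"
    using \<rho> by (subst emeasure_density) (auto simp: nn_integral_cmult_indicator emeasure_distr)
  finally have "measure lborel A = \<rho>\<^sup>2 * measure lborel (shrink p n -` A)"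
    by (simp add: measure_def enn2real_mult)
  moreover have "((real n + 1) / real n)\<^sup>2 * \<rho>\<^sup>2 = 1"
    using n by (simp add: \<rho>_def power_mult_distrib[symmetric])
  ultimately show ?thesis by (simp add: mult.assoc[symmetric])
qed

text \<open>
  With \<open>A\<close> the area in the disk and \<open>h n\<close> the area in the annulus between the radii \<open>r n / (n + 1)\<close> and
  \<open>r\<close>, the dilated domain has area \<open>(1 + 1/n)\<^sup>2 (A - h n)\<close> in the disk. The difference quotient
  therefore tends to \<open>2 A\<close> minus the limit of \<open>n h n\<close>.
\<close>

theorem area_flux_arc_identity:
  fixes \<Omega> :: "(real^2) set"
  assumes \<Omega>: "open \<Omega>" "bounded \<Omega>" "lipschitz_boundary \<Omega>" and r: "0 < r"
    and fin: "finite (frontier \<Omega> \<inter> sphere p r)"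
  shows "(LINT x|arc_length. indicator (frontier \<Omega>) x * (indicator (cball p r) x * ((x - p) \<bullet> outward_unit_normal \<Omega> x)))
    = 2 * measure lborel (cball p r \<inter> \<Omega>) - r\<^sup>2 * measure lborel {t \<in> {\<alpha>..<\<alpha> + 2 * pi}. circle_point p r t \<in> \<Omega>}"
proof -
  let ?D = "cball p r"
  define A where "A = measure lborel (?D \<inter> \<Omega>)"
  define \<Theta> where "\<Theta> = measure lborel {t \<in> {\<alpha>..<\<alpha> + 2 * pi}. circle_point p r t \<in> \<Omega>}"
  define h where "h n = measure lborel (\<Omega> \<inter> (?D - cball p (r - r / (real n + 1))))" for n
  have [measurable]: "\<Omega> \<in> sets borel" using \<Omega> by simp
  have fm: "X \<in> fmeasurable lborel" if "X \<subseteq> \<Omega>" "X \<in> sets borel" for X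
  proof (rule fmeasurableI)
    show "emeasure lborel X < \<infinity>" using that \<Omega>(2) bounded_subset by (intro emeasure_bounded_finite) blast
  qed (use that in simp)
  have eq: "real n * (LINT x|lborel. indicator ?D x * (indicator \<Omega> (shrink p n x) - indicator \<Omega> x))
    = (2 + 1 / real n) * A - ((real n + 1) / real n)\<^sup>2 * (real n * h n)" if n: "0 < n" for n
  proof -
    define X where "X = shrink p n -` (\<Omega> \<inter> cball p (r - r / (real n + 1)))"
    have X: "X \<in> sets borel" unfolding X_def using measurable_sets[OF borel_measurable_shrink, of "\<Omega> \<inter> cball p (r - r / (real n + 1))"] by simp
    have memX: "x \<in> X \<longleftrightarrow> shrink p n x \<in> \<Omega> \<and> x \<in> ?D" for x
    proof -
      have "dist p (shrink p n x) = real n / (real n + 1) * dist p x"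
        by (simp add: shrink_def dist_norm norm_minus_commute)
      moreover have "r - r / (real n + 1) = real n / (real n + 1) * r" by (simp add: field_simps)
      moreover have "0 < real n / (real n + 1)" using n by simp
      ultimately show ?thesis
        unfolding X_def vimage_eq Int_iff mem_cball by (simp only: mult_le_cancel_left_pos)
    qed
    have X_sub: "X \<subseteq> ?D" using memX by blast
    have fX: "emeasure lborel X < \<infinity>" using X_sub by (intro emeasure_bounded_finite) (rule bounded_subset[OF bounded_cball])
    have "(LINT x|lborel. indicator ?D x * (indicator \<Omega> (shrink p n x) - indicator \<Omega> x) :: real)
      = (LINT x|lborel. indicator X x - indicator (?D \<inter> \<Omega>) x :: real)"
      by (intro Bochner_Integration.integral_cong) (auto simp: indicator_def memX)
    also have "\<dots> = measure lborel X - A"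
      unfolding A_def using X fX fm[of "?D \<inter> \<Omega>"]
      by (subst Bochner_Integration.integral_diff) (auto simp: fmeasurable_def)
    also have "measure lborel X = ((real n + 1) / real n)\<^sup>2 * measure lborel (\<Omega> \<inter> cball p (r - r / (real n + 1)))"
      unfolding X_def using n by (intro measure_shrink_vimage) auto
    also have "measure lborel (\<Omega> \<inter> cball p (r - r / (real n + 1))) = A - h n"
    proof -
      have "r - r / (real n + 1) \<le> r" using r by simp
      then have "?D \<inter> \<Omega> = (\<Omega> \<inter> cball p (r - r / (real n + 1))) \<union> (\<Omega> \<inter> (?D - cball p (r - r / (real n + 1))))" by auto
      then have "A = measure lborel (\<Omega> \<inter> cball p (r - r / (real n + 1))) + h n"
        unfolding A_def h_def
        using measure_Un3[OF fm fm, of "\<Omega> \<inter> cball p (r - r / (real n + 1))" "\<Omega> \<inter> (?D - cball p (r - r / (real n + 1)))"]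
        by (simp add: Int_Diff Int_ac) 
      then show ?thesis by simp
    qed
    finally have "real n * (LINT x|lborel. indicator ?D x * (indicator \<Omega> (shrink p n x) - indicator \<Omega> x))
      = real n * (((real n + 1) / real n)\<^sup>2 * (A - h n) - A)" by simp
    also have "\<dots> = (2 + 1 / real n) * A - ((real n + 1) / real n)\<^sup>2 * (real n * h n)"
      using n by (simp add: field_simps power2_eq_square)
    finally show ?thesis .
  qed
  have lim: "(\<lambda>n. real n * h n) \<longlonglongrightarrow> r\<^sup>2 * \<Theta>"
    unfolding h_def \<Theta>_def by (rule annulus_limit[OF \<Omega>(1) r fin])
  have inv: "(\<lambda>n. 1 / real n) \<longlonglongrightarrow> 0" by (rule lim_1_over_n)
  have "(\<lambda>n. (2 + 1 / real n) * A - (1 + 1 / real n)\<^sup>2 * (real n * h n)) \<longlonglongrightarrow> (2 + 0) * A - (1 + 0)\<^sup>2 * (r\<^sup>2 * \<Theta>)"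
    by (intro tendsto_diff tendsto_mult[OF _ lim] tendsto_mult tendsto_power tendsto_add tendsto_const inv)
  moreover have "\<forall>\<^sub>F n in sequentially. (2 + 1 / real n) * A - (1 + 1 / real n)\<^sup>2 * (real n * h n)
    = real n * (LINT x|lborel. indicator ?D x * (indicator \<Omega> (shrink p n x) - indicator \<Omega> x))"
    using eventually_gt_at_top[of 0]
  proof eventually_elim
    case (elim n)
    then have "1 + 1 / real n = (real n + 1) / real n" by (simp add: field_simps)
    then show ?case using eq[OF elim] by simp
  qed
  ultimately have "(\<lambda>n. real n * (LINT x|lborel. indicator ?D x * (indicator \<Omega> (shrink p n x) - indicator \<Omega> x)))
    \<longlonglongrightarrow> 2 * A - r\<^sup>2 * \<Theta>" by (simp add: tendsto_cong)
  then show ?thesis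
    using dilation_flux_limit(2)[OF \<Omega> fin] LIMSEQ_unique unfolding A_def \<Theta>_def by blast
qed

text \<open>
  An angle that is no \<open>\<theta> m\<close> lies directly after a last \<open>\<theta> m\<close>, and the parity of \<open>m\<close> decides whether
  it belongs to an arc inside \<open>\<Omega>\<close>.
\<close>

lemma measure_alternating_arcs:
  fixes \<theta> :: "nat \<Rightarrow> real"
  assumes "k \<ge> 1" and mono: "strict_mono_on {1..2*k} \<theta>" and "\<theta> (2*k) < \<theta> 1 + 2 * pi"
    and F: "finite {t \<in> {\<theta> 1..<\<theta> 1 + 2 * pi}. circle_point p r t \<in> F}"
    and arcs: "\<And>i t. i \<in> {1..k} \<Longrightarrow> \<theta> (2*i - 1) < t \<Longrightarrow> t < \<theta> (2*i) \<Longrightarrow>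
           circle_point p r t \<notin> F \<Longrightarrow> circle_point p r t \<in> \<Omega>"
    and gaps: "\<And>i t. i \<in> {1..<k} \<Longrightarrow> \<theta> (2*i) < t \<Longrightarrow> t < \<theta> (2*i + 1) \<Longrightarrow>
           circle_point p r t \<notin> F \<Longrightarrow> circle_point p r t \<notin> \<Omega>"
    and last_gap: "\<And>t. \<theta> (2*k) < t \<Longrightarrow> t < \<theta> 1 + 2 * pi \<Longrightarrow>
           circle_point p r t \<notin> F \<Longrightarrow> circle_point p r t \<notin> \<Omega>"
    and \<Omega>: "\<Omega> \<in> sets borel"
  shows "measure lborel {t \<in> {\<theta> 1..<\<theta> 1 + 2 * pi}. circle_point p r t \<in> \<Omega>} = (\<Sum>i=1..k. \<theta> (2*i) - \<theta> (2*i - 1))"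
proof -
  let ?X = "{t \<in> {\<theta> 1..<\<theta> 1 + 2 * pi}. circle_point p r t \<in> \<Omega>}"
  let ?U = "\<Union>i\<in>{1..k}. {\<theta> (2*i - 1)<..<\<theta> (2*i)}"
  have less: "\<theta> i < \<theta> j" if "1 \<le> i" "i < j" "j \<le> 2*k" for i j
    using mono that by (auto simp: strict_mono_on_def)
  have le: "\<theta> i \<le> \<theta> j" if "1 \<le> i" "i \<le> j" "j \<le> 2*k" for i j
    using less[of i j] that by (cases "i = j") auto
  define N where "N = {t \<in> {\<theta> 1..<\<theta> 1 + 2 * pi}. circle_point p r t \<in> F} \<union> \<theta> ` {1..2*k}"
  have N: "finite N" using F by (simp add: N_def)
  have mem: "t \<in> ?X \<longleftrightarrow> t \<in> ?U" if t: "t \<notin> N" for t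
  proof
    assume tX: "t \<in> ?X"
    then have nF: "circle_point p r t \<notin> F" using t by (auto simp: N_def)
    define M where "M = {m \<in> {1..2*k}. \<theta> m \<le> t}"
    have M: "finite M" "1 \<in> M" using tX \<open>k \<ge> 1\<close> by (auto simp: M_def)
    define m where "m = Max M"
    have "m \<in> M" unfolding m_def using M by (intro Max_in) auto
    then have m: "1 \<le> m" "m \<le> 2*k" "\<theta> m < t" using t by (auto simp: M_def N_def less_le)
    have next_m: "t < \<theta> (m + 1)" if "m < 2*k"
    proof (rule ccontr)
      assume "\<not> t < \<theta> (m + 1)"
      then have "m + 1 \<in> M" using that by (auto simp: M_def)
      then show False using Max_ge[OF M(1)] unfolding m_def by fastforce
    qed
    have "m < 2*k" using last_gap[of t] m nF tX by (cases "m = 2*k") auto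
    show "t \<in> ?U"
    proof (cases "even m")
      case True
      then obtain i where i: "m = 2 * i" by blast
      have "circle_point p r t \<notin> \<Omega>" using gaps[of i t] nF m next_m \<open>m < 2*k\<close> i by auto
      then show ?thesis using tX by simp
    next
      case False
      then obtain i where i: "m = 2 * i + 1" by (rule oddE)
      have "t \<in> {\<theta> (2*(i+1) - 1)<..<\<theta> (2*(i+1))}" using m next_m \<open>m < 2*k\<close> i by simp
      moreover have "i + 1 \<in> {1..k}" using \<open>m < 2*k\<close> i by simp
      ultimately show ?thesis by blast
    qed
  next
    assume "t \<in> ?U"
    then obtain i where i: "i \<in> {1..k}" "\<theta> (2*i - 1) < t" "t < \<theta> (2*i)" by auto
    have "\<theta> 1 \<le> \<theta> (2*i - 1)" "\<theta> (2*i) \<le> \<theta> (2*k)" using i by (auto intro!: le)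
    then have range: "t \<in> {\<theta> 1..<\<theta> 1 + 2 * pi}" using i assms(3) by auto
    then have "circle_point p r t \<notin> F" using t by (auto simp: N_def)
    then show "t \<in> ?X" using arcs[OF i] range by simp
  qed
  have [measurable]: "\<Omega> \<in> sets borel" by (rule \<Omega>)
  have [measurable]: "circle_point p r \<in> borel_measurable borel"
    unfolding circle_point_eq[abs_def] by (intro borel_measurable_continuous_onI continuous_intros)
  have "AE t in lborel. t \<notin> N" using finite_imp_null_set_lborel[OF N] by (rule AE_not_in)
  then have "AE t in lborel. t \<in> ?X \<longleftrightarrow> t \<in> ?U" by eventually_elim (rule mem)
  then have "measure lborel ?X = measure lborel ?U"
    by (intro measure_eq_AE) auto
  also have "\<dots> = (\<Sum>i=1..k. measure lborel {\<theta> (2*i - 1)<..<\<theta> (2*i)})"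
  proof (rule measure_finite_Union)
    show "disjoint_family_on (\<lambda>i. {\<theta> (2*i - 1)<..<\<theta> (2*i)}) {1..k}"
    proof -
      have "{\<theta> (2*i - 1)<..<\<theta> (2*i)} \<inter> {\<theta> (2*j - 1)<..<\<theta> (2*j)} = {}" if "1 \<le> i" "i < j" "j \<le> k" for i j
      proof -
        have "\<theta> (2*i) \<le> \<theta> (2*j - 1)" using that by (intro le) auto
        then show ?thesis by auto
      qed
      then show ?thesis unfolding disjoint_family_on_def by (metis Int_commute atLeastAtMost_iff linorder_neqE_nat)
    qed
    fix i assume i: "i \<in> {1..k}"
    then have "\<theta> (2*i - 1) \<le> \<theta> (2*i)" by (intro le) auto
    then show "emeasure lborel {\<theta> (2*i - 1)<..<\<theta> (2*i)} \<noteq> \<infinity>" by simp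
  qed auto
  also have "\<dots> = (\<Sum>i=1..k. \<theta> (2*i) - \<theta> (2*i - 1))"
    using le by (intro sum.cong) auto
  finally show ?thesis .
qed

theorem mainTheorem3:
  fixes \<Omega> C :: "(real^2) set" and p :: "real^2" and r :: real
    and V :: "real^2 \<Rightarrow> real^2" and k :: nat and \<theta> :: "nat \<Rightarrow> real"
    and ignored :: "(real^2) set"
  assumes "open \<Omega>" and "connected \<Omega>" and "bounded \<Omega>" and "lipschitz_boundary \<Omega>"
    and C: "C = frontier \<Omega>"
    and "p \<in> C" and "r > 0"
    and V: "\<And>x. V x = (1/2) *\<^sub>R (x - p)"
    and "finite (C \<inter> sphere p r)"
    and ignored: "ignored = {q \<in> C \<inter> sphere p r. one_sided_at C p r q}"
    and "k \<ge> 1"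
    and "strict_mono_on {1..2*k} \<theta>" and "\<theta> (2*k) < \<theta> 1 + 2 * pi"
    and "C \<inter> sphere p r - ignored = (\<lambda>i. circle_point p r (\<theta> i)) ` {1..2*k}"
    and "\<And>i t. i \<in> {1..k} \<Longrightarrow> \<theta> (2*i - 1) < t \<Longrightarrow> t < \<theta> (2*i) \<Longrightarrow>
           circle_point p r t \<notin> ignored \<Longrightarrow> circle_point p r t \<in> \<Omega>"
    and "\<And>i t. i \<in> {1..<k} \<Longrightarrow> \<theta> (2*i) < t \<Longrightarrow> t < \<theta> (2*i + 1) \<Longrightarrow>
           circle_point p r t \<notin> ignored \<Longrightarrow> circle_point p r t \<notin> \<Omega>"
    and "\<And>t. \<theta> (2*k) < t \<Longrightarrow> t < \<theta> 1 + 2 * pi \<Longrightarrow>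
           circle_point p r t \<notin> ignored \<Longrightarrow> circle_point p r t \<notin> \<Omega>"
  shows "set_integrable arc_length (C \<inter> cball p r) (\<lambda>x. V x \<bullet> outward_unit_normal \<Omega> x) \<and>
    circular_area_invariant \<Omega> r p =
      (LINT x:C \<inter> cball p r|arc_length. V x \<bullet> outward_unit_normal \<Omega> x)
      + r^2 / 2 * (\<Sum>i=1..k. \<theta> (2*i) - \<theta> (2*i - 1))"
proof -
  let ?F = "\<lambda>x. indicator (frontier \<Omega>) x * (indicator (cball p r) x * ((x - p) \<bullet> outward_unit_normal \<Omega> x)) :: real"
  have fin: "finite (frontier \<Omega> \<inter> sphere p r)" using assms(9) C by simp
  have \<Omega>: "\<Omega> \<in> sets borel" using assms(1) by simp
  have half: "indicator (C \<inter> cball p r) x *\<^sub>R (V x \<bullet> outward_unit_normal \<Omega> x) = (1/2) * ?F x" for x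
    unfolding V C by (simp add: indicator_def)
  have int: "integrable arc_length ?F"
    by (rule dilation_flux_limit(1)[OF assms(1,3,4) fin])
  have ignored_fin: "finite {t \<in> {\<theta> 1..<\<theta> 1 + 2 * pi}. circle_point p r t \<in> ignored}"
    using assms(9) by (intro finite_circle_angles[OF \<open>r > 0\<close>]) (auto simp: ignored intro: rev_finite_subset)
  have arcs: "measure lborel {t \<in> {\<theta> 1..<\<theta> 1 + 2 * pi}. circle_point p r t \<in> \<Omega>} = (\<Sum>i=1..k. \<theta> (2*i) - \<theta> (2*i - 1))"
    using assms(11-13) ignored_fin assms(15-17) \<Omega> by (rule measure_alternating_arcs)
  have "(LINT x:C \<inter> cball p r|arc_length. V x \<bullet> outward_unit_normal \<Omega> x) = 1/2 * (LINT x|arc_length. ?F x)"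
    unfolding set_lebesgue_integral_def half by (rule integral_mult_right_zero)
  also have "(LINT x|arc_length. ?F x) = 2 * measure lborel (cball p r \<inter> \<Omega>)
      - r\<^sup>2 * (\<Sum>i=1..k. \<theta> (2*i) - \<theta> (2*i - 1))"
    using area_flux_arc_identity[OF assms(1,3,4,7) fin, of "\<theta> 1"] by (simp only: arcs)
  finally have "circular_area_invariant \<Omega> r p =
      (LINT x:C \<inter> cball p r|arc_length. V x \<bullet> outward_unit_normal \<Omega> x)
      + r^2 / 2 * (\<Sum>i=1..k. \<theta> (2*i) - \<theta> (2*i - 1))"
    using \<Omega> by (simp add: circular_area_invariant_def measure_completion algebra_simps)
  moreover have "set_integrable arc_length (C \<inter> cball p r) (\<lambda>x. V x \<bullet> outward_unit_normal \<Omega> x)"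
    unfolding set_integrable_def half using int by (rule integrable_mult_right)
  ultimately show ?thesis by blast
qed

end
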